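(* Let $X$ be an infinite-dimensional complex Banach space and $T\in L(X)$. The following conditions are equivalent: (i) there exists a pair $(M,N)$ of closed $T$-invariant subspaces with $X=M\oplus N$ such that $T_M$ is invertible and $T_N$ is Riesz; (ii) $T$ admits a GKRD and $0\notin \operatorname{int}\sigma(T)$; (iii) $T$ admits a GKRD and both $T$ and its adjoint $T'$ have the SVEP at $0$; (iv) $T$ is generalized Drazin-Riesz invertible; (v) $T$ is Riesz-quasipolar; (vi) there exists a bounded projection $P$ on $X$ commuting with $T$ such that $T+P$ is Browder and $TP$ is Riesz; (vii) there exists a pair $(M,N)$ of closed $T$-invariant subspaces with $X=M\oplus N$ such that $T_M$ is Browder and $T_N$ is Riesz; (viii) $T$ admits a GKRD and $0\notin\operatorname{acc}\sigma_{\mathcal B}(T)$; (ix) $T$ admits a GKRD and $0\notin\operatorname{int}\sigma_{\mathcal B}(T)$.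
   Context: $L(X)$ is the algebra of bounded operators on $X$, $N(S)$ and $R(S)$ kernel and range. $S$ is Kato if $R(S)$ is closed and $N(S)\subset R(S^n)$ for all $n\in\mathbb N$. $S$ is Riesz if $S-\lambda$ is Fredholm for all $\lambda\ne0$. $S$ is Browder if it is Fredholm with finite ascent and finite descent. For closed $T$-invariant $M,N$ with $X=M\oplus N$, $T_M,T_N$ are the restrictions; $T$ admits a GKRD (generalized Kato-Riesz decomposition) if there is such a pair with $T_M$ Kato and $T_N$ Riesz. $\sigma(T)$ is the spectrum, $\sigma_{\mathcal B}(T)=\{\lambda\in\mathbb C: T-\lambda \text{ not Browder}\}$; $\operatorname{int}K$ and $\operatorname{acc}K$ denote the interior and the set of accumulation points of $K\subset\mathbb C$. $T$ has the SVEP at $\lambda_0$ if for every open disc $D$ centered at $\lambda_0$ the only analytic $f:D\to X$ with $(T-\lambda)f(\lambda)=0$ on $D$ is $f\equiv0$. $T$ is generalized Drazin-Riesz invertible if there is $S\in L(X)$ with $TS=ST$, $STS=S$ and $TST-T$ Riesz. $T$ is Riesz-quasipolar if there is a bounded projection $Q$ with $TQ=QT$, $T(I-Q)$ Riesz, and $Q\in (L(X)T)\cap(TL(X))$. *)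

theory Defs
  imports "HOL-Analysis.Analysis"
begin

class cbanach = banach +
  fixes scaleC :: "complex \<Rightarrow> 'a \<Rightarrow> 'a" (infixr \<open>*\<^sub>C\<close> 75)
  assumes scaleC_of_real: "scaleC (complex_of_real r) x = scaleR r x"
    and scaleC_add_right: "scaleC a (x + y) = scaleC a x + scaleC a y"
    and scaleC_add_left: "scaleC (a + b) x = scaleC a x + scaleC b x"
    and scaleC_scaleC: "scaleC a (scaleC b x) = scaleC (a * b) x"
    and scaleC_one: "scaleC 1 x = x"
    and norm_scaleC: "norm (scaleC a x) = cmod a * norm x"

definition clinear :: "('a::cbanach \<Rightarrow> 'b::cbanach) \<Rightarrow> bool" where
  "clinear T \<longleftrightarrow> (\<forall>x y. T (x + y) = T x + T y) \<and> (\<forall>c x. T (c *\<^sub>C x) = c *\<^sub>C T x)"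

definition bounded_clinear :: "('a::cbanach \<Rightarrow> 'b::cbanach) \<Rightarrow> bool" where
  "bounded_clinear T \<longleftrightarrow> clinear T \<and> (\<exists>K. \<forall>x. norm (T x) \<le> norm x * K)"

definition csubspace :: "'a::cbanach set \<Rightarrow> bool" where
  "csubspace M \<longleftrightarrow> 0 \<in> M \<and> (\<forall>x\<in>M. \<forall>y\<in>M. x + y \<in> M) \<and> (\<forall>c. \<forall>x\<in>M. c *\<^sub>C x \<in> M)"

definition cspan :: "'a::cbanach set \<Rightarrow> 'a set" where
  "cspan B = {\<Sum>b\<in>B. c b *\<^sub>C b | c. True}"

definition fin_cdim :: "'a::cbanach set \<Rightarrow> bool" where
  "fin_cdim V \<longleftrightarrow> (\<exists>B. finite B \<and> V = cspan B)"

definition closed_direct_sum :: "'a::cbanach set \<Rightarrow> 'a set \<Rightarrow> bool" where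
  "closed_direct_sum M N \<longleftrightarrow> csubspace M \<and> csubspace N \<and> closed M \<and> closed N \<and>
     M \<inter> N = {0} \<and> (\<forall>x. \<exists>m\<in>M. \<exists>n\<in>N. x = m + n)"

definition invariant :: "('a \<Rightarrow> 'a) \<Rightarrow> 'a set \<Rightarrow> bool" where
  "invariant T M \<longleftrightarrow> T ` M \<subseteq> M"

text \<open>All notions below are stated for the restriction \<open>S_M\<close> of \<open>S\<close> to a (closed, \<open>S\<close>-invariant)
  subspace \<open>M\<close>, viewed as an operator on the Banach space \<open>M\<close>; taking \<open>M = UNIV\<close> gives the
  notions for \<open>S \<in> L(X)\<close> itself.\<close>

definition ker_on :: "'a set \<Rightarrow> ('a \<Rightarrow> 'a::cbanach) \<Rightarrow> 'a set" where
  "ker_on M S = {x\<in>M. S x = 0}"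

definition shift :: "('a::cbanach \<Rightarrow> 'a) \<Rightarrow> complex \<Rightarrow> 'a \<Rightarrow> 'a" where
  "shift S \<mu> = (\<lambda>x. S x - \<mu> *\<^sub>C x)"

definition invertible_on :: "'a set \<Rightarrow> ('a \<Rightarrow> 'a::cbanach) \<Rightarrow> bool" where
  "invertible_on M S \<longleftrightarrow> (\<exists>R. (\<forall>x\<in>M. R x \<in> M \<and> R (S x) = x \<and> S (R x) = x) \<and>
      (\<forall>x\<in>M. \<forall>y\<in>M. R (x + y) = R x + R y) \<and> (\<forall>c. \<forall>x\<in>M. R (c *\<^sub>C x) = c *\<^sub>C R x) \<and>
      (\<exists>K. \<forall>x\<in>M. norm (R x) \<le> norm x * K))"

definition Fredholm_on :: "'a set \<Rightarrow> ('a \<Rightarrow> 'a::cbanach) \<Rightarrow> bool" where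
  "Fredholm_on M S \<longleftrightarrow> fin_cdim (ker_on M S) \<and> closed (S ` M) \<and>
     (\<exists>F. fin_cdim F \<and> F \<subseteq> M \<and> (\<forall>x\<in>M. \<exists>y\<in>S ` M. \<exists>f\<in>F. x = y + f))"

definition Riesz_on :: "'a set \<Rightarrow> ('a \<Rightarrow> 'a::cbanach) \<Rightarrow> bool" where
  "Riesz_on M S \<longleftrightarrow> (\<forall>\<mu>. \<mu> \<noteq> 0 \<longrightarrow> Fredholm_on M (shift S \<mu>))"

definition Kato_on :: "'a set \<Rightarrow> ('a \<Rightarrow> 'a::cbanach) \<Rightarrow> bool" where
  "Kato_on M S \<longleftrightarrow> closed (S ` M) \<and> (\<forall>n. ker_on M S \<subseteq> (S ^^ n) ` M)"

definition finite_ascent_on :: "'a set \<Rightarrow> ('a \<Rightarrow> 'a::cbanach) \<Rightarrow> bool" where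
  "finite_ascent_on M S \<longleftrightarrow> (\<exists>p. ker_on M (S ^^ p) = ker_on M (S ^^ Suc p))"

definition finite_descent_on :: "'a set \<Rightarrow> ('a \<Rightarrow> 'a::cbanach) \<Rightarrow> bool" where
  "finite_descent_on M S \<longleftrightarrow> (\<exists>q. (S ^^ q) ` M = (S ^^ Suc q) ` M)"

definition Browder_on :: "'a set \<Rightarrow> ('a \<Rightarrow> 'a::cbanach) \<Rightarrow> bool" where
  "Browder_on M S \<longleftrightarrow> Fredholm_on M S \<and> finite_ascent_on M S \<and> finite_descent_on M S"

abbreviation Riesz :: "('a \<Rightarrow> 'a::cbanach) \<Rightarrow> bool" where "Riesz S \<equiv> Riesz_on UNIV S"
abbreviation Browder :: "('a \<Rightarrow> 'a::cbanach) \<Rightarrow> bool" where "Browder S \<equiv> Browder_on UNIV S"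

definition GKRD :: "('a::cbanach \<Rightarrow> 'a) \<Rightarrow> bool" where
  "GKRD T \<longleftrightarrow> (\<exists>M N. closed_direct_sum M N \<and> invariant T M \<and> invariant T N \<and>
                     Kato_on M T \<and> Riesz_on N T)"

definition cspectrum :: "('a::cbanach \<Rightarrow> 'a) \<Rightarrow> complex set" where
  "cspectrum T = {\<mu>. \<not> invertible_on UNIV (shift T \<mu>)}"

definition Browder_spectrum :: "('a::cbanach \<Rightarrow> 'a) \<Rightarrow> complex set" where
  "Browder_spectrum T = {\<mu>. \<not> Browder (shift T \<mu>)}"

definition analytic_on_X :: "complex set \<Rightarrow> (complex \<Rightarrow> 'a::cbanach) \<Rightarrow> bool" where
  "analytic_on_X D f \<longleftrightarrow> (\<forall>z\<in>D. \<exists>r>0. ball z r \<subseteq> D \<and>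
      (\<exists>c::nat \<Rightarrow> 'a. \<forall>w\<in>ball z r. (\<lambda>n. ((w - z) ^ n) *\<^sub>C c n) sums f w))"

definition SVEP_at :: "('a::cbanach \<Rightarrow> 'a) \<Rightarrow> complex \<Rightarrow> bool" where
  "SVEP_at T \<mu>\<^sub>0 \<longleftrightarrow> (\<forall>r>0. \<forall>f. analytic_on_X (ball \<mu>\<^sub>0 r) f \<and>
       (\<forall>\<mu>\<in>ball \<mu>\<^sub>0 r. T (f \<mu>) - \<mu> *\<^sub>C f \<mu> = 0) \<longrightarrow> (\<forall>\<mu>\<in>ball \<mu>\<^sub>0 r. f \<mu> = 0))"

definition bounded_cfunctional :: "('a::cbanach \<Rightarrow> complex) \<Rightarrow> bool" where
  "bounded_cfunctional \<phi> \<longleftrightarrow> (\<forall>x y. \<phi> (x + y) = \<phi> x + \<phi> y) \<and> (\<forall>c x. \<phi> (c *\<^sub>C x) = c * \<phi> x) \<and>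
      (\<exists>K. \<forall>x. cmod (\<phi> x) \<le> norm x * K)"

definition dual_norm :: "('a::cbanach \<Rightarrow> complex) \<Rightarrow> real" where
  "dual_norm \<phi> = Sup ((\<lambda>x. cmod (\<phi> x)) ` {x. norm x \<le> 1})"

definition analytic_on_dual :: "complex set \<Rightarrow> (complex \<Rightarrow> 'a::cbanach \<Rightarrow> complex) \<Rightarrow> bool" where
  "analytic_on_dual D f \<longleftrightarrow> (\<forall>w\<in>D. bounded_cfunctional (f w)) \<and>
     (\<forall>z\<in>D. \<exists>r>0. ball z r \<subseteq> D \<and>
       (\<exists>c::nat \<Rightarrow> 'a \<Rightarrow> complex. (\<forall>n. bounded_cfunctional (c n)) \<and>
          (\<forall>w\<in>ball z r. (\<lambda>N. dual_norm (\<lambda>x. f w x - (\<Sum>n<N. (w - z) ^ n * c n x))) \<longlonglongrightarrow> 0)))"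

definition SVEP_adjoint_at :: "('a::cbanach \<Rightarrow> 'a) \<Rightarrow> complex \<Rightarrow> bool" where
  "SVEP_adjoint_at T \<mu>\<^sub>0 \<longleftrightarrow> (\<forall>r>0. \<forall>f. analytic_on_dual (ball \<mu>\<^sub>0 r) f \<and>
       (\<forall>\<mu>\<in>ball \<mu>\<^sub>0 r. \<forall>x. f \<mu> (T x) - \<mu> * f \<mu> x = 0) \<longrightarrow> (\<forall>\<mu>\<in>ball \<mu>\<^sub>0 r. \<forall>x. f \<mu> x = 0))"

definition gen_Drazin_Riesz_invertible :: "('a::cbanach \<Rightarrow> 'a) \<Rightarrow> bool" where
  "gen_Drazin_Riesz_invertible T \<longleftrightarrow> (\<exists>S. bounded_clinear S \<and> T \<circ> S = S \<circ> T \<and> S \<circ> T \<circ> S = S \<and>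
      Riesz (\<lambda>x. T (S (T x)) - T x))"

definition Riesz_quasipolar :: "('a::cbanach \<Rightarrow> 'a) \<Rightarrow> bool" where
  "Riesz_quasipolar T \<longleftrightarrow> (\<exists>Q. bounded_clinear Q \<and> Q \<circ> Q = Q \<and> T \<circ> Q = Q \<circ> T \<and>
      Riesz (\<lambda>x. T (x - Q x)) \<and>
      (\<exists>A. bounded_clinear A \<and> Q = A \<circ> T) \<and> (\<exists>B. bounded_clinear B \<and> Q = T \<circ> B))"

end

(*
The core is a statement about a Kato operator A on a Banach space: if A - mu is bijective for
arbitrarily small mu, then A is bijective. Indeed a kernel vector x extends to a chain
x = x_0, A x_(n+1) = x_n with geometrically bounded norms, and the sum of mu^n x_n is then an
eigenvector of A for every small mu; so A is injective, bounded below, and a small perturbation of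
the bijective operators A - mu. Applied to the Kato part of a GKRD, this yields (i) from (ii), (viii)
and (ix). The same chain, and its dual built with the Hahn-Banach theorem, violate the SVEP of T
and of its adjoint unless the Kato part is bijective.

For a Fredholm operator B the restriction to the range of B^p is Kato once p is large. Hence if B
is a limit of invertible B - mu, it has finite ascent and descent, and B - mu is invertible in a
punctured neighbourhood of 0. A connectedness argument in the punctured plane then shows that all
T - mu with mu nonzero are Browder when T is Riesz; no index theory is needed.
*)

theory Submission
  imports Defs
begin

text \<open>All conditions are compared with \<open>Riesz_decomposable\<close>, which is (i) with
  bijectivity in place of a bounded inverse. Restrictions are not turned into operators on a new
  space: a subspace and the ambient operator are carried along, so the open mapping argument is
  needed for images of closed subspaces. In (vii) the decomposition itself has to change: a Browder
  part splits into a bijective part, the range of a power, and a nilpotent part. The latter moves to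
  the Riesz summand and does no harm there, because its shift by any nonzero scalar is bijective.
  For (iii) the obstacle is that analyticity asks for an expansion about every point of the disc,
  while a chain gives one series about 0. Hence power series are re-expanded with explicit remainder
  bounds, strong enough for convergence in the dual norm. Conversely, there are regular points
  arbitrarily close to 0, at which the eigenvalue equation forces the analytic function to vanish;
  the identity theorem does the rest, and for the adjoint it is applied to the scalar functions
  obtained by evaluating at a fixed vector.\<close>

section \<open>Complex subspaces and finite dimension\<close>

interpretation cvs: vector_space "scaleC :: complex \<Rightarrow> 'a::cbanach \<Rightarrow> 'a"
  by unfold_locales (simp_all add: scaleC_add_right scaleC_add_left scaleC_scaleC scaleC_one)

lemma csubspace_iff: "csubspace M \<longleftrightarrow> cvs.subspace M"
  by (auto simp: csubspace_def cvs.subspace_def)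

lemma csubspace_0: "csubspace M \<Longrightarrow> 0 \<in> M"
  and csubspace_add: "csubspace M \<Longrightarrow> x \<in> M \<Longrightarrow> y \<in> M \<Longrightarrow> x + y \<in> M"
  and csubspace_scale: "csubspace M \<Longrightarrow> x \<in> M \<Longrightarrow> c *\<^sub>C x \<in> M"
  by (auto simp: csubspace_def)

lemma csubspace_diff: "csubspace M \<Longrightarrow> x \<in> M \<Longrightarrow> y \<in> M \<Longrightarrow> x - y \<in> M"
  by (simp add: csubspace_iff cvs.subspace_diff)

lemma csubspace_minus: "csubspace M \<Longrightarrow> x \<in> M \<Longrightarrow> - x \<in> M"
  by (simp add: csubspace_iff cvs.subspace_neg)

lemma csubspace_sum: "csubspace M \<Longrightarrow> (\<And>i. i \<in> I \<Longrightarrow> f i \<in> M) \<Longrightarrow> sum f I \<in> M"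
  by (simp add: csubspace_iff cvs.subspace_sum)

lemma csubspace_imp_subspace: "csubspace M \<Longrightarrow> subspace M"
  unfolding csubspace_def subspace_def by (metis scaleC_of_real)

lemma csubspace_UNIV: "csubspace UNIV"
  by (simp add: csubspace_def)

lemma cspan_eq_span: "finite B \<Longrightarrow> cspan B = cvs.span B"
  by (auto simp: cspan_def cvs.span_finite)

lemma fin_cdim_iff: "fin_cdim V \<longleftrightarrow> (\<exists>B. finite B \<and> V = cvs.span B)"
  unfolding fin_cdim_def using cspan_eq_span by metis

lemma fin_cdim_subset:
  assumes "fin_cdim V" "csubspace W" "W \<subseteq> V"
  shows "fin_cdim W"
proof -
  obtain B where B: "finite B" "V = cvs.span B" using assms by (auto simp: fin_cdim_iff)
  obtain C where C: "C \<subseteq> W" "cvs.independent C" "W \<subseteq> cvs.span C"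
    using cvs.maximal_independent_subset by blast
  have "finite C" using cvs.independent_span_bound[of B C] B C assms by blast
  moreover have "cvs.span C = W"
    using C assms(2) by (metis antisym csubspace_iff cvs.span_minimal)
  ultimately show ?thesis by (auto simp: fin_cdim_iff)
qed

lemma fin_cdim_zero: "fin_cdim {0}"
  unfolding fin_cdim_iff by (rule exI[of _ "{}"]) auto

text \<open>A strict inclusion lowers the dimension. A chain may pause and drop again later, so
  \<open>p\<close> is chosen with least dimension among all members and not at the first
  repetition.\<close>

lemma fin_cdim_chain_stable:
  assumes "fin_cdim (V 0)" "\<And>n. csubspace (V n)" "\<And>n. V (Suc n) \<subseteq> V n"
  obtains p where "\<And>n. n \<ge> p \<Longrightarrow> V n = V p"
proof -
  have dec: "V n \<subseteq> V m" if "m \<le> n" for m n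
    using that assms(3) by (rule_tac lift_Suc_antimono_le[of V]) auto
  have fin: "fin_cdim (V n)" for n
    using fin_cdim_subset[OF assms(1) assms(2)] dec by blast
  define d where "d n = cvs.dim (V n)" for n
  define p where "p = (ARG_MIN d n. True)"
  have dmin: "d p \<le> d n" for n
    unfolding p_def by (rule arg_min_nat_le) simp
  have "V n = V p" if "n \<ge> p" for n
  proof (rule ccontr)
    assume "V n \<noteq> V p"
    then obtain x where x: "x \<in> V p" "x \<notin> V n" using dec[OF \<open>p \<le> n\<close>] by auto
    obtain C where C: "C \<subseteq> V n" "cvs.independent C" "V n \<subseteq> cvs.span C" "card C = d n"
      using cvs.basis_exists unfolding d_def by blast
    obtain B where B: "finite B" "V p = cvs.span B" using fin by (auto simp: fin_cdim_iff)
    have spC: "cvs.span C = V n"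
      using C(1,3) assms(2)[of n] cvs.span_minimal[of C "V n"] by (simp add: csubspace_iff subset_antisym)
    have ind: "cvs.independent (insert x C)"
      using x(2) by (intro cvs.independent_insertI C(2)) (simp add: spC)
    have sub: "insert x C \<subseteq> V p" using x(1) C(1) dec[OF \<open>p \<le> n\<close>] by simp
    then have fi: "finite (insert x C)" using cvs.independent_span_bound[OF B(1) ind] B(2) by simp
    obtain D where D: "insert x C \<subseteq> D" "D \<subseteq> V p" "cvs.independent D" "V p \<subseteq> cvs.span D"
      using cvs.maximal_independent_subset_extend[OF sub ind] by blast
    have "finite D" using cvs.independent_span_bound[OF B(1) D(3)] D(2) B(2) by simp
    have "d p = card D" unfolding d_def using cvs.basis_card_eq_dim[OF D(2,4,3)] by simp
    also have "\<dots> \<ge> card (insert x C)" using D \<open>finite D\<close> by (intro card_mono) auto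
    also have "card (insert x C) = Suc (d n)"
    proof -
      have "x \<notin> C" using x(2) C(1) by auto
      then show ?thesis using fi C(4) by simp
    qed
    finally show False using dmin[of n] by simp
  qed
  then show thesis using that by blast
qed

section \<open>Complex linear and bounded operators\<close>

lemma clinear_iff: "clinear T \<longleftrightarrow> Vector_Spaces.linear scaleC scaleC T"
  by (auto simp: clinear_def Vector_Spaces.linear_iff cvs.vector_space_axioms)

lemma clinear_imp_linear: "clinear T \<Longrightarrow> linear T"
  by (rule linearI) (auto simp: clinear_def simp flip: scaleC_of_real)

lemma bounded_clinear_clinear: "bounded_clinear T \<Longrightarrow> clinear T"
  by (simp add: bounded_clinear_def)

lemma bounded_clinear_linear: "bounded_clinear T \<Longrightarrow> bounded_linear T"
  unfolding bounded_clinear_def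
  by (meson bounded_linear.intro bounded_linear_axioms.intro clinear_imp_linear)

lemma clinear_add: "clinear T \<Longrightarrow> T (x + y) = T x + T y"
  and clinear_scale: "clinear T \<Longrightarrow> T (c *\<^sub>C x) = c *\<^sub>C T x"
  by (auto simp: clinear_def)

lemma clinear_0: "clinear T \<Longrightarrow> T 0 = 0"
  and clinear_diff: "clinear T \<Longrightarrow> T (x - y) = T x - T y"
  and clinear_minus: "clinear T \<Longrightarrow> T (- x) = - T x"
  by (simp_all add: clinear_imp_linear linear_0 linear_diff linear_neg)

lemma clinear_compose: "clinear S \<Longrightarrow> clinear T \<Longrightarrow> clinear (\<lambda>x. S (T x))"
  by (simp add: clinear_def)

lemma clinear_funpow: "clinear (T :: 'a::cbanach \<Rightarrow> 'a) \<Longrightarrow> clinear (T ^^ n)"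
proof (induction n)
  case (Suc n)
  then show ?case using clinear_compose[of T "T ^^ n"] by (simp add: o_def)
qed (simp add: clinear_def)

lemma bounded_clinearI:
  assumes "clinear T" "bounded_linear T"
  shows "bounded_clinear T"
  unfolding bounded_clinear_def using assms bounded_linear.bounded by blast

lemma bounded_clinear_scaleC: "bounded_clinear (\<lambda>x. c *\<^sub>C x)"
  unfolding bounded_clinear_def
proof
  show "clinear (\<lambda>x. c *\<^sub>C x)" by (auto simp: clinear_def scaleC_add_right scaleC_scaleC mult.commute)
  show "\<exists>K. \<forall>x. norm (c *\<^sub>C x) \<le> norm x * K" by (auto simp: norm_scaleC mult.commute intro!: exI[of _ "cmod c"])
qed

lemma bounded_clinear_compose:
  assumes "bounded_clinear S" "bounded_clinear T"
  shows "bounded_clinear (\<lambda>x. S (T x))"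
  using assms bounded_linear_compose[of S T]
  by (intro bounded_clinearI) (auto intro: clinear_compose bounded_clinear_clinear bounded_clinear_linear)

lemma bounded_clinear_add:
  assumes "bounded_clinear S" "bounded_clinear T"
  shows "bounded_clinear (\<lambda>x. S x + T x)"
proof (rule bounded_clinearI)
  show "clinear (\<lambda>x. S x + T x)"
    using assms by (auto simp: bounded_clinear_def clinear_def scaleC_add_right)
qed (use assms in \<open>intro bounded_linear_add bounded_clinear_linear\<close>)

lemma bounded_clinear_diff:
  assumes "bounded_clinear S" "bounded_clinear T"
  shows "bounded_clinear (\<lambda>x. S x - T x)"
proof (rule bounded_clinearI)
  show "clinear (\<lambda>x. S x - T x)"
    using assms by (auto simp: bounded_clinear_def clinear_def cvs.scale_right_diff_distrib)
qed (use assms in \<open>intro bounded_linear_sub bounded_clinear_linear\<close>)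

lemma bounded_clinear_id: "bounded_clinear (\<lambda>x. x)"
  using bounded_clinear_scaleC[of 1] by (simp add: scaleC_one)

lemma bounded_clinear_shift: "bounded_clinear T \<Longrightarrow> bounded_clinear (shift T \<mu>)"
  unfolding shift_def by (intro bounded_clinear_diff bounded_clinear_scaleC)

lemma bounded_clinear_funpow: "bounded_clinear (T :: 'a::cbanach \<Rightarrow> 'a) \<Longrightarrow> bounded_clinear (T ^^ n)"
proof (induction n)
  case 0
  then show ?case using bounded_clinear_id by (simp add: id_def[abs_def])
next
  case (Suc n)
  then show ?case using bounded_clinear_compose[of T "T ^^ n"] by (simp add: o_def)
qed

lemma csubspace_ker_on: "csubspace M \<Longrightarrow> clinear T \<Longrightarrow> csubspace (ker_on M T)"
  unfolding csubspace_def[of "ker_on M T"]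
  by (auto simp: ker_on_def clinear_0 clinear_add clinear_scale csubspace_0 csubspace_add csubspace_scale)

lemma csubspace_image:
  assumes "csubspace M" "clinear T"
  shows "csubspace (T ` M)"
  unfolding csubspace_def
proof (intro conjI ballI allI)
  show "0 \<in> T ` M" using assms by (metis clinear_0 csubspace_0 imageI)
next
  fix x y assume "x \<in> T ` M" "y \<in> T ` M"
  then show "x + y \<in> T ` M" using assms by (auto simp: csubspace_add simp flip: clinear_add)
next
  fix c x assume "x \<in> T ` M"
  then show "c *\<^sub>C x \<in> T ` M" using assms by (auto simp: csubspace_scale simp flip: clinear_scale)
qed

lemma csubspace_Int: "csubspace M \<Longrightarrow> csubspace N \<Longrightarrow> csubspace (M \<inter> N)"
  by (auto simp: csubspace_def)

lemma csubspace_plus: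
  assumes "csubspace M" "csubspace N"
  shows "csubspace {m + n | m n. m \<in> M \<and> n \<in> N}"
  using assms cvs.subspace_sums by (simp add: csubspace_iff)

lemma fin_cdim_image: "fin_cdim V \<Longrightarrow> clinear T \<Longrightarrow> fin_cdim (T ` V)"
  unfolding fin_cdim_iff clinear_iff
  by (metis finite_imageI module_hom.span_image module_hom_iff_linear)

lemma closed_ker_on:
  assumes "closed M" "bounded_clinear T"
  shows "closed (ker_on M T)"
proof -
  have "continuous_on UNIV T"
    using assms(2) by (intro linear_continuous_on bounded_clinear_linear)
  then have "closed (T -` {0})" by (intro closed_vimage) auto
  moreover have "ker_on M T = M \<inter> T -` {0}" by (auto simp: ker_on_def)
  ultimately show ?thesis using assms by auto
qed

section \<open>Sums of a closed and a finite-dimensional subspace\<close>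

lemma span_insert_eq:
  "cvs.span (insert b B) = {v + a *\<^sub>C b | v a. v \<in> cvs.span B}"
  by (auto simp: cvs.span_insert) (metis add.commute diff_add_cancel, metis add_diff_cancel)

text \<open>The constant is the distance of \<open>b\<close> from \<open>Y\<close>, positive because
  \<open>Y\<close> is closed. In other words, the coefficient of \<open>b\<close> is a bounded
  functional on the span of \<open>Y\<close> and \<open>b\<close>; this serves both the closedness
  of such sums and the separation of points from subspaces.\<close>

lemma csubspace_coefficient_bound:
  fixes Y :: "'a::cbanach set"
  assumes Y: "csubspace Y" "closed Y" and b: "b \<notin> Y"
  obtains d where "d > 0" "\<And>y a. y \<in> Y \<Longrightarrow> cmod a * d \<le> norm (y + a *\<^sub>C b)"
proof -
  define d where "d = infdist b Y"
  have ne: "Y \<noteq> {}" using Y csubspace_0 by blast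
  have d: "d > 0" using b Y ne in_closed_iff_infdist_zero infdist_nonneg
    unfolding d_def by (metis less_eq_real_def)
  have "cmod a * d \<le> norm (y + a *\<^sub>C b)" if "y \<in> Y" for y a
  proof (cases "a = 0")
    case False
    have "- (inverse a *\<^sub>C y) \<in> Y" using that Y by (intro csubspace_minus csubspace_scale)
    then have "d \<le> dist b (- (inverse a *\<^sub>C y))" unfolding d_def by (rule infdist_le)
    then have "cmod a * d \<le> cmod a * norm (b + inverse a *\<^sub>C y)" by (simp add: dist_norm mult_left_mono)
    also have "\<dots> = norm (a *\<^sub>C (b + inverse a *\<^sub>C y))" by (simp add: norm_scaleC)
    also have "a *\<^sub>C (b + inverse a *\<^sub>C y) = y + a *\<^sub>C b"
      using False by (simp add: scaleC_add_right scaleC_scaleC scaleC_one)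
    finally show ?thesis .
  qed simp
  with d show thesis by (rule that)
qed

text \<open>By the coefficient bound a convergent sequence in the sum has Cauchy coefficients;
  subtracting the convergent multiples of \<open>b\<close> leaves a convergent sequence in
  \<open>Y\<close>.\<close>

lemma closed_csubspace_plus_line:
  assumes Y: "csubspace Y" "closed Y"
  shows "closed {y + a *\<^sub>C b | y a. y \<in> Y}"
proof (cases "b \<in> Y")
  case True
  then have "{y + a *\<^sub>C b | y a. y \<in> Y} = Y"
    using Y by (force intro: csubspace_add csubspace_scale exI[of _ "0::complex"])
  then show ?thesis using Y by simp
next
  case False
  then obtain d where d: "d > 0" and key: "\<And>y a. y \<in> Y \<Longrightarrow> cmod a * d \<le> norm (y + a *\<^sub>C b)"
    using csubspace_coefficient_bound[OF Y] by blast
  show ?thesis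
    unfolding closed_sequential_limits
  proof safe
    fix s z assume s: "\<forall>n. s n \<in> {y + a *\<^sub>C b | y a. y \<in> Y}" "s \<longlonglongrightarrow> z"
    then obtain y a where ya: "\<And>n. s n = y n + a n *\<^sub>C b" "\<And>n. y n \<in> Y" by simp metis
    have est: "cmod (a m - a n) * d \<le> norm (s m - s n)" for m n
    proof -
      have "s m - s n = (y m - y n) + (a m - a n) *\<^sub>C b"
        by (simp add: ya cvs.scale_left_diff_distrib)
      then show ?thesis using key[of "y m - y n" "a m - a n"] Y ya(2) by (simp add: csubspace_diff)
    qed
    have "Cauchy a"
    proof (rule CauchyI)
      fix e :: real assume "0 < e"
      have "Cauchy s" using s by (rule_tac LIMSEQ_imp_Cauchy)
      then obtain M where M: "\<forall>m\<ge>M. \<forall>n\<ge>M. norm (s m - s n) < e * d"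
        using d \<open>0 < e\<close> CauchyD[of s "e * d"] by auto
      show "\<exists>M. \<forall>m\<ge>M. \<forall>n\<ge>M. norm (a m - a n) < e"
        using M est d by (intro exI[of _ M]) (meson le_less_trans mult_less_cancel_right_pos)
    qed
    then obtain a' where a': "a \<longlonglongrightarrow> a'" using Cauchy_convergent convergent_def by blast
    have "(\<lambda>n. a n *\<^sub>C b) \<longlonglongrightarrow> a' *\<^sub>C b"
    proof (rule LIM_zero_cancel, rule tendsto_norm_zero_cancel)
      have "(\<lambda>n. cmod (a n - a') * norm b) \<longlonglongrightarrow> 0 * norm b"
        using a' by (intro tendsto_mult tendsto_const tendsto_norm_zero LIM_zero)
      then show "(\<lambda>n. norm (a n *\<^sub>C b - a' *\<^sub>C b)) \<longlonglongrightarrow> 0"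
        by (simp add: norm_scaleC flip: cvs.scale_left_diff_distrib)
    qed
    from tendsto_diff[OF s(2) this] have "y \<longlonglongrightarrow> z - a' *\<^sub>C b" by (simp add: ya)
    then have "z - a' *\<^sub>C b \<in> Y" using Y ya closed_sequentially by blast
    then show "\<exists>y a. z = y + a *\<^sub>C b \<and> y \<in> Y"
      by (intro exI[of _ "z - a' *\<^sub>C b"] exI[of _ a']) auto
  qed
qed

lemma closed_csubspace_plus_fin_cdim:
  assumes "csubspace Y" "closed Y" "fin_cdim F"
  shows "closed {y + f | y f. y \<in> Y \<and> f \<in> F}"
proof -
  obtain B where "finite B" "F = cvs.span B" using assms by (auto simp: fin_cdim_iff)
  moreover have "closed {y + f | y f. y \<in> Y \<and> f \<in> cvs.span B}" if "finite B" for B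
    using that
  proof induction
    case empty
    then show ?case using assms by simp
  next
    case (insert b B)
    let ?Z = "{y + f | y f. y \<in> Y \<and> f \<in> cvs.span B}"
    have "csubspace ?Z" using assms by (intro csubspace_plus) (auto simp: csubspace_iff)
    from closed_csubspace_plus_line[OF this insert.IH, of b]
    have "closed {z + a *\<^sub>C b | z a. z \<in> ?Z}" .
    moreover have "{z + a *\<^sub>C b | z a. z \<in> ?Z} = {y + f | y f. y \<in> Y \<and> f \<in> cvs.span (insert b B)}"
      unfolding span_insert_eq by (auto simp: add.assoc) (metis add.assoc)+
    ultimately show ?case by simp
  qed
  ultimately show ?thesis by blast
qed

subsection \<open>Bounded lifting\<close>

text \<open>Baire's theorem yields approximate preimages of controlled norm; correcting the error
  geometrically turns them into exact ones.\<close>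

lemma approximate_lifting:
  fixes f :: "'a::banach \<Rightarrow> 'b::banach"
  assumes f: "bounded_linear f" and M: "subspace M" and Y: "closed (f ` M)"
  obtains K where "K > 0"
    "\<And>y \<delta>. y \<in> f ` M \<Longrightarrow> \<delta> > 0 \<Longrightarrow> \<exists>x\<in>M. norm x \<le> K * norm y \<and> norm (y - f x) < \<delta>"
proof -
  interpret f: bounded_linear f by (rule f)
  define Y where "Y = f ` M"
  have sY: "subspace Y" unfolding Y_def using f.linear_axioms M by (rule linear_subspace_image)
  have cY: "closed Y" using Y by (simp add: Y_def)
  \<comment> \<open>Baire's theorem is applied inside the range as a metric space of its own, since
    the range may have empty interior in the target space.\<close>
  interpret Y: Metric_space Y dist
    by unfold_locales (auto simp: dist_commute dist_triangle)
  have "Y.mcomplete"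
    unfolding Y.mcomplete_def
  proof (intro allI impI)
    fix \<sigma> assume "Y.MCauchy \<sigma>"
    then have \<sigma>: "range \<sigma> \<subseteq> Y" "Cauchy \<sigma>"
      by (auto simp: Y.MCauchy_def Cauchy_def)
    then obtain l where l: "\<sigma> \<longlonglongrightarrow> l" using Cauchy_convergent convergent_def by blast
    then have "l \<in> Y" using \<sigma> cY closed_sequentially[of Y \<sigma> l] by blast
    moreover have "\<forall>\<^sub>F n in sequentially. \<sigma> n \<in> Y \<and> dist (\<sigma> n) l < e" if "e > 0" for e
      using tendstoD[OF l that] by eventually_elim (use \<sigma> in auto)
    ultimately show "\<exists>x. limitin Y.mtopology \<sigma> x sequentially"
      by (auto simp: Y.limitin_metric)
  qed
  define A where "A n = closure (f ` (M \<inter> cball 0 (real n)))" for n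
  have AY: "A n \<subseteq> Y" for n
    unfolding A_def using cY by (intro closure_minimal) (auto simp: Y_def)
  have UA: "\<Union>(range A) = Y"
  proof
    show "Y \<subseteq> \<Union>(range A)"
    proof
      fix y assume "y \<in> Y"
      then obtain x where x: "x \<in> M" "y = f x" by (auto simp: Y_def)
      obtain n where "norm x \<le> real n" using real_arch_simple by blast
      then have "y \<in> A n" using x closure_subset by (fastforce simp: A_def)
      then show "y \<in> \<Union>(range A)" by blast
    qed
  qed (use AY in auto)
  have "\<exists>n. Y.mtopology interior_of (A n) \<noteq> {}"
  proof (rule ccontr)
    assume "\<not> ?thesis"
    then have "Y.mtopology interior_of \<Union>(range A) = {}"
    proof (intro Y.metric_Baire_category_alt conjI)
      fix T assume "T \<in> range A"
      then obtain n where n: "T = A n" by auto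
      have "l \<in> A n" if "range \<sigma> \<subseteq> A n" "limitin Y.mtopology \<sigma> l sequentially" for \<sigma> l
      proof -
        have "\<sigma> \<longlonglongrightarrow> l" unfolding tendsto_iff
          using that(2) by (auto simp: Y.limitin_metric elim!: eventually_mono)
        then show ?thesis using that(1) closed_sequentially[of "A n" \<sigma> l] by (auto simp: A_def)
      qed
      then show "closedin Y.mtopology T"
        unfolding Y.metric_closedin_iff_sequentially_closed n using AY by blast
    qed (use \<open>Y.mcomplete\<close> in auto)
    moreover have "Y.mtopology interior_of \<Union>(range A) = Y"
      unfolding UA using interior_of_topspace[of Y.mtopology] by simp
    ultimately show False using subspace_0[OF sY] by simp
  qed
  then obtain n U y0 where U: "openin Y.mtopology U" "y0 \<in> U" "U \<subseteq> A n"
    unfolding interior_of_def by blast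
  then obtain r where "r > 0" "Y.mball y0 r \<subseteq> U" and y0: "y0 \<in> Y"
    unfolding Y.openin_mtopology by blast
  then have ball: "y \<in> A n" if "y \<in> Y" "dist y0 y < r" for y
    using that U by auto
  \<comment> \<open>Differences of approximate preimages move the centre of the ball from
    \<open>y0\<close> to 0, at the price of doubling the norm bound.\<close>
  have small: "\<exists>x\<in>M. norm x \<le> 2 * real n \<and> norm (y - f x) < \<delta>"
    if y: "y \<in> Y" "norm y < r" and \<delta>: "\<delta> > 0" for y \<delta>
  proof -
    have "y0 + y \<in> A n" "y0 \<in> A n"
      using ball y y0 \<open>r > 0\<close> subspace_add[OF sY] by (auto simp: dist_norm)
    then obtain u v where u: "u \<in> M" "norm u \<le> real n" "dist (f u) (y0 + y) < \<delta>/2"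
      and v: "v \<in> M" "norm v \<le> real n" "dist (f v) y0 < \<delta>/2"
      using \<delta> unfolding A_def closure_approachable by (force dest!: spec[of _ "\<delta>/2"])
    have "y - f (u - v) = (y0 + y - f u) - (y0 - f v)" by (simp add: f.diff)
    then have "norm (y - f (u - v)) \<le> norm (y0 + y - f u) + norm (y0 - f v)"
      using norm_triangle_ineq4 by metis
    also have "\<dots> < \<delta>" using u v by (simp add: dist_norm norm_minus_commute)
    finally show ?thesis
      using u v subspace_diff[OF M] norm_triangle_ineq4[of u v] by (intro bexI[of _ "u - v"]) auto
  qed
  \<comment> \<open>A vector is scaled to norm \<open>r / 2\<close> before \<open>small\<close> is
    applied. The summand 1 keeps \<open>K\<close> positive when \<open>n = 0\<close>.\<close>
  define K where "K = 2 * (2 * real n + 1) / r"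
  show thesis
  proof
    show "K > 0" using \<open>r > 0\<close> by (simp add: K_def)
    fix y and \<delta> :: real assume y: "y \<in> f ` M" and \<delta>: "\<delta> > 0"
    show "\<exists>x\<in>M. norm x \<le> K * norm y \<and> norm (y - f x) < \<delta>"
    proof (cases "y = 0")
      case True
      then show ?thesis using \<delta> subspace_0[OF M] by (intro bexI[of _ 0]) (auto simp: f.zero)
    next
      case False
      define t where "t = r / (2 * norm y)"
      have t: "t > 0" using False \<open>r > 0\<close> by (simp add: t_def)
      have "t *\<^sub>R y \<in> Y" using y subspace_scale[OF sY] by (simp add: Y_def)
      moreover have "norm (t *\<^sub>R y) < r" using False \<open>r > 0\<close> by (simp add: t_def)
      ultimately obtain x where x: "x \<in> M" "norm x \<le> 2 * real n" "norm (t *\<^sub>R y - f x) < t * \<delta>"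
        using small[of "t *\<^sub>R y" "t * \<delta>"] t \<delta> by auto
      have "y - f (inverse t *\<^sub>R x) = inverse t *\<^sub>R (t *\<^sub>R y - f x)"
        using t by (simp add: f.scaleR scaleR_diff_right)
      then have "norm (y - f (inverse t *\<^sub>R x)) = inverse t * norm (t *\<^sub>R y - f x)"
        using t by simp
      also have "\<dots> < inverse t * (t * \<delta>)" using x t by (intro mult_strict_left_mono) auto
      also have "\<dots> = \<delta>" using t by simp
      finally have "norm (y - f (inverse t *\<^sub>R x)) < \<delta>" .
      moreover have "norm (inverse t *\<^sub>R x) \<le> inverse t * (2 * real n + 1)"
        using x t by (simp add: mult_left_mono)
      then have "norm (inverse t *\<^sub>R x) \<le> K * norm y"
        using False \<open>r > 0\<close> by (simp add: t_def K_def field_simps)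
      ultimately show ?thesis using x subspace_scale[OF M] by blast
    qed
  qed
qed

lemma bounded_lifting:
  fixes f :: "'a::banach \<Rightarrow> 'b::banach"
  assumes f: "bounded_linear f" and M: "subspace M" "closed M" and Y: "closed (f ` M)"
  obtains C where "C > 0" "\<And>y. y \<in> f ` M \<Longrightarrow> \<exists>x\<in>M. f x = y \<and> norm x \<le> C * norm y"
proof -
  interpret f: bounded_linear f by (rule f)
  obtain K where K: "K > 0"
    "\<And>y \<delta>. y \<in> f ` M \<Longrightarrow> \<delta> > 0 \<Longrightarrow> \<exists>x\<in>M. norm x \<le> K * norm y \<and> norm (y - f x) < \<delta>"
    using approximate_lifting[OF f M(1) Y] by metis
  have sY: "subspace (f ` M)" using f.linear_axioms M(1) by (rule linear_subspace_image)
  show thesis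
  proof
    show "2 * K > 0" using K by simp
    fix y assume y: "y \<in> f ` M"
    show "\<exists>x\<in>M. f x = y \<and> norm x \<le> 2 * K * norm y"
    proof (cases "y = 0")
      case True
      then show ?thesis using subspace_0[OF M(1)] by (intro bexI[of _ 0]) (auto simp: f.zero)
    next
      case False
      \<comment> \<open>Each approximate preimage has to halve the error, so the errors decay
        geometrically and the corrections sum to at most twice the first bound.\<close>
      define P where "P y x \<longleftrightarrow> x \<in> M \<and> norm x \<le> K * norm y \<and> norm (y - f x) \<le> norm y / 2" for y x
      have ex: "\<exists>x. P y x" if "y \<in> f ` M" for y
      proof (cases "y = 0")
        case True
        then show ?thesis using subspace_0[OF M(1)] by (intro exI[of _ 0]) (auto simp: f.zero P_def)
      next
        case False
        then show ?thesis using K(2)[OF that, of "norm y / 2"] by (fastforce simp: P_def)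
      qed
      define g where "g y = (SOME x. P y x)" for y
      have g: "P y (g y)" if "y \<in> f ` M" for y
        unfolding g_def using ex[OF that] by (rule someI_ex)
      define e where "e n = ((\<lambda>y. y - f (g y)) ^^ n) y" for n
      have e0: "e 0 = y" and eS: "e (Suc n) = e n - f (g (e n))" for n by (simp_all add: e_def)
      have eY: "e n \<in> f ` M" for n
      proof (induction n)
        case (Suc n)
        then show ?case using g[OF Suc] subspace_diff[OF sY] by (simp add: eS P_def)
      qed (simp add: e0 y)
      have en: "norm (e n) \<le> norm y * (1/2)^n" for n
      proof (induction n)
        case (Suc n)
        have "norm (e (Suc n)) \<le> norm (e n) / 2" using g[OF eY[of n]] by (simp add: eS P_def)
        with Suc show ?case by simp
      qed (simp add: e0)
      define x where "x n = g (e n)" for n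
      have xM: "x n \<in> M" for n using g[OF eY[of n]] by (simp add: x_def P_def)
      have xn: "norm (x n) \<le> K * norm y * (1/2)^n" for n
      proof -
        have "norm (x n) \<le> K * norm (e n)" using g[OF eY[of n]] by (simp add: x_def P_def)
        also have "\<dots> \<le> K * (norm y * (1/2)^n)" using K(1) en by (intro mult_left_mono) auto
        finally show ?thesis by (simp add: mult.assoc)
      qed
      have sg: "(\<lambda>n. K * norm y * (1/2)^n) sums (K * norm y * 2)"
        using geometric_sums[of "1/2::real"] by (intro sums_mult) auto
      have sn: "summable (\<lambda>n. norm (x n))"
        using xn by (intro summable_comparison_test[OF _ sums_summable[OF sg]]) auto
      then have sx: "summable x" by (rule summable_norm_cancel)
      have "(\<Sum>n. x n) \<in> M"
      proof (rule closed_sequentially[OF M(2)])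
        show "(\<lambda>n. \<Sum>i<n. x i) \<longlonglongrightarrow> (\<Sum>n. x n)" using sx by (rule summable_LIMSEQ)
        show "(\<Sum>i<n. x i) \<in> M" for n using xM by (intro subspace_sum M)
      qed
      moreover have "norm (\<Sum>n. x n) \<le> 2 * K * norm y"
      proof -
        have "norm (\<Sum>n. x n) \<le> (\<Sum>n. norm (x n))" by (rule summable_norm[OF sn])
        also have "\<dots> \<le> K * norm y * 2"
          using suminf_le[OF xn sn sums_summable[OF sg]] sums_unique[OF sg] by simp
        finally show ?thesis by simp
      qed
      moreover have "f (\<Sum>n. x n) = y"
      proof -
        have part: "(\<Sum>i<n. f (x i)) = y - e n" for n
          by (induction n) (auto simp: e0 eS x_def)
        have "(\<lambda>n. norm y * (1/2)^n) \<longlonglongrightarrow> norm y * 0"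
          by (intro tendsto_mult tendsto_const LIMSEQ_realpow_zero) auto
        then have "e \<longlonglongrightarrow> 0" using en
          by (intro tendsto_norm_zero_cancel[of e] Lim_null_comparison[of "\<lambda>n. norm (e n)" "\<lambda>n. norm y * (1/2)^n"]) auto
        then have "(\<lambda>n. y - e n) \<longlonglongrightarrow> y - 0" by (intro tendsto_diff tendsto_const)
        then have "(\<lambda>n. f (x n)) sums y" by (simp add: sums_def part)
        then show ?thesis using f.suminf[OF sx] sums_unique by metis
      qed
      ultimately show ?thesis by blast
    qed
  qed
qed

subsection \<open>Invertibility and Kato operators on invariant subspaces\<close>

abbreviation bij_on :: "'a set \<Rightarrow> ('a \<Rightarrow> 'a) \<Rightarrow> bool" where
  "bij_on M T \<equiv> bij_betw T M M"

text \<open>Keeping the ambient \<open>T\<close> lets the same operator be viewed on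
  \<open>M\<close>, on the range of a power inside \<open>M\<close> and on the whole space, without
  a change of type.\<close>

locale restricted_op =
  fixes M :: "'a::cbanach set" and T :: "'a \<Rightarrow> 'a"
  assumes csubspace: "csubspace M" and closed: "closed M"
    and bounded: "bounded_clinear T" and inv: "invariant T M"
begin

lemma clinear: "clinear T" by (rule bounded_clinear_clinear[OF bounded])
lemma bounded_linear: "bounded_linear T" by (rule bounded_clinear_linear[OF bounded])
lemma T_in: "x \<in> M \<Longrightarrow> T x \<in> M" using inv by (auto simp: invariant_def)
lemma subspace: "subspace M" by (rule csubspace_imp_subspace[OF csubspace])

lemmas T_0 = clinear_0[OF clinear]
  and T_add = clinear_add[OF clinear]
  and T_diff = clinear_diff[OF clinear]
  and T_scale = clinear_scale[OF clinear]

lemmas mem_0 = csubspace_0[OF csubspace]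
  and mem_add = csubspace_add[OF csubspace]
  and mem_diff = csubspace_diff[OF csubspace]
  and mem_scale = csubspace_scale[OF csubspace]

lemma clinear_pow: "clinear (T ^^ n)" by (rule clinear_funpow[OF clinear])

lemma pow_in: "x \<in> M \<Longrightarrow> (T ^^ n) x \<in> M"
  by (induction n) (auto simp: T_in)

lemma shift_restricted: "restricted_op M (shift T \<mu>)"
proof
  show "invariant (shift T \<mu>) M"
    unfolding invariant_def shift_def
    by (blast intro: T_in mem_diff mem_scale)
qed (fact csubspace closed bounded_clinear_shift[OF bounded])+

lemma inj_onI_ker:
  assumes "\<And>x. x \<in> M \<Longrightarrow> T x = 0 \<Longrightarrow> x = 0"
  shows "inj_on T M"
proof (rule inj_onI)
  fix x y assume "x \<in> M" "y \<in> M" "T x = T y"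
  then have "x - y \<in> M" "T (x - y) = 0"
    by (simp_all add: mem_diff T_diff)
  then have "x - y = 0" by (rule assms)
  then show "x = y" by simp
qed

text \<open>Under injectivity the preimage supplied by \<open>bounded_lifting\<close> is the only
  one, so its norm bound holds for every vector of \<open>M\<close>.\<close>

lemma lower_bound:
  assumes "inj_on T M" "closed (T ` M)"
  obtains c where "c > 0" "\<And>x. x \<in> M \<Longrightarrow> c * norm x \<le> norm (T x)"
proof -
  obtain C where C: "C > 0" "\<And>y. y \<in> T ` M \<Longrightarrow> \<exists>x\<in>M. T x = y \<and> norm x \<le> C * norm y"
    using bounded_lifting[OF bounded_linear subspace closed assms(2)] by metis
  show thesis
  proof
    show "1 / C > 0" using C by simp
    fix x assume x: "x \<in> M"
    then obtain x' where "x' \<in> M" "T x' = T x" "norm x' \<le> C * norm (T x)"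
      using C(2)[of "T x"] by blast
    moreover from this have "x' = x" using assms(1) x by (auto dest: inj_onD)
    ultimately show "1 / C * norm x \<le> norm (T x)" using C(1) by (simp add: field_simps)
  qed
qed

lemma lower_bound_bij:
  assumes "bij_on M T"
  obtains c where "c > 0" "\<And>x. x \<in> M \<Longrightarrow> c * norm x \<le> norm (T x)"
proof (rule lower_bound)
  show "inj_on T M" "closed (T ` M)" using assms closed by (simp_all add: bij_betw_def)
qed (rule that)

text \<open>The bounded inverse theorem on \<open>M\<close>: linearity of the inverse is automatic
  and its bound comes from \<open>lower_bound_bij\<close>. From here on only bijectivity has to be
  established.\<close>

lemma invertible_on_iff: "invertible_on M T \<longleftrightarrow> bij_on M T"
proof
  assume "invertible_on M T"
  then obtain R where R: "\<And>x. x \<in> M \<Longrightarrow> R x \<in> M \<and> R (T x) = x \<and> T (R x) = x"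
    unfolding invertible_on_def by blast
  show "bij_on M T"
  proof (rule bij_betw_byWitness)
    show "T ` M \<subseteq> M" "R ` M \<subseteq> M" using R T_in by blast+
    show "\<forall>x\<in>M. R (T x) = x" "\<forall>x\<in>M. T (R x) = x" using R by blast+
  qed
next
  assume bij: "bij_on M T"
  obtain c where c: "c > 0" "\<And>x. x \<in> M \<Longrightarrow> c * norm x \<le> norm (T x)"
    using lower_bound_bij[OF bij] by blast
  define R where "R = inv_into M T"
  have TM: "T ` M = M" and inj: "inj_on T M" using bij by (simp_all add: bij_betw_def)
  have R: "R x \<in> M" "T (R x) = x" if "x \<in> M" for x
    using that unfolding R_def by (simp_all add: inv_into_into f_inv_into_f TM)
  have R': "R x = y" if "y \<in> M" "T y = x" for x y
    using inv_into_f_f[OF inj that(1)] that(2) by (simp add: R_def)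
  have "norm (R x) \<le> norm x * (1 / c)" if "x \<in> M" for x
    using c(2)[OF R(1)[OF that]] R(2)[OF that] c(1) by (simp add: field_simps)
  moreover have "R (x + y) = R x + R y" if "x \<in> M" "y \<in> M" for x y
    using that by (intro R') (simp_all add: mem_add R T_add)
  moreover have "R (a *\<^sub>C x) = a *\<^sub>C R x" if "x \<in> M" for x a
    using that by (intro R') (simp_all add: mem_scale R T_scale)
  moreover have "R (T x) = x" if "x \<in> M" for x
    using that by (intro R') simp_all
  ultimately show "invertible_on M T"
    unfolding invertible_on_def using R by (intro exI[of _ R] conjI ballI allI exI[of _ "1 / c"]) simp_all
qed

text \<open>Solving \<open>B x = y\<close> is the fixed point problem \<open>x = T\<^sup>-\<^sup>1 (y - (B - T) x)\<close>.\<close>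

lemma bij_betw_perturb:
  assumes bij: "bij_on M T" and B: "restricted_op M B"
    and c: "\<And>x. x \<in> M \<Longrightarrow> c * norm x \<le> norm (T x)"
    and d: "\<And>x. x \<in> M \<Longrightarrow> norm (B x - T x) \<le> d * norm x" "0 \<le> d" "d < c"
  shows "bij_on M B"
proof -
  interpret B: restricted_op M B by (rule B)
  have ex1: "\<exists>!x. x \<in> M \<and> B x = y" if y: "y \<in> M" for y
  proof -
    define g where "g x = inv_into M T (y - (B x - T x))" for x
    have in_M: "y - (B x - T x) \<in> M" if "x \<in> M" for x
      using that y by (intro mem_diff B.T_in T_in)
    have g: "g x \<in> M" "T (g x) = y - (B x - T x)" if "x \<in> M" for x
      using in_M[OF that] bij by (auto simp: g_def bij_betw_def inv_into_into f_inv_into_f)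
    have fix_iff: "g x = x \<longleftrightarrow> B x = y" if "x \<in> M" for x
    proof
      assume "g x = x"
      then show "B x = y" using g(2)[OF that] by (simp add: algebra_simps)
    next
      assume "B x = y"
      then have "T (g x) = T x" using g(2)[OF that] by simp
      then show "g x = x" using g(1)[OF that] that bij by (auto simp: bij_betw_def dest: inj_onD)
    qed
    have "\<exists>!x\<in>M. g x = x"
    proof (rule Banach_fix)
      show "complete M" using closed by (simp add: complete_eq_closed)
      show "M \<noteq> {}" using y by blast
      show "0 \<le> d / c" "d / c < 1" using d by auto
      show "g ` M \<subseteq> M" using g by blast
      fix x x' assume x: "x \<in> M" "x' \<in> M"
      have "c * norm (g x - g x') \<le> norm (T (g x - g x'))"
        using x g by (intro c mem_diff) auto
      also have "T (g x - g x') = T (g x) - T (g x')" by (rule T_diff)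
      also have "\<dots> = - (B (x - x') - T (x - x'))"
        using x g by (simp add: T_diff B.T_diff)
      also have "norm \<dots> \<le> d * norm (x - x')"
        using x d(1)[of "x - x'"] by (simp only: norm_minus_cancel) (simp add: mem_diff)
      finally show "dist (g x) (g x') \<le> d / c * dist x x'"
        using d by (simp add: dist_norm field_simps)
    qed
    then show ?thesis using fix_iff by metis
  qed
  have "inj_on B M"
  proof (rule inj_onI)
    fix x x' assume "x \<in> M" "x' \<in> M" "B x = B x'"
    then show "x = x'" using ex1[OF B.T_in[of x]] by metis
  qed
  moreover have "B ` M = M"
  proof
    show "M \<subseteq> B ` M"
    proof
      fix y assume "y \<in> M"
      from ex1[OF this] show "y \<in> B ` M" by auto
    qed
  qed (use B.T_in in auto)
  ultimately show ?thesis by (simp add: bij_betw_def)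
qed

lemma bij_shift_small:
  assumes bij: "bij_on M T"
  obtains \<delta> where "\<delta> > 0" "\<And>\<mu>. cmod \<mu> < \<delta> \<Longrightarrow> bij_on M (shift T \<mu>)"
proof -
  obtain c where c: "c > 0" "\<And>x. x \<in> M \<Longrightarrow> c * norm x \<le> norm (T x)"
    using lower_bound_bij[OF bij] by blast
  have "bij_on M (shift T \<mu>)" if "cmod \<mu> < c" for \<mu>
    by (rule bij_betw_perturb[OF bij shift_restricted c(2), of _ "cmod \<mu>"])
      (use that in \<open>auto simp: shift_def norm_scaleC\<close>)
  with c(1) show thesis by (rule that)
qed

text \<open>Here \<open>T\<close> itself is the perturbation: the unperturbed operator is
  multiplication by \<open>-\<mu>\<close>, whose lower bound is the modulus of
  \<open>\<mu>\<close>.\<close>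

lemma bij_shift_large:
  obtains K where "K \<ge> 0" "\<And>\<mu>. cmod \<mu> > K \<Longrightarrow> bij_on M (shift T \<mu>)"
proof -
  obtain K where K: "K > 0" "\<And>x. norm (T x) \<le> norm x * K"
    using bounded_linear.pos_bounded[OF bounded_linear] by blast
  have "bij_on M (shift T \<mu>)" if "cmod \<mu> > K" for \<mu>
  proof -
    have \<mu>: "\<mu> \<noteq> 0" using that K by auto
    interpret A: restricted_op M "\<lambda>x. (-\<mu>) *\<^sub>C x"
      by unfold_locales (use mem_scale in
          \<open>auto simp only: invariant_def csubspace closed bounded_clinear_scaleC\<close>)
    have bij: "bij_on M (\<lambda>x. (-\<mu>) *\<^sub>C x)"
    proof (rule bij_betw_byWitness[of _ "\<lambda>x. (- inverse \<mu>) *\<^sub>C x"])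
      show "(\<lambda>x. (-\<mu>) *\<^sub>C x) ` M \<subseteq> M" "(\<lambda>x. (- inverse \<mu>) *\<^sub>C x) ` M \<subseteq> M"
        using mem_scale by blast+
    qed (use \<mu> in \<open>simp_all only: scaleC_scaleC, simp_all add: scaleC_one\<close>)
    have "norm (shift T \<mu> x - (- \<mu>) *\<^sub>C x) \<le> K * norm x" for x
      using K(2)[of x] by (simp add: shift_def mult.commute)
    from A.bij_betw_perturb[OF bij shift_restricted _ this, of "cmod \<mu>"] show ?thesis
      using that K by (simp add: norm_scaleC del: cvs.scale_minus_left)
  qed
  with K(1) show thesis by (intro that[of K]) auto
qed

definition near_bij :: bool where
  "near_bij \<longleftrightarrow> (\<forall>\<epsilon>>0. \<exists>\<mu>. cmod \<mu> < \<epsilon> \<and> bij_on M (shift T \<mu>))"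

text \<open>A lower bound \<open>c\<close> of \<open>T\<close> leaves the lower bound
  \<open>c - cmod \<mu>\<close> for the bijective shift, and \<open>T\<close> differs from that
  shift by \<open>cmod \<mu>\<close>. The perturbation lemma therefore asks for \<open>\<mu>\<close>
  of modulus below \<open>c / 2\<close>.\<close>

lemma near_bij_inj_imp_bij:
  assumes near_bij "inj_on T M" "closed (T ` M)"
  shows "bij_on M T"
proof -
  obtain c where c: "c > 0" "\<And>x. x \<in> M \<Longrightarrow> c * norm x \<le> norm (T x)"
    using lower_bound[OF assms(2,3)] by blast
  obtain \<mu> where \<mu>: "cmod \<mu> < c / 2" "bij_on M (shift T \<mu>)"
    using assms(1) c(1) unfolding near_bij_def by (meson half_gt_zero)
  interpret A: restricted_op M "shift T \<mu>" by (rule shift_restricted)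
  show ?thesis
  proof (rule A.bij_betw_perturb[OF \<mu>(2) restricted_op_axioms, of "c - cmod \<mu>" "cmod \<mu>"])
    fix x assume "x \<in> M"
    then have "c * norm x \<le> norm (T x)" by (rule c)
    also have "\<dots> = norm (shift T \<mu> x + \<mu> *\<^sub>C x)" by (simp add: shift_def)
    also have "\<dots> \<le> norm (shift T \<mu> x) + cmod \<mu> * norm x"
      using norm_triangle_ineq[of "shift T \<mu> x" "\<mu> *\<^sub>C x"] by (simp add: norm_scaleC)
    finally show "(c - cmod \<mu>) * norm x \<le> norm (shift T \<mu> x)" by (simp add: algebra_simps)
  qed (use \<mu> in \<open>auto simp: shift_def norm_scaleC\<close>)
qed

text \<open>Every preimage under \<open>T\<close> of a vector in \<open>\<Inter>n. T\<^sup>n M\<close> again lies in this intersection, because the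
  kernel does; so preimages can be chosen one after the other, with geometric control of the norm.\<close>

lemma Kato_chain:
  assumes K: "Kato_on M T" and x: "x \<in> ker_on M T"
  obtains u C where "C > 0" "u 0 = x" "\<And>n. u n \<in> M" "\<And>n. T (u (Suc n)) = u n"
    "\<And>n. norm (u n) \<le> norm x * C ^ n"
proof -
  obtain C where C: "C > 0" "\<And>y. y \<in> T ` M \<Longrightarrow> \<exists>x\<in>M. T x = y \<and> norm x \<le> C * norm y"
    using bounded_lifting[OF bounded_linear subspace closed] K unfolding Kato_on_def by metis
  then obtain g where g: "\<And>y. y \<in> T ` M \<Longrightarrow> g y \<in> M \<and> T (g y) = y \<and> norm (g y) \<le> C * norm y"
    by metis
  define R where "R = {y. \<forall>n. y \<in> (T ^^ n) ` M}"
  have RT: "y \<in> T ` M" if "y \<in> R" for y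
    using that by (auto simp: R_def dest: spec[of _ 1])
  have gR: "g y \<in> R" if y: "y \<in> R" for y
    unfolding R_def
  proof safe
    fix n
    have gy: "g y \<in> M" "T (g y) = y" using g RT y by auto
    obtain z where z: "z \<in> M" "y = (T ^^ Suc n) z" using y unfolding R_def by blast
    have "g y - (T ^^ n) z \<in> ker_on M T"
      using gy z pow_in by (auto simp: ker_on_def T_diff intro: mem_diff)
    then have "g y - (T ^^ n) z \<in> (T ^^ n) ` M" using K by (auto simp: Kato_on_def)
    then have "(g y - (T ^^ n) z) + (T ^^ n) z \<in> (T ^^ n) ` M"
      using z by (intro csubspace_add[OF csubspace_image[OF csubspace clinear_pow]]) auto
    then show "g y \<in> (T ^^ n) ` M" by simp
  qed
  define u where "u n = (g ^^ n) x" for n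
  have u0: "u 0 = x" and uS: "u (Suc n) = g (u n)" for n by (simp_all add: u_def)
  have uR: "u n \<in> R" for n
  proof (induction n)
    case 0
    then show ?case using x K by (auto simp: u0 R_def Kato_on_def)
  qed (simp add: uS gR)
  have "u n \<in> M" for n using uR[of n] by (auto simp: R_def dest: spec[of _ 0])
  moreover have "T (u (Suc n)) = u n" for n using g RT uR by (simp add: uS)
  moreover have "norm (u n) \<le> norm x * C ^ n" for n
  proof (induction n)
    case (Suc n)
    have "norm (u (Suc n)) \<le> C * norm (u n)" using g RT uR by (simp add: uS)
    also have "\<dots> \<le> C * (norm x * C ^ n)" using Suc C(1) by (intro mult_left_mono) auto
    finally show ?case by (simp add: ac_simps)
  qed (simp add: u0)
  ultimately show thesis using that C(1) u0 by blast
qed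

end

section \<open>Series along chains of preimages\<close>

lemma summable_scaleC_power:
  fixes u :: "nat \<Rightarrow> 'a::cbanach"
  assumes "C > 0" "\<And>n. norm (u n) \<le> K * C ^ n" "cmod \<mu> * C < 1"
  shows "summable (\<lambda>n. norm (\<mu> ^ n *\<^sub>C u n))"
proof (rule summable_comparison_test)
  have "summable (\<lambda>n. (cmod \<mu> * C) ^ n)"
    using assms by (intro summable_geometric) auto
  then show "summable (\<lambda>n. K * (cmod \<mu> * C) ^ n)" by (rule summable_mult)
  have "norm (\<mu> ^ n *\<^sub>C u n) \<le> K * (cmod \<mu> * C) ^ n" for n
  proof -
    have "cmod \<mu> ^ n * norm (u n) \<le> cmod \<mu> ^ n * (K * C ^ n)"
      using assms(2) by (intro mult_left_mono) auto
    then show ?thesis by (simp add: norm_scaleC norm_power power_mult_distrib ac_simps)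
  qed
  then show "\<exists>N. \<forall>n\<ge>N. norm (norm (\<mu> ^ n *\<^sub>C u n)) \<le> K * (cmod \<mu> * C) ^ n" by auto
qed

text \<open>The terms after the first are dominated by a geometric series. Since the bound tends to
  0 with \<open>\<mu>\<close>, a series with \<open>u 0\<close> nonzero cannot vanish at small
  arguments; at \<open>\<mu> = 0\<close> the bound identifies the sum with
  \<open>u 0\<close>.\<close>

lemma power_series_near_0:
  fixes u :: "nat \<Rightarrow> 'a::cbanach"
  assumes "C > 0" "\<And>n. norm (u n) \<le> K * C ^ n" "cmod \<mu> * C < 1"
  shows "norm ((\<Sum>n. \<mu> ^ n *\<^sub>C u n) - u 0) \<le> K * (cmod \<mu> * C) / (1 - cmod \<mu> * C)"
proof -
  define q where "q = cmod \<mu> * C"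
  have q: "0 \<le> q" "q < 1" using assms by (auto simp: q_def)
  have s: "summable (\<lambda>n. norm (\<mu> ^ n *\<^sub>C u n))" by (rule summable_scaleC_power[OF assms])
  then have s1: "summable (\<lambda>n. norm (\<mu> ^ Suc n *\<^sub>C u (Suc n)))" by (subst summable_Suc_iff)
  have "(\<Sum>n. \<mu> ^ n *\<^sub>C u n) - u 0 = (\<Sum>n. \<mu> ^ Suc n *\<^sub>C u (Suc n))"
    using suminf_split_head[OF summable_norm_cancel[OF s]] by (simp add: scaleC_one)
  also have "norm \<dots> \<le> (\<Sum>n. norm (\<mu> ^ Suc n *\<^sub>C u (Suc n)))" by (rule summable_norm[OF s1])
  also have "\<dots> \<le> (\<Sum>n. K * q * q ^ n)"
  proof (rule suminf_le[OF _ s1])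
    fix n
    have "cmod \<mu> ^ Suc n * norm (u (Suc n)) \<le> cmod \<mu> ^ Suc n * (K * C ^ Suc n)"
      using assms(2)[of "Suc n"] by (intro mult_left_mono) auto
    then show "norm (\<mu> ^ Suc n *\<^sub>C u (Suc n)) \<le> K * q * q ^ n"
      by (simp add: q_def norm_scaleC norm_power power_mult_distrib ac_simps norm_mult)
  next
    show "summable (\<lambda>n. K * q * q ^ n)" using q by (intro summable_mult summable_geometric) auto
  qed
  also have "\<dots> = K * q / (1 - q)"
    using q by (subst suminf_mult) (auto intro: summable_geometric simp: suminf_geometric)
  finally show ?thesis by (simp add: q_def)
qed

context restricted_op
begin

text \<open>\<open>T\<close> moves the chain down by one place and kills its first vector, which
  amounts to multiplying the series by \<open>\<mu>\<close>.\<close>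

lemma chain_eigenvector:
  assumes C: "C > 0" "\<And>n. norm (u n) \<le> K * C ^ n" "cmod \<mu> * C < 1"
    and u: "T (u 0) = 0" "\<And>n. u n \<in> M" "\<And>n. T (u (Suc n)) = u n"
  shows "(\<Sum>n. \<mu> ^ n *\<^sub>C u n) \<in> M" "T (\<Sum>n. \<mu> ^ n *\<^sub>C u n) = \<mu> *\<^sub>C (\<Sum>n. \<mu> ^ n *\<^sub>C u n)"
proof -
  have s: "summable (\<lambda>n. \<mu> ^ n *\<^sub>C u n)" by (rule summable_norm_cancel[OF summable_scaleC_power[OF C]])
  show "(\<Sum>n. \<mu> ^ n *\<^sub>C u n) \<in> M"
  proof (rule closed_sequentially[OF closed])
    show "(\<lambda>n. \<Sum>i<n. \<mu> ^ i *\<^sub>C u i) \<longlonglongrightarrow> (\<Sum>n. \<mu> ^ n *\<^sub>C u n)" using s by (rule summable_LIMSEQ)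
    show "(\<Sum>i<n. \<mu> ^ i *\<^sub>C u i) \<in> M" for n
      using u by (intro csubspace_sum[OF csubspace] mem_scale)
  qed
  have sT: "summable (\<lambda>n. T (\<mu> ^ n *\<^sub>C u n))" by (rule bounded_linear.summable[OF bounded_linear s])
  have "T (\<Sum>n. \<mu> ^ n *\<^sub>C u n) = (\<Sum>n. T (\<mu> ^ n *\<^sub>C u n))" by (rule bounded_linear.suminf[OF bounded_linear s])
  also have "\<dots> = (\<Sum>n. T (\<mu> ^ Suc n *\<^sub>C u (Suc n)))"
    using suminf_split_head[OF sT] by (simp add: u scaleC_one)
  also have "\<dots> = (\<Sum>n. \<mu> *\<^sub>C (\<mu> ^ n *\<^sub>C u n))" by (simp add: T_scale u scaleC_scaleC)
  also have "\<dots> = \<mu> *\<^sub>C (\<Sum>n. \<mu> ^ n *\<^sub>C u n)"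
    using bounded_linear.suminf[OF bounded_clinear_linear[OF bounded_clinear_scaleC] s] by simp
  finally show "T (\<Sum>n. \<mu> ^ n *\<^sub>C u n) = \<mu> *\<^sub>C (\<Sum>n. \<mu> ^ n *\<^sub>C u n)" .
qed

lemma Kato_near_bij_imp_bij:
  assumes K: "Kato_on M T" and near: near_bij
  shows "bij_on M T"
proof (rule near_bij_inj_imp_bij[OF near])
  show "closed (T ` M)" using K by (simp add: Kato_on_def)
  show "inj_on T M"
  proof (rule inj_onI_ker, rule ccontr)
    fix x assume x: "x \<in> M" "T x = 0" "x \<noteq> 0"
    then have "x \<in> ker_on M T" by (simp add: ker_on_def)
    from Kato_chain[OF K this] obtain u C where C: "C > 0" "\<And>n. norm (u n) \<le> norm x * C ^ n"
      and u: "u 0 = x" "\<And>n. u n \<in> M" "\<And>n. T (u (Suc n)) = u n" by metis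
    \<comment> \<open>This radius makes the ratio \<open>cmod \<mu> * C\<close> smaller than one
      half, so that ratio / (1 - ratio) is below 1 and the estimate contradicts
      \<open>x \<noteq> 0\<close>.\<close>
    obtain \<mu> where \<mu>: "cmod \<mu> < 1 / (2 * C)" "bij_on M (shift T \<mu>)"
      using near C(1) unfolding near_bij_def by (metis divide_pos_pos mult_pos_pos zero_less_numeral zero_less_one)
    define v where "v = (\<Sum>n. \<mu> ^ n *\<^sub>C u n)"
    have q: "cmod \<mu> * C < 1 / 2" using \<mu> C by (simp add: field_simps)
    then have q1: "cmod \<mu> * C < 1" by simp
    have v: "v \<in> M" "T v = \<mu> *\<^sub>C v"
      using chain_eigenvector[OF C q1 _ u(2,3)] u(1) x by (auto simp: v_def)
    then have "shift T \<mu> v = shift T \<mu> 0" by (simp add: shift_def T_0)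
    then have "v = 0" using \<mu> v mem_0 by (auto simp: bij_betw_def dest: inj_onD)
    then have "norm x \<le> norm x * (cmod \<mu> * C) / (1 - cmod \<mu> * C)"
      using power_series_near_0[OF C q1] u(1) by (simp add: v_def)
    also have "\<dots> < norm x"
    proof -
      have "norm x * (cmod \<mu> * C) < norm x * (1 - cmod \<mu> * C)"
        using q x(3) by (intro mult_strict_left_mono) (simp_all only: zero_less_norm_iff, simp)
      then show ?thesis using q by (simp add: pos_divide_less_eq)
    qed
    finally show False by simp
  qed
qed

end

subsection \<open>Fredholm and Riesz operators\<close>

lemma shift_shift: "shift (shift T \<nu>) \<mu> = shift T (\<nu> + \<mu>)"
  by (simp add: shift_def fun_eq_iff scaleC_add_left algebra_simps)

lemma image_funpow_add: "(T ^^ n) ` ((T ^^ m) ` A) = (T ^^ (n + m)) ` A"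
  by (simp add: image_image funpow_add)

lemma image_funpow_Suc: "T ` ((T ^^ n) ` A) = (T ^^ Suc n) ` A"
  by (simp add: image_image)

context restricted_op
begin

lemma funpow_shift: "(T ^^ n) (shift T \<mu> x) = shift T \<mu> ((T ^^ n) x)"
  by (simp add: shift_def clinear_diff[OF clinear_pow] clinear_scale[OF clinear_pow] funpow_swap1)

text \<open>If images of vectors of \<open>Y\<close> converge to \<open>T x\<close>, bounded lifting
  of the differences yields vectors \<open>x + u n\<close> with the same images and
  \<open>u n\<close> tending to 0. They lie in the sum of \<open>Y\<close> and the kernel, which is
  closed because the kernel is finite-dimensional; hence so does \<open>x\<close>.\<close>

lemma closed_image_of_closed:
  assumes ker: "fin_cdim (ker_on M T)" and R: "closed (T ` M)"
    and Y: "csubspace Y" "closed Y" "Y \<subseteq> M"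
  shows "closed (T ` Y)"
  unfolding closed_sequential_limits
proof safe
  obtain C where C: "C > 0" "\<And>y. y \<in> T ` M \<Longrightarrow> \<exists>x\<in>M. T x = y \<and> norm x \<le> C * norm y"
    using bounded_lifting[OF bounded_linear subspace closed R] by metis
  fix s z assume s: "\<forall>n. s n \<in> T ` Y" "s \<longlonglongrightarrow> z"
  from s(1) have "\<forall>n. \<exists>y. y \<in> Y \<and> s n = T y" by blast
  then obtain y where y: "\<And>n. y n \<in> Y" "\<And>n. s n = T (y n)" by metis
  have "z \<in> T ` M"
    by (rule closed_sequentially[OF R _ s(2)]) (use y Y in blast)
  then obtain x where x: "x \<in> M" "z = T x" by blast
  have "\<exists>u. u \<in> M \<and> T u = s n - z \<and> norm u \<le> C * norm (s n - z)" for n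
  proof -
    have "s n - z = T (y n - x)" using x y by (simp add: T_diff)
    moreover have "y n - x \<in> M" using x y Y by (intro mem_diff) auto
    ultimately have "s n - z \<in> T ` M" by blast
    from C(2)[OF this] show ?thesis by blast
  qed
  then obtain u where u: "\<And>n. u n \<in> M" "\<And>n. T (u n) = s n - z" "\<And>n. norm (u n) \<le> C * norm (s n - z)"
    by metis
  have "(\<lambda>n. C * norm (s n - z)) \<longlonglongrightarrow> C * 0"
    using s(2) by (intro tendsto_mult tendsto_const tendsto_norm_zero LIM_zero)
  then have u0: "u \<longlonglongrightarrow> 0"
    using u(3) by (intro tendsto_norm_zero_cancel[of u] Lim_null_comparison[of "\<lambda>n. norm (u n)" "\<lambda>n. C * norm (s n - z)"]) auto
  define Z where "Z = {v + k | v k. v \<in> Y \<and> k \<in> ker_on M T}"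
  have xu: "x + u n \<in> Z" for n
  proof -
    have "T (x + u n - y n) = 0" using x y u by (simp add: T_diff T_add)
    moreover have "x + u n - y n \<in> M"
      using x(1) u(1) y(1) Y(3) by (intro mem_diff mem_add) auto
    ultimately have "x + u n - y n \<in> ker_on M T" by (simp add: ker_on_def)
    moreover have "x + u n = y n + (x + u n - y n)" by simp
    ultimately show ?thesis using y(1) unfolding Z_def by blast
  qed
  have lim: "(\<lambda>n. x + u n) \<longlonglongrightarrow> x + 0" using u0 by (intro tendsto_add tendsto_const)
  have "closed Z" unfolding Z_def using Y(1,2) ker by (rule closed_csubspace_plus_fin_cdim)
  from closed_sequentially[OF this xu lim] have "x \<in> Z" by simp
  then obtain v k where "v \<in> Y" "k \<in> ker_on M T" "x = v + k" unfolding Z_def by blast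
  then show "z \<in> T ` Y" using x by (auto simp: ker_on_def T_add)
qed

lemma pow_image_mono: "m \<le> n \<Longrightarrow> (T ^^ n) ` M \<subseteq> (T ^^ m) ` M"
proof -
  assume "m \<le> n"
  then have "(T ^^ n) ` M = (T ^^ m) ` ((T ^^ (n - m)) ` M)" by (simp add: image_funpow_add)
  also have "\<dots> \<subseteq> (T ^^ m) ` M" using pow_in by (intro image_mono) auto
  finally show ?thesis .
qed

lemma pow_image_subset: "(T ^^ n) ` M \<subseteq> M"
  using pow_in by auto

text \<open>Closedness of the range passes to the ranges of the powers one step at a time, each step
  using the finite-dimensional kernel.\<close>

lemma pow_image_op:
  assumes ker: "fin_cdim (ker_on M T)" and R: "closed (T ` M)"
  shows "restricted_op ((T ^^ n) ` M) T"
proof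
  show "csubspace ((T ^^ n) ` M)" by (rule csubspace_image[OF csubspace clinear_pow])
  show "bounded_clinear T" by (rule bounded)
  show "invariant T ((T ^^ n) ` M)"
    unfolding invariant_def image_funpow_Suc by (rule pow_image_mono) simp
  show "closed ((T ^^ n) ` M)"
  proof (induction n)
    case (Suc n)
    have "closed (T ` ((T ^^ n) ` M))"
      using csubspace_image[OF csubspace clinear_pow] Suc pow_image_subset
      by (rule closed_image_of_closed[OF ker R])
    then show ?case by (simp only: image_funpow_Suc)
  qed (simp add: closed)
qed

text \<open>Once the chain \<open>ker T \<inter> T\<^sup>n M\<close> has become stationary, the restriction to \<open>T\<^sup>n M\<close> is a Kato operator.\<close>

lemma Fredholm_Kato_part:
  assumes "Fredholm_on M T"
  obtains p where "Kato_on ((T ^^ p) ` M) T"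
proof -
  have ker: "fin_cdim (ker_on M T)" and R: "closed (T ` M)" using assms by (auto simp: Fredholm_on_def)
  define V where "V n = ker_on M T \<inter> (T ^^ n) ` M" for n
  have V0: "V 0 = ker_on M T" by (auto simp: V_def ker_on_def)
  have "csubspace (V n)" for n
    unfolding V_def by (intro csubspace_Int csubspace_ker_on csubspace_image csubspace clinear clinear_pow)
  moreover have "V (Suc n) \<subseteq> V n" for n
    using pow_image_mono[of n "Suc n"] unfolding V_def by auto
  moreover have "fin_cdim (V 0)" using ker V0 by simp
  ultimately obtain p where p: "\<And>n. n \<ge> p \<Longrightarrow> V n = V p"
    using fin_cdim_chain_stable[of V] by metis
  interpret P: restricted_op "(T ^^ Suc p) ` M" T by (rule pow_image_op[OF ker R])
  have "ker_on ((T ^^ p) ` M) T = V p" using pow_image_subset[of p] by (auto simp: ker_on_def V_def)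
  moreover have "V p \<subseteq> (T ^^ n) ` ((T ^^ p) ` M)" for n
    using p[of "n + p"] unfolding image_funpow_add V_def by auto
  moreover have "closed (T ` ((T ^^ p) ` M))" unfolding image_funpow_Suc by (rule P.closed)
  ultimately show thesis using that[of p] by (simp add: Kato_on_def)
qed

text \<open>Shifts commute with the powers of \<open>T\<close>, so a shift that is bijective on
  \<open>M\<close> stays bijective on the range of each power; the Kato part inherits
  \<open>near_bij\<close>.\<close>

lemma Fredholm_near_bij_part:
  assumes F: "Fredholm_on M T" and near: near_bij
  obtains p where "bij_on ((T ^^ p) ` M) T"
proof -
  obtain p where p: "Kato_on ((T ^^ p) ` M) T" using Fredholm_Kato_part[OF F] by blast
  interpret P: restricted_op "(T ^^ p) ` M" T
    using F by (intro pow_image_op) (auto simp: Fredholm_on_def)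
  have "bij_on ((T ^^ p) ` M) (shift T \<mu>)" if "bij_on M (shift T \<mu>)" for \<mu>
  proof -
    have "inj_on (shift T \<mu>) ((T ^^ p) ` M)"
      using that pow_image_subset by (auto simp: bij_betw_def intro: inj_on_subset)
    moreover have "shift T \<mu> ` ((T ^^ p) ` M) = (T ^^ p) ` (shift T \<mu> ` M)"
      by (simp add: image_image funpow_shift)
    ultimately show ?thesis using that by (simp add: bij_betw_def)
  qed
  then have P.near_bij using near unfolding near_bij_def P.near_bij_def by blast
  with p have "bij_on ((T ^^ p) ` M) T" by (rule P.Kato_near_bij_imp_bij)
  then show thesis by (rule that)
qed

section \<open>Ascent, descent and the nilpotent part\<close>

lemma bij_part_ascent_descent:
  assumes bij: "bij_on ((T ^^ p) ` M) T"
  shows "finite_ascent_on M T" "finite_descent_on M T"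
proof -
  have inj: "inj_on T ((T ^^ p) ` M)" and im: "T ` ((T ^^ p) ` M) = (T ^^ p) ` M"
    using bij by (simp_all add: bij_betw_def)
  show "finite_descent_on M T"
    using im unfolding finite_descent_on_def image_funpow_Suc by metis
  have "x \<in> ker_on M (T ^^ p) \<longleftrightarrow> x \<in> ker_on M (T ^^ Suc p)" for x
  proof
    assume "x \<in> ker_on M (T ^^ p)"
    then show "x \<in> ker_on M (T ^^ Suc p)" by (simp add: ker_on_def T_0)
  next
    assume x: "x \<in> ker_on M (T ^^ Suc p)"
    have "0 \<in> (T ^^ p) ` M" by (rule csubspace_0[OF csubspace_image[OF csubspace clinear_pow]])
    moreover have "(T ^^ p) x \<in> (T ^^ p) ` M" "T ((T ^^ p) x) = T 0"
      using x by (simp_all add: ker_on_def T_0)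
    ultimately have "(T ^^ p) x = 0" using inj by (meson inj_onD)
    then show "x \<in> ker_on M (T ^^ p)" using x by (simp add: ker_on_def)
  qed
  then show "finite_ascent_on M T" unfolding finite_ascent_on_def by blast
qed

text \<open>\<open>T ^^ p\<close> maps its range onto itself, so \<open>(T ^^ p) y\<close> also has
  a preimage \<open>v\<close> in that range, and \<open>y - v\<close> is killed by
  \<open>T ^^ p\<close>.\<close>

lemma bij_part_decomp:
  assumes bij: "bij_on ((T ^^ p) ` M) T" and y: "y \<in> M"
  obtains v k where "v \<in> (T ^^ p) ` M" "k \<in> ker_on M (T ^^ p)" "y = v + k"
proof -
  have "(T ^^ n) ` ((T ^^ p) ` M) = (T ^^ p) ` M" for n
  proof (induction n)
    case (Suc n)
    have "(T ^^ Suc n) ` ((T ^^ p) ` M) = T ` ((T ^^ n) ` ((T ^^ p) ` M))"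
      by (rule image_funpow_Suc[symmetric])
    then show ?case using bij unfolding Suc by (simp add: bij_betw_def)
  qed simp
  then obtain v where v: "v \<in> (T ^^ p) ` M" "(T ^^ p) v = (T ^^ p) y" using y by (metis imageE imageI)
  have "v \<in> M" using v(1) pow_image_subset by blast
  then have "y - v \<in> ker_on M (T ^^ p)"
    using v y by (simp add: ker_on_def clinear_diff[OF clinear_pow] mem_diff)
  then show thesis using that[OF v(1), of "y - v"] by simp
qed

text \<open>A finite Neumann series, summed by induction: if \<open>w\<close> solves the equation
  with right-hand side \<open>T k\<close>, then \<open>w - k\<close> is mapped to
  \<open>\<mu>\<close> times \<open>k\<close>.\<close>

lemma shift_nilpotent_surj:
  assumes "\<mu> \<noteq> 0" "k \<in> ker_on M (T ^^ p)"
  shows "\<exists>w\<in>ker_on M (T ^^ p). shift T \<mu> w = k"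
  using assms(2)
proof (induction p arbitrary: k)
  case 0
  then show ?case using mem_0
    by (intro bexI[of _ 0]) (simp_all add: ker_on_def shift_def T_0)
next
  case (Suc p)
  then have k: "k \<in> M" "(T ^^ p) (T k) = 0" by (simp_all add: ker_on_def funpow_swap1)
  then have "T k \<in> ker_on M (T ^^ p)" by (simp add: ker_on_def T_in)
  from Suc.IH[OF this] obtain w where w: "w \<in> ker_on M (T ^^ p)" "shift T \<mu> w = T k" by blast
  have "shift T \<mu> (inverse \<mu> *\<^sub>C (w - k)) = inverse \<mu> *\<^sub>C (shift T \<mu> w - shift T \<mu> k)"
    by (simp add: shift_def T_scale T_diff cvs.scale_right_diff_distrib
        scaleC_scaleC mult.commute algebra_simps)
  also have "\<dots> = k" unfolding w(2) using assms(1) by (simp add: shift_def scaleC_scaleC scaleC_one)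
  finally have "shift T \<mu> (inverse \<mu> *\<^sub>C (w - k)) = k" .
  moreover have "w \<in> ker_on M (T ^^ Suc p)" using w(1) by (simp add: ker_on_def T_0)
  then have "inverse \<mu> *\<^sub>C (w - k) \<in> ker_on M (T ^^ Suc p)"
    using Suc.prems by (intro csubspace_scale csubspace_diff csubspace_ker_on csubspace clinear_pow)
  ultimately show ?case by blast
qed

lemma funpow_eigenvector:
  assumes "shift T \<mu> x = 0"
  shows "(T ^^ n) x = \<mu> ^ n *\<^sub>C x"
proof (induction n)
  case (Suc n)
  have "(T ^^ Suc n) x = \<mu> ^ n *\<^sub>C T x" using Suc by (simp add: T_scale)
  also have "T x = \<mu> *\<^sub>C x" using assms by (simp add: shift_def)
  finally show ?case by (simp add: scaleC_scaleC mult.commute)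
qed (simp add: scaleC_one)

lemma shift_nilpotent_inj:
  assumes "\<mu> \<noteq> 0" "k \<in> ker_on M (T ^^ p)" "shift T \<mu> k = 0"
  shows "k = 0"
  using assms funpow_eigenvector[OF assms(3), of p] by (simp add: ker_on_def)

text \<open>Small shifts remain bijective on the range of \<open>T ^^ p\<close>, and nonzero shifts
  are onto on its kernel. No eigenvector escapes: with nonzero eigenvalue it is a multiple of its
  own image under \<open>T ^^ p\<close>, hence lies in the range.\<close>

lemma bij_part_imp_punctured:
  assumes F: "Fredholm_on M T" and bij: "bij_on ((T ^^ p) ` M) T"
  obtains \<delta> where "\<delta> > 0" "\<And>\<mu>. \<mu> \<noteq> 0 \<Longrightarrow> cmod \<mu> < \<delta> \<Longrightarrow> bij_on M (shift T \<mu>)"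
proof -
  interpret P: restricted_op "(T ^^ p) ` M" T
    using F by (intro pow_image_op) (auto simp: Fredholm_on_def)
  obtain \<delta> where \<delta>: "\<delta> > 0" "\<And>\<mu>. cmod \<mu> < \<delta> \<Longrightarrow> bij_on ((T ^^ p) ` M) (shift T \<mu>)"
    using P.bij_shift_small[OF bij] by blast
  have "bij_on M (shift T \<mu>)" if \<mu>: "\<mu> \<noteq> 0" "cmod \<mu> < \<delta>" for \<mu>
  proof -
    interpret S: restricted_op M "shift T \<mu>" by (rule shift_restricted)
    note bijP = \<delta>(2)[OF \<mu>(2)]
    have "inj_on (shift T \<mu>) M"
    proof (rule S.inj_onI_ker)
      fix x assume x: "x \<in> M" "shift T \<mu> x = 0"
      have "x = inverse (\<mu> ^ p) *\<^sub>C (T ^^ p) x"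
        using \<mu>(1) by (simp add: funpow_eigenvector[OF x(2)] scaleC_scaleC scaleC_one)
      moreover have "inverse (\<mu> ^ p) *\<^sub>C (T ^^ p) x \<in> (T ^^ p) ` M"
        using x(1) by (intro P.mem_scale) simp
      ultimately have "x \<in> (T ^^ p) ` M" by simp
      moreover have "shift T \<mu> x = shift T \<mu> 0" using x(2) by (simp add: shift_def T_0)
      ultimately show "x = 0"
        using bijP P.mem_0 unfolding bij_betw_def by (meson inj_onD)
    qed
    moreover have "shift T \<mu> ` M = M"
    proof
      show "shift T \<mu> ` M \<subseteq> M" using S.T_in by blast
      show "M \<subseteq> shift T \<mu> ` M"
      proof
        fix y assume "y \<in> M"
        from bij_part_decomp[OF bij this] obtain v k where
          vk: "v \<in> (T ^^ p) ` M" "k \<in> ker_on M (T ^^ p)" "y = v + k" .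
        obtain v' where "v' \<in> (T ^^ p) ` M" "shift T \<mu> v' = v"
          using vk(1) bijP by (metis bij_betw_def imageE)
        moreover from this have "v' \<in> M" using pow_image_subset by blast
        moreover obtain w where "w \<in> M" "shift T \<mu> w = k"
          using shift_nilpotent_surj[OF \<mu>(1) vk(2)] unfolding ker_on_def by blast
        ultimately have "shift T \<mu> (v' + w) = y" "v' + w \<in> M"
          using vk(3) by (simp_all add: S.T_add mem_add)
        then show "y \<in> shift T \<mu> ` M" by blast
      qed
    qed
    ultimately show ?thesis by (simp add: bij_betw_def)
  qed
  with \<delta>(1) show thesis by (rule that)
qed

text \<open>Converse of \<open>bij_part_ascent_descent\<close>. The two facts together replace
  ascent and descent by one condition, bijectivity on the range of a single power, which is easier
  to restrict and to perturb.\<close>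

lemma Browder_imp_bij_part:
  assumes "finite_ascent_on M T" "finite_descent_on M T"
  obtains p where "bij_on ((T ^^ p) ` M) T"
proof -
  obtain a where a: "ker_on M (T ^^ a) = ker_on M (T ^^ Suc a)"
    using assms(1) by (auto simp: finite_ascent_on_def)
  obtain d where d: "(T ^^ d) ` M = (T ^^ Suc d) ` M"
    using assms(2) by (auto simp: finite_descent_on_def)
  \<comment> \<open>Both chains stay constant once they repeat, so the larger exponent serves
    injectivity and surjectivity alike.\<close>
  define p where "p = max a d"
  have "inj_on T ((T ^^ p) ` M)"
  proof (rule inj_onI)
    fix y y' assume "y \<in> (T ^^ p) ` M" "y' \<in> (T ^^ p) ` M" and eq: "T y = T y'"
    then have "y - y' \<in> (T ^^ p) ` M" by (intro csubspace_diff[OF csubspace_image[OF csubspace clinear_pow]])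
    then obtain z where z: "z \<in> M" "y - y' = (T ^^ p) z" by blast
    have pa: "p = a + (p - a)" by (simp add: p_def)
    have "(T ^^ Suc a) ((T ^^ (p - a)) z) = T ((T ^^ p) z)"
      by (subst (2) pa) (simp only: funpow_add funpow.simps o_apply)
    also have "\<dots> = 0" using eq by (simp add: T_diff flip: z(2))
    finally have "(T ^^ (p - a)) z \<in> ker_on M (T ^^ Suc a)" using z pow_in by (simp add: ker_on_def)
    then have "(T ^^ (p - a)) z \<in> ker_on M (T ^^ a)" using a by simp
    then have "(T ^^ a) ((T ^^ (p - a)) z) = 0" by (simp add: ker_on_def)
    then have "(T ^^ p) z = 0" by (subst pa) (simp only: funpow_add o_apply)
    then show "y = y'" using z(2) by simp
  qed
  moreover have "T ` ((T ^^ p) ` M) = (T ^^ p) ` M"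
  proof -
    have pd: "p = (p - d) + d" by (simp add: p_def)
    have "T ` ((T ^^ p) ` M) = (T ^^ (p - d + Suc d)) ` M"
      unfolding image_funpow_Suc by (subst pd) simp
    also have "\<dots> = (T ^^ (p - d)) ` ((T ^^ Suc d) ` M)" by (rule image_funpow_add[symmetric])
    also have "\<dots> = (T ^^ p) ` M" unfolding d[symmetric] image_funpow_add by (subst (2) pd) (rule refl)
    finally show ?thesis .
  qed
  ultimately show thesis using that[of p] by (simp add: bij_betw_def)
qed

lemma Browder_imp_punctured:
  assumes "Browder_on M T"
  obtains \<delta> where "\<delta> > 0" "\<And>\<mu>. \<mu> \<noteq> 0 \<Longrightarrow> cmod \<mu> < \<delta> \<Longrightarrow> bij_on M (shift T \<mu>)"
proof -
  have F: "Fredholm_on M T" and ad: "finite_ascent_on M T" "finite_descent_on M T"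
    using assms by (auto simp: Browder_on_def)
  obtain p where "bij_on ((T ^^ p) ` M) T" using Browder_imp_bij_part[OF ad] .
  from bij_part_imp_punctured[OF F this] that show thesis .
qed

text \<open>The set of \<open>\<nu> \<noteq> 0\<close> with a punctured neighbourhood in the resolvent set is open, closed in
  \<open>- {0}\<close> and contains all large \<open>\<nu>\<close>, and \<open>- {0}\<close> is connected.\<close>

lemma Riesz_punctured:
  assumes R: "Riesz_on M T" and \<nu>: "\<nu> \<noteq> 0"
  shows "\<exists>\<delta>>0. \<forall>\<mu>. \<mu> \<noteq> \<nu> \<and> cmod (\<mu> - \<nu>) < \<delta> \<longrightarrow> bij_on M (shift T \<mu>)"
proof -
  define U where "U = {\<nu>. \<nu> \<noteq> 0 \<and> (\<exists>\<delta>>0. \<forall>\<mu>. \<mu> \<noteq> \<nu> \<and> cmod (\<mu> - \<nu>) < \<delta> \<longrightarrow> bij_on M (shift T \<mu>))}"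
  have sub: "U \<subseteq> - {0}" unfolding U_def by blast
  have opU: "open U"
    unfolding open_contains_ball
  proof
    fix l assume "l \<in> U"
    then obtain \<delta> where l: "l \<noteq> 0" "\<delta> > 0" "\<And>\<mu>. \<mu> \<noteq> l \<Longrightarrow> cmod (\<mu> - l) < \<delta> \<Longrightarrow> bij_on M (shift T \<mu>)"
      unfolding U_def by blast
    define e where "e = min \<delta> (cmod l)"
    have "l' \<in> U" if l': "l' \<in> ball l e" for l'
    proof (cases "l' = l")
      case True
      then show ?thesis using \<open>l \<in> U\<close> by simp
    next
      case False
      \<comment> \<open>The disc about \<open>l'\<close> stays inside the disc about
        \<open>l\<close> and avoids \<open>l\<close>, where bijectivity is unknown.\<close>
      define d where "d = min (\<delta> - cmod (l' - l)) (cmod (l' - l))"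
      have d0: "d > 0" using False l' by (auto simp: d_def e_def dist_norm norm_minus_commute)
      have "bij_on M (shift T \<mu>)" if "cmod (\<mu> - l') < d" for \<mu>
      proof (rule l(3))
        show "\<mu> \<noteq> l" using that by (auto simp: d_def norm_minus_commute)
        have "cmod (\<mu> - l) \<le> cmod (\<mu> - l') + cmod (l' - l)"
          using norm_triangle_ineq[of "\<mu> - l'" "l' - l"] by simp
        then show "cmod (\<mu> - l) < \<delta>" using that by (simp add: d_def)
      qed
      moreover have "l' \<noteq> 0" using l' by (auto simp: e_def dist_norm)
      ultimately show ?thesis unfolding U_def using d0 by blast
    qed
    moreover have "e > 0" using l by (simp add: e_def)
    ultimately show "\<exists>e>0. ball l e \<subseteq> U" by blast
  qed
  \<comment> \<open>The only place where Fredholmness enters: a point of the closure is a limit of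
    regular points, and \<open>Fredholm_near_bij_part\<close> turns this into a punctured
    neighbourhood of regular points.\<close>
  have clU: "l \<in> U" if l: "l \<noteq> 0" "l \<in> closure U" for l
  proof -
    interpret S: restricted_op M "shift T l" by (rule shift_restricted)
    have F: "Fredholm_on M (shift T l)" using R l(1) by (simp add: Riesz_on_def)
    have "S.near_bij"
      unfolding S.near_bij_def
    proof (intro allI impI)
      fix e :: real assume "e > 0"
      then obtain l' where l': "l' \<in> U" "dist l' l < e / 2"
        using l(2) unfolding closure_approachable by (meson half_gt_zero)
      from l'(1) obtain \<delta> where d: "\<delta> > 0" "\<And>\<mu>. \<mu> \<noteq> l' \<Longrightarrow> cmod (\<mu> - l') < \<delta> \<Longrightarrow> bij_on M (shift T \<mu>)"
        unfolding U_def by blast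
      define t where "t = min \<delta> e / 3"
      have t: "t > 0" "t < \<delta>" "t \<le> e / 3" using d \<open>e > 0\<close> by (auto simp: t_def)
      \<comment> \<open>A step aside by \<open>t\<close>, because \<open>l'\<close> itself need not
        be regular.\<close>
      let ?m = "l' + of_real t"
      have "bij_on M (shift T ?m)" using t by (intro d(2)) auto
      moreover have "cmod (?m - l) < e"
      proof -
        have "cmod (?m - l) \<le> cmod (l' - l) + cmod (of_real t)"
          using norm_triangle_ineq[of "l' - l" "of_real t"] by (simp add: algebra_simps)
        then show ?thesis using t l'(2) by (simp add: dist_norm)
      qed
      ultimately show "\<exists>\<mu>. cmod \<mu> < e \<and> bij_on M (shift (shift T l) \<mu>)"
        by (intro exI[of _ "?m - l"]) (simp add: shift_shift)
    qed
    from S.Fredholm_near_bij_part[OF F this] obtain p where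
      p: "bij_on ((shift T l ^^ p) ` M) (shift T l)" .
    obtain \<delta> where \<delta>: "\<delta> > 0" "\<And>\<mu>. \<mu> \<noteq> 0 \<Longrightarrow> cmod \<mu> < \<delta> \<Longrightarrow> bij_on M (shift (shift T l) \<mu>)"
      using S.bij_part_imp_punctured[OF F p] by blast
    have "bij_on M (shift T \<mu>)" if "\<mu> \<noteq> l" "cmod (\<mu> - l) < \<delta>" for \<mu>
      using \<delta>(2)[of "\<mu> - l"] that by (simp add: shift_shift)
    then show ?thesis unfolding U_def using l(1) \<delta>(1) by blast
  qed
  have ne: "U \<noteq> {}"
  proof -
    obtain K where K: "K \<ge> 0" "\<And>\<mu>. cmod \<mu> > K \<Longrightarrow> bij_on M (shift T \<mu>)" using bij_shift_large by blast
    \<comment> \<open>The unit disc about \<open>K + 2\<close> still lies outside the disc of radius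
      \<open>K\<close>.\<close>
    let ?l = "of_real (K + 2) :: complex"
    have nl: "cmod ?l = K + 2" using K(1) by (simp only: norm_of_real)
    have "bij_on M (shift T \<mu>)" if "cmod (\<mu> - ?l) < 1" for \<mu>
    proof (rule K(2))
      have "cmod ?l \<le> cmod \<mu> + cmod (\<mu> - ?l)" using norm_triangle_sub[of ?l \<mu>] by (simp add: norm_minus_commute)
      then show "cmod \<mu> > K" using that nl by linarith
    qed
    moreover have "cmod ?l > 0" unfolding nl using K(1) by linarith
    then have "?l \<noteq> 0" unfolding zero_less_norm_iff .
    ultimately have "?l \<in> U" unfolding U_def using zero_less_one by blast
    then show ?thesis by blast
  qed
  have "connected (- {0::complex})" by (intro connected_punctured_universe) simp
  moreover have "openin (top_of_set (- {0})) U" using opU sub by (simp add: openin_open_eq open_Compl)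
  moreover have "closedin (top_of_set (- {0})) U"
  proof -
    have "U = - {0} \<inter> closure U" using clU sub closure_subset by auto
    then show ?thesis by (metis closed_closure closedin_closed_Int)
  qed
  ultimately have "U = - {0}" using ne unfolding connected_clopen by blast
  then have "\<nu> \<in> U" using \<nu> by simp
  then show ?thesis unfolding U_def by blast
qed

lemma Riesz_Browder:
  assumes R: "Riesz_on M T" and \<nu>: "\<nu> \<noteq> 0"
  shows "Browder_on M (shift T \<nu>)"
proof -
  interpret S: restricted_op M "shift T \<nu>" by (rule shift_restricted)
  have F: "Fredholm_on M (shift T \<nu>)" using R \<nu> by (simp add: Riesz_on_def)
  obtain \<delta> where \<delta>: "\<delta> > 0" "\<And>\<mu>. \<mu> \<noteq> \<nu> \<Longrightarrow> cmod (\<mu> - \<nu>) < \<delta> \<Longrightarrow> bij_on M (shift T \<mu>)"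
    using Riesz_punctured[OF R \<nu>] by blast
  have "S.near_bij"
    unfolding S.near_bij_def shift_shift
  proof (intro allI impI)
    fix e :: real assume "e > 0"
    define t where "t = min \<delta> e / 2"
    have t: "t > 0" "t < \<delta>" "t < e" using \<delta> \<open>e > 0\<close> by (auto simp: t_def)
    then show "\<exists>\<mu>. cmod \<mu> < e \<and> bij_on M (shift T (\<nu> + \<mu>))"
      by (intro exI[of _ "of_real t"] conjI \<delta>(2)) auto
  qed
  from S.Fredholm_near_bij_part[OF F this] obtain p where
    p: "bij_on ((shift T \<nu> ^^ p) ` M) (shift T \<nu>)" .
  then show ?thesis using F S.bij_part_ascent_descent by (simp add: Browder_on_def)
qed

text \<open>\<open>Riesz_punctured\<close> says nothing about 0, so \<open>\<nu>\<close> is first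
  replaced by a nearby nonzero \<open>\<kappa>\<close>.\<close>

lemma Riesz_dense_bij:
  assumes R: "Riesz_on M T" and e: "e > 0"
  obtains \<mu> where "cmod (\<mu> - \<nu>) < e" "bij_on M (shift T \<mu>)"
proof -
  obtain \<kappa> where k: "\<kappa> \<noteq> 0" "cmod (\<kappa> - \<nu>) < e / 2"
  proof (cases "\<nu> = 0")
    case True
    then show ?thesis using e that[of "of_real (e / 3)"] by simp
  qed (use e that[of \<nu>] in simp)
  obtain \<delta> where \<delta>: "\<delta> > 0" "\<And>\<mu>. \<mu> \<noteq> \<kappa> \<Longrightarrow> cmod (\<mu> - \<kappa>) < \<delta> \<Longrightarrow> bij_on M (shift T \<mu>)"
    using Riesz_punctured[OF R k(1)] by blast
  define t where "t = min \<delta> e / 3"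
  have t: "t > 0" "t < \<delta>" "t \<le> e / 3" using \<delta> e by (auto simp: t_def)
  have "cmod (\<kappa> + of_real t - \<nu>) \<le> cmod (\<kappa> - \<nu>) + cmod (of_real t)"
    using norm_triangle_ineq[of "\<kappa> - \<nu>" "of_real t"] by (simp add: algebra_simps)
  then have "cmod (\<kappa> + of_real t - \<nu>) < e" using t k by simp
  moreover have "bij_on M (shift T (\<kappa> + of_real t))" using t by (intro \<delta>(2)) auto
  ultimately show thesis by (rule that)
qed

end

subsection \<open>Reducing decompositions\<close>

lemma closed_direct_sum_commute: "closed_direct_sum M N \<Longrightarrow> closed_direct_sum N M"
  unfolding closed_direct_sum_def by (metis add.commute inf_commute)

lemma closed_direct_sum_unique:
  assumes "closed_direct_sum M N" "m \<in> M" "m' \<in> M" "n \<in> N" "n' \<in> N" "m + n = m' + n'"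
  shows "m = m'" "n = n'"
proof -
  have "m - m' = n' - n" using assms(6) by (simp add: algebra_simps)
  moreover have "m - m' \<in> M" "n' - n \<in> N"
    using assms by (auto simp: closed_direct_sum_def intro: csubspace_diff)
  ultimately have "m - m' \<in> M \<inter> N" by simp
  moreover have "M \<inter> N = {0}" using assms(1) by (simp add: closed_direct_sum_def)
  ultimately have "m - m' = 0" by blast
  then show "m = m'" by simp
  then show "n = n'" using assms(6) by simp
qed

text \<open>The bounded lifting lemma, applied to addition \<open>M \<times> N \<rightarrow> X\<close>, makes the projections bounded.\<close>

lemma closed_direct_sum_projection:
  fixes M N :: "'a::cbanach set"
  assumes MN: "closed_direct_sum M N"
  obtains P where "bounded_clinear P" "\<And>x. P x \<in> M" "\<And>x. x - P x \<in> N"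
    "\<And>x. x \<in> M \<Longrightarrow> P x = x" "\<And>x. x \<in> N \<Longrightarrow> P x = 0"
proof -
  have sM: "csubspace M" and sN: "csubspace N" and cl: "closed M" "closed N"
    and ex: "\<And>x. \<exists>m\<in>M. \<exists>n\<in>N. x = m + n"
    using MN by (auto simp: closed_direct_sum_def)
  have "\<exists>m. m \<in> M \<and> x - m \<in> N" for x using ex[of x] by force
  then obtain P where P: "\<And>x. P x \<in> M" "\<And>x. x - P x \<in> N" by metis
  have P_eq: "P (m + n) = m" if "m \<in> M" "n \<in> N" for m n
    by (rule closed_direct_sum_unique(1)[OF MN P(1) that(1) P(2)[of "m + n"] that(2)]) simp
  have "clinear P"
    unfolding clinear_def
  proof (intro conjI allI)
    fix x y
    have "P ((P x + P y) + ((x - P x) + (y - P y))) = P x + P y"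
      by (intro P_eq csubspace_add[OF sM] csubspace_add[OF sN] P)
    then show "P (x + y) = P x + P y" by simp
  next
    fix c x
    have "P (c *\<^sub>C P x + c *\<^sub>C (x - P x)) = c *\<^sub>C P x"
      by (intro P_eq csubspace_scale[OF sM] csubspace_scale[OF sN] P)
    then show "P (c *\<^sub>C x) = c *\<^sub>C P x" by (simp flip: scaleC_add_right)
  qed
  moreover have "\<exists>K. \<forall>x. norm (P x) \<le> norm x * K"
  proof -
    let ?f = "\<lambda>p::'a \<times> 'a. fst p + snd p"
    have im: "?f ` (M \<times> N) = UNIV" using ex by force
    have "subspace (M \<times> N)"
      by (intro subspace_Times csubspace_imp_subspace sM sN)
    moreover have "closed (M \<times> N)" by (intro closed_Times cl)
    moreover have "bounded_linear ?f" by (intro bounded_linear_add bounded_linear_fst bounded_linear_snd)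
    ultimately obtain C where C: "\<And>y. y \<in> ?f ` (M \<times> N) \<Longrightarrow> \<exists>p\<in>M \<times> N. ?f p = y \<and> norm p \<le> C * norm y"
      using bounded_lifting[of ?f "M \<times> N"] im by (metis closed_UNIV)
    have "norm (P x) \<le> norm x * C" for x
    proof -
      obtain p where p: "p \<in> M \<times> N" "?f p = x" "norm p \<le> C * norm x" using C[of x] im by blast
      then have "P x = fst p" using P_eq[of "fst p" "snd p"] by auto
      then show ?thesis using p(3) norm_fst_le[of "fst p" "snd p"] by (simp add: mult.commute)
    qed
    then show ?thesis by blast
  qed
  moreover have "P x = x" if "x \<in> M" for x using P_eq[OF that csubspace_0[OF sN]] by simp
  moreover have "P x = 0" if "x \<in> N" for x using P_eq[OF csubspace_0[OF sM] that] by simp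
  ultimately show thesis using that P by (simp add: bounded_clinear_def)
qed

lemma projection_closed_direct_sum:
  assumes P: "bounded_clinear P" "P \<circ> P = P"
  shows "closed_direct_sum {x. P x = x} {x. P x = 0}"
proof -
  have cl: "clinear P" by (rule bounded_clinear_clinear[OF P(1)])
  have PP: "P (P x) = P x" for x using P(2) by (metis o_apply)
  have I: "bounded_clinear (\<lambda>x. P x - x)" by (intro bounded_clinear_diff P bounded_clinear_id)
  have eq: "{x. P x = x} = ker_on UNIV (\<lambda>x. P x - x)" "{x. P x = 0} = ker_on UNIV P"
    by (auto simp: ker_on_def)
  have "csubspace {x. P x = x}" "csubspace {x. P x = 0}" "closed {x. P x = x}" "closed {x. P x = 0}"
    unfolding eq using cl P(1) I
    by (auto intro!: csubspace_ker_on closed_ker_on csubspace_UNIV bounded_clinear_clinear)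
  moreover have "\<exists>m\<in>{x. P x = x}. \<exists>n\<in>{x. P x = 0}. x = m + n" for x
    by (rule bexI[of _ "P x"], rule bexI[of _ "x - P x"]) (simp_all add: PP clinear_diff[OF cl])
  moreover have "{x. P x = x} \<inter> {x. P x = 0} = {0}" using clinear_0[OF cl] by auto
  ultimately show ?thesis by (simp add: closed_direct_sum_def)
qed

section \<open>Operators that agree on a subspace\<close>

lemma funpow_cong_on:
  assumes "\<And>x. x \<in> M \<Longrightarrow> S x = T x" "invariant T M" "x \<in> M"
  shows "(S ^^ n) x = (T ^^ n) x" "(T ^^ n) x \<in> M"
  using assms by (induction n) (auto simp: invariant_def)

lemma ker_on_cong: "(\<And>x. x \<in> M \<Longrightarrow> S x = T x) \<Longrightarrow> ker_on M S = ker_on M T"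
  by (auto simp: ker_on_def)

lemma Fredholm_on_cong:
  assumes "\<And>x. x \<in> M \<Longrightarrow> S x = T x"
  shows "Fredholm_on M S \<longleftrightarrow> Fredholm_on M T"
proof -
  have "S ` M = T ` M" using assms by (rule image_cong[OF refl])
  then show ?thesis by (simp add: Fredholm_on_def ker_on_cong[OF assms])
qed

lemma Riesz_on_cong:
  assumes "\<And>x. x \<in> M \<Longrightarrow> S x = T x"
  shows "Riesz_on M S \<longleftrightarrow> Riesz_on M T"
proof -
  have "Fredholm_on M (shift S \<mu>) \<longleftrightarrow> Fredholm_on M (shift T \<mu>)" for \<mu>
    using assms by (intro Fredholm_on_cong) (simp add: shift_def)
  then show ?thesis by (simp add: Riesz_on_def)
qed

lemma Browder_on_cong:
  assumes eq: "\<And>x. x \<in> M \<Longrightarrow> S x = T x" and inv: "invariant T M"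
  shows "Browder_on M S \<longleftrightarrow> Browder_on M T"
proof -
  have "ker_on M (S ^^ n) = ker_on M (T ^^ n)" for n
    by (rule ker_on_cong) (rule funpow_cong_on(1)[OF eq inv])
  moreover have "(S ^^ n) ` M = (T ^^ n) ` M" for n
    by (rule image_cong[OF refl]) (rule funpow_cong_on(1)[OF eq inv])
  ultimately show ?thesis
    using Fredholm_on_cong[OF eq] by (simp only: Browder_on_def finite_ascent_on_def finite_descent_on_def)
qed

text \<open>Meant for condition (iv), where \<open>TST - T\<close> equals \<open>-T\<close> on the
  second summand.\<close>

lemma Riesz_on_minus:
  assumes "csubspace M" "clinear T" "Riesz_on M T"
  shows "Riesz_on M (\<lambda>x. - T x)"
  unfolding Riesz_on_def
proof (intro allI impI)
  fix \<mu> :: complex assume "\<mu> \<noteq> 0"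
  then have F: "Fredholm_on M (shift T (- \<mu>))" using assms(3) by (simp add: Riesz_on_def)
  have neg: "shift (\<lambda>x. - T x) \<mu> x = - shift T (- \<mu>) x" for x by (simp add: shift_def)
  have neg': "shift (\<lambda>x. - T x) \<mu> x = shift T (- \<mu>) (- x)" for x
    by (simp add: shift_def clinear_minus[OF assms(2)])
  have "uminus ` M = M"
  proof
    show "M \<subseteq> uminus ` M"
    proof
      fix x assume "x \<in> M"
      then have "- x \<in> M" by (rule csubspace_minus[OF assms(1)])
      then have "- (- x) \<in> uminus ` M" by (rule imageI)
      then show "x \<in> uminus ` M" by simp
    qed
  qed (use csubspace_minus[OF assms(1)] in auto)
  then have "shift (\<lambda>x. - T x) \<mu> ` M = shift T (- \<mu>) ` M"
    unfolding neg' using image_image[of "shift T (- \<mu>)" uminus M] by simp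
  moreover have "ker_on M (shift (\<lambda>x. - T x) \<mu>) = ker_on M (shift T (- \<mu>))"
    by (simp add: ker_on_def neg)
  ultimately show "Fredholm_on M (shift (\<lambda>x. - T x) \<mu>)" using F by (simp add: Fredholm_on_def)
qed

locale reduced_op =
  fixes M N :: "'a::cbanach set" and T :: "'a \<Rightarrow> 'a"
  assumes sum: "closed_direct_sum M N" and bounded: "bounded_clinear T"
    and invM: "invariant T M" and invN: "invariant T N"

sublocale reduced_op \<subseteq> onM: restricted_op M T
  using sum bounded invM by unfold_locales (simp_all add: closed_direct_sum_def)

sublocale reduced_op \<subseteq> onN: restricted_op N T
  using sum bounded invN by unfold_locales (simp_all add: closed_direct_sum_def)

sublocale reduced_op \<subseteq> onX: restricted_op UNIV T
  using bounded by unfold_locales (simp_all add: csubspace_UNIV invariant_def)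

lemma reduced_op_commute: "reduced_op M N T \<Longrightarrow> reduced_op N M T"
  by (simp add: reduced_op_def closed_direct_sum_commute)

context reduced_op
begin

text \<open>The projection onto \<open>M\<close> along \<open>N\<close>. It is picked by choice only
  to have a name in the locale; the listed properties determine it.\<close>

definition proj :: "'a \<Rightarrow> 'a" where
  "proj = (SOME P. bounded_clinear P \<and> (\<forall>x. P x \<in> M) \<and> (\<forall>x. x - P x \<in> N) \<and>
     (\<forall>x\<in>M. P x = x) \<and> (\<forall>x\<in>N. P x = 0))"

lemma proj: "bounded_clinear proj" "proj x \<in> M" "x - proj x \<in> N"
  "x \<in> M \<Longrightarrow> proj x = x" "x \<in> N \<Longrightarrow> proj x = 0"
proof -
  let ?R = "\<lambda>P. bounded_clinear P \<and> (\<forall>x. P x \<in> M) \<and> (\<forall>x. x - P x \<in> N) \<and>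
     (\<forall>x\<in>M. P x = x) \<and> (\<forall>x\<in>N. P x = 0)"
  have "\<exists>P. ?R P" using closed_direct_sum_projection[OF sum] by metis
  then have "?R proj" unfolding proj_def by (rule someI_ex)
  then show "bounded_clinear proj" "proj x \<in> M" "x - proj x \<in> N"
    "x \<in> M \<Longrightarrow> proj x = x" "x \<in> N \<Longrightarrow> proj x = 0" by blast+
qed

lemma proj_cl: "clinear proj" by (rule bounded_clinear_clinear[OF proj(1)])

lemmas proj_0 = clinear_0[OF proj_cl]
  and proj_add = clinear_add[OF proj_cl]
  and proj_diff = clinear_diff[OF proj_cl]
  and proj_scale = clinear_scale[OF proj_cl]

lemma proj_T: "proj (T x) = T (proj x)"
proof -
  have "proj (T (proj x) + T (x - proj x)) = T (proj x) + 0"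
    using proj by (simp add: proj_add onM.T_in onN.T_in)
  then show ?thesis by (simp flip: onM.T_add)
qed

lemma coproj_T: "T x - proj (T x) = T (x - proj x)"
  by (simp add: proj_T onM.T_diff)

lemma coproj_bounded: "bounded_clinear (\<lambda>x. x - proj x)"
  by (intro bounded_clinear_diff bounded_clinear_id proj)

lemma reduced_cong: "bounded_clinear S \<Longrightarrow> invariant S M \<Longrightarrow> invariant S N \<Longrightarrow> reduced_op M N S"
  using sum by unfold_locales

lemma reduced_shift: "reduced_op M N (shift T \<mu>)"
  using onM.shift_restricted onN.shift_restricted by (intro reduced_cong) (auto simp: restricted_op_def)

text \<open>Projecting a preimage along \<open>M\<close> gives a preimage in \<open>N\<close>. The
  statement for the other summand comes from \<open>reduced_op_commute\<close>.\<close>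

lemma bij_on_component:
  assumes bij: "bij_on UNIV T"
  shows "bij_on N T"
proof -
  have "y \<in> T ` N" if y: "y \<in> N" for y
  proof -
    obtain x where "y = T x" using bij by (auto simp: bij_betw_def)
    then have "y = T (x - proj x)" using coproj_T[of x] proj(5)[OF y] by simp
    then show ?thesis using proj(3) by blast
  qed
  then have "T ` N = N" using onN.T_in by blast
  then show ?thesis using bij inj_on_subset[of T UNIV N] by (simp add: bij_betw_def)
qed

lemma bij_UNIV_iff: "bij_on UNIV T \<longleftrightarrow> bij_on M T \<and> bij_on N T"
proof
  assume "bij_on UNIV T"
  then show "bij_on M T \<and> bij_on N T"
    using bij_on_component
      reduced_op.bij_on_component[OF reduced_op_commute[OF reduced_op_axioms]] by blast
next
  assume bij: "bij_on M T \<and> bij_on N T"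
  have "inj_on T UNIV"
  proof (rule onX.inj_onI_ker)
    fix x assume "T x = 0"
    then have "T (proj x) = T 0" "T (x - proj x) = T 0"
      using proj_T[of x] coproj_T[of x] by (simp_all add: onM.T_0 proj_0)
    then have "proj x = 0" "x - proj x = 0"
      using bij proj(2,3)[of x] onM.mem_0 onN.mem_0
      unfolding bij_betw_def by (meson inj_onD)+
    then show "x = 0" by simp
  qed
  moreover have "y \<in> range T" for y
  proof -
    obtain m n where "proj y = T m" "y - proj y = T n"
      using bij proj(2,3)[of y] unfolding bij_betw_def by (metis imageE)
    then have "y = T (m + n)" by (metis add_diff_cancel_left' onM.T_add diff_add_cancel add.commute)
    then show ?thesis by blast
  qed
  ultimately show "bij_on UNIV T" by (auto simp: bij_betw_def)
qed

lemma Fredholm_on_component: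
  assumes F: "Fredholm_on UNIV T"
  shows "Fredholm_on N T"
  unfolding Fredholm_on_def
proof (intro conjI)
  show "fin_cdim (ker_on N T)"
  proof (rule fin_cdim_subset)
    show "fin_cdim (ker_on UNIV T)" using F by (simp add: Fredholm_on_def)
    show "csubspace (ker_on N T)" by (rule csubspace_ker_on[OF onN.csubspace onN.clinear])
  qed (auto simp: ker_on_def)
  have "T ` N = range T \<inter> N"
  proof
    show "range T \<inter> N \<subseteq> T ` N"
    proof
      fix y assume "y \<in> range T \<inter> N"
      then obtain x where "y = T x" "y \<in> N" by blast
      then have "y = T (x - proj x)" using coproj_T[of x] proj(5)[of y] by simp
      then show "y \<in> T ` N" using proj(3) by blast
    qed
  qed (use onN.T_in in blast)
  moreover have "closed (range T)" using F by (simp add: Fredholm_on_def)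
  ultimately show "closed (T ` N)" using onN.closed by (simp add: closed_Int)
  obtain F' where F': "fin_cdim F'" "\<And>x. \<exists>y\<in>range T. \<exists>f\<in>F'. x = y + f"
    using F unfolding Fredholm_on_def by blast
  show "\<exists>F. fin_cdim F \<and> F \<subseteq> N \<and> (\<forall>x\<in>N. \<exists>y\<in>T ` N. \<exists>f\<in>F. x = y + f)"
  proof (intro exI[of _ "(\<lambda>x. x - proj x) ` F'"] conjI ballI)
    show "fin_cdim ((\<lambda>x. x - proj x) ` F')"
      using F'(1) bounded_clinear_clinear[OF coproj_bounded] by (rule fin_cdim_image)
    show "(\<lambda>x. x - proj x) ` F' \<subseteq> N" using proj(3) by blast
    fix x assume x: "x \<in> N"
    obtain z f where zf: "f \<in> F'" "x = T z + f" using F'(2)[of x] by blast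
    have "x = x - proj x" using proj(5)[OF x] by simp
    also have "\<dots> = T (z - proj z) + (f - proj f)"
      unfolding zf(2) coproj_T[symmetric] by (simp add: proj_add)
    finally show "\<exists>y\<in>T ` N. \<exists>f\<in>(\<lambda>x. x - proj x) ` F'. x = y + f"
      using proj(3)[of z] zf(1) by blast
  qed
qed

lemma Browder_on_component:
  assumes B: "Browder_on UNIV T"
  shows "Browder_on N T"
proof -
  obtain p where p: "bij_on (range (T ^^ p)) T"
    using B onX.Browder_imp_bij_part by (auto simp: Browder_on_def)
  have coproj_pow: "(T ^^ n) x - proj ((T ^^ n) x) = (T ^^ n) (x - proj x)" for n x
    by (induction n) (simp_all add: coproj_T)
  have "inj_on T ((T ^^ p) ` N)" using p by (auto simp: bij_betw_def intro: inj_on_subset)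
  moreover have "T ` ((T ^^ p) ` N) = (T ^^ p) ` N"
  proof
    show "T ` ((T ^^ p) ` N) \<subseteq> (T ^^ p) ` N"
      unfolding image_funpow_Suc by (rule onN.pow_image_mono) simp
    show "(T ^^ p) ` N \<subseteq> T ` ((T ^^ p) ` N)"
    proof
      fix y assume y: "y \<in> (T ^^ p) ` N"
      then have "y \<in> range (T ^^ p)" "y \<in> N" using onN.pow_in by auto
      then obtain x where "y = (T ^^ Suc p) x"
        using p unfolding bij_betw_def image_funpow_Suc by (metis imageE)
      then have "y = (T ^^ Suc p) (x - proj x)"
        using coproj_pow[of "Suc p" x] proj(5)[OF \<open>y \<in> N\<close>] by simp
      then show "y \<in> T ` ((T ^^ p) ` N)" unfolding image_funpow_Suc using proj(3) by blast
    qed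
  qed
  ultimately have "bij_on ((T ^^ p) ` N) T" by (simp add: bij_betw_def)
  then show ?thesis
    using onN.bij_part_ascent_descent Fredholm_on_component B by (simp add: Browder_on_def)
qed

text \<open>Besides \<open>K = M\<close>, the case of interest is the nilpotent part \<open>K\<close> of a Browder operator on \<open>M\<close>.\<close>

lemma Fredholm_on_sum:
  assumes bij: "bij_on K T" and K: "csubspace K" "closed K" "K \<subseteq> M" and F: "Fredholm_on N T"
  shows "Fredholm_on {x. proj x \<in> K} T"
  unfolding Fredholm_on_def
proof (intro conjI)
  have N: "x \<in> {x. proj x \<in> K}" if "x \<in> N" for x using that proj(5) csubspace_0[OF K(1)] by simp
  have inj: "inj_on T K" and im: "T ` K = K" using bij by (auto simp: bij_betw_def)
  have "ker_on {x. proj x \<in> K} T = ker_on N T"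
  proof
    show "ker_on {x. proj x \<in> K} T \<subseteq> ker_on N T"
    proof
      fix x assume "x \<in> ker_on {x. proj x \<in> K} T"
      then have x: "proj x \<in> K" "T x = 0" by (auto simp: ker_on_def)
      then have "T (proj x) = T 0"
        using proj_T[of x] by (simp add: onM.T_0 proj_0)
      then have "proj x = 0" using inj x(1) csubspace_0[OF K(1)] by (meson inj_onD)
      then show "x \<in> ker_on N T" using proj(3)[of x] x(2) by (simp add: ker_on_def)
    qed
  qed (use N in \<open>auto simp: ker_on_def\<close>)
  then show "fin_cdim (ker_on {x. proj x \<in> K} T)" using F by (simp add: Fredholm_on_def)
  \<comment> \<open>Describing the image through the two continuous projections exhibits it as an
    intersection of preimages of closed sets.\<close>
  have im_iff: "T ` {x. proj x \<in> K} = proj -` K \<inter> (\<lambda>x. x - proj x) -` (T ` N)"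
  proof
    show "T ` {x. proj x \<in> K} \<subseteq> proj -` K \<inter> (\<lambda>x. x - proj x) -` (T ` N)"
      using proj(3) im by (auto simp: proj_T simp flip: onM.T_diff)
    show "proj -` K \<inter> (\<lambda>x. x - proj x) -` (T ` N) \<subseteq> T ` {x. proj x \<in> K}"
    proof
      fix y assume y: "y \<in> proj -` K \<inter> (\<lambda>x. x - proj x) -` (T ` N)"
      then obtain n where n: "n \<in> N" "y - proj y = T n" by auto
      obtain k where k: "k \<in> K" "proj y = T k" using y im by (metis IntD1 imageE vimageD)
      have "T (k + n) = proj y + (y - proj y)" unfolding n(2) unfolding k(2) by (rule onM.T_add)
      then have "y = T (k + n)" by simp
      moreover have "proj (k + n) = k" using k n K(3) proj(4,5) by (auto simp: proj_add)
      ultimately show "y \<in> T ` {x. proj x \<in> K}" using k by auto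
    qed
  qed
  have cont: "continuous_on UNIV proj" "continuous_on UNIV (\<lambda>x. x - proj x)"
    by (intro linear_continuous_on bounded_clinear_linear proj(1) coproj_bounded)+
  have "closed (T ` N)" using F by (simp add: Fredholm_on_def)
  then show "closed (T ` {x. proj x \<in> K})"
    unfolding im_iff by (intro closed_Int closed_vimage K cont)
  obtain F' where F': "fin_cdim F'" "F' \<subseteq> N" "\<And>x. x \<in> N \<Longrightarrow> \<exists>y\<in>T ` N. \<exists>f\<in>F'. x = y + f"
    using F unfolding Fredholm_on_def by blast
  show "\<exists>F. fin_cdim F \<and> F \<subseteq> {x. proj x \<in> K} \<and>
      (\<forall>x\<in>{x. proj x \<in> K}. \<exists>y\<in>T ` {x. proj x \<in> K}. \<exists>f\<in>F. x = y + f)"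
  proof (intro exI[of _ F'] conjI ballI)
    fix x assume "x \<in> {x. proj x \<in> K}"
    then obtain k where k: "k \<in> K" "proj x = T k" using im by (metis imageE mem_Collect_eq)
    obtain n f where nf: "n \<in> N" "f \<in> F'" "x - proj x = T n + f" using F'(3)[OF proj(3)[of x]] by blast
    have "x = proj x + (x - proj x)" by simp
    also have "\<dots> = T (k + n) + f" unfolding nf(3) by (simp add: k onM.T_add add.assoc)
    finally have "x = T (k + n) + f" .
    have "proj (k + n) = k" using k nf K(3) proj(4,5) by (auto simp: proj_add)
    then have "k + n \<in> {x. proj x \<in> K}" using k(1) by simp
    with \<open>x = T (k + n) + f\<close> show "\<exists>y\<in>T ` {x. proj x \<in> K}. \<exists>f\<in>F'. x = y + f" using nf(2) by blast
  qed (use F' N in auto)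
qed

lemma Fredholm_on_UNIV:
  assumes "bij_on M T" "Fredholm_on N T"
  shows "Fredholm_on UNIV T"
proof -
  have "{x. proj x \<in> M} = UNIV" using proj(2) by auto
  then show ?thesis using Fredholm_on_sum[OF assms(1) onM.csubspace onM.closed subset_refl assms(2)] by simp
qed

text \<open>Since \<open>T\<close> is bijective on \<open>M\<close>, the exponent that works on
  \<open>N\<close> works on the whole space.\<close>

lemma Browder_on_UNIV:
  assumes bij: "bij_on M T" and B: "Browder_on N T"
  shows "Browder_on UNIV T"
proof -
  have F: "Fredholm_on UNIV T" using Fredholm_on_UNIV[OF bij] B by (simp add: Browder_on_def)
  obtain p where p: "bij_on ((T ^^ p) ` N) T"
    using B onN.Browder_imp_bij_part by (auto simp: Browder_on_def)
  have proj_pow: "proj ((T ^^ n) x) = (T ^^ n) (proj x)" for n x by (induction n) (simp_all add: proj_T)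
  have "inj_on T (range (T ^^ p))"
  proof (rule inj_onI)
    fix y y' assume "y \<in> range (T ^^ p)" "y' \<in> range (T ^^ p)" and eq: "T y = T y'"
    then have "y - y' \<in> range (T ^^ p)"
      by (intro csubspace_diff[OF csubspace_image[OF csubspace_UNIV onM.clinear_pow]])
    then obtain x where x: "y - y' = (T ^^ p) x" by blast
    define z where "z = y - y'"
    have Tz: "T z = 0" using eq by (simp add: z_def onM.T_diff)
    have "T (proj z) = T 0" "T (z - proj z) = T 0"
      using proj_T[of z] coproj_T[of z] Tz by (simp_all add: onM.T_0 proj_0)
    moreover have "z - proj z = (T ^^ p) (x - proj x)"
      unfolding z_def x by (simp add: proj_pow clinear_diff[OF onM.clinear_pow])
    then have "z - proj z \<in> (T ^^ p) ` N" using proj(3) by blast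
    moreover have "0 \<in> (T ^^ p) ` N" by (rule csubspace_0[OF csubspace_image[OF onN.csubspace onN.clinear_pow]])
    ultimately have "z - proj z = 0" "proj z = 0"
      using p bij proj(2)[of z] onM.mem_0 unfolding bij_betw_def by (meson inj_onD)+
    then show "y = y'" by (simp add: z_def)
  qed
  moreover have "T ` range (T ^^ p) = range (T ^^ p)"
  proof
    show "T ` range (T ^^ p) \<subseteq> range (T ^^ p)"
      unfolding image_funpow_Suc by (rule onX.pow_image_mono) simp
    show "range (T ^^ p) \<subseteq> T ` range (T ^^ p)"
    proof
      fix y assume "y \<in> range (T ^^ p)"
      then obtain x where x: "y = (T ^^ p) x" by blast
      obtain m where m: "proj x = T m" using bij proj(2)[of x] unfolding bij_betw_def by (metis imageE)
      have "(T ^^ p) (x - proj x) \<in> T ` ((T ^^ p) ` N)" using p proj(3)[of x] by (auto simp: bij_betw_def)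
      then obtain n where n: "(T ^^ p) (x - proj x) = T ((T ^^ p) n)" by blast
      have "y = (T ^^ p) (proj x) + (T ^^ p) (x - proj x)" unfolding x by (simp flip: clinear_add[OF onM.clinear_pow])
      also have "\<dots> = T ((T ^^ p) (m + n))"
        unfolding n unfolding m by (simp add: clinear_add[OF onM.clinear_pow] onM.T_add funpow_swap1)
      finally show "y \<in> T ` range (T ^^ p)" by blast
    qed
  qed
  ultimately have "bij_on (range (T ^^ p)) T" by (simp add: bij_betw_def)
  then show ?thesis using onX.bij_part_ascent_descent[of p] F by (simp add: Browder_on_def)
qed

text \<open>On \<open>M\<close> a shift is multiplication by \<open>-\<mu>\<close>, bijective for
  nonzero \<open>\<mu>\<close>, so \<open>M\<close> has no influence. This links the Riesz operators
  on the whole space in (iv) to (vi) with the restriction of \<open>T\<close> to one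
  summand.\<close>

lemma Riesz_UNIV_iff:
  assumes zero: "\<And>x. x \<in> M \<Longrightarrow> T x = 0"
  shows "Riesz_on UNIV T \<longleftrightarrow> Riesz_on N T"
proof -
  have "Fredholm_on UNIV (shift T \<mu>) \<longleftrightarrow> Fredholm_on N (shift T \<mu>)" if \<mu>: "\<mu> \<noteq> 0" for \<mu>
  proof -
    interpret S: reduced_op M N "shift T \<mu>" by (rule reduced_shift)
    have "bij_on M (shift T \<mu>)"
    proof (rule bij_betw_byWitness[of _ "\<lambda>x. (- inverse \<mu>) *\<^sub>C x"])
      show "shift T \<mu> ` M \<subseteq> M" using S.onM.T_in by blast
      show "(\<lambda>x. (- inverse \<mu>) *\<^sub>C x) ` M \<subseteq> M" using onM.mem_scale by blast
      show "\<forall>x\<in>M. (- inverse \<mu>) *\<^sub>C shift T \<mu> x = x"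
        using \<mu> zero by (simp add: shift_def scaleC_scaleC scaleC_one)
      show "\<forall>x\<in>M. shift T \<mu> ((- inverse \<mu>) *\<^sub>C x) = x"
        using \<mu> zero onM.mem_scale[of _ "- inverse \<mu>"]
        by (simp add: shift_def scaleC_scaleC scaleC_one)
    qed
    then show ?thesis using S.Fredholm_on_UNIV S.Fredholm_on_component by blast
  qed
  then show ?thesis by (simp add: Riesz_on_def)
qed

end

subsection \<open>The conditions without the SVEP\<close>

definition Riesz_decomposable :: "('a::cbanach \<Rightarrow> 'a) \<Rightarrow> bool" where
  "Riesz_decomposable T \<longleftrightarrow>
     (\<exists>M N. reduced_op M N T \<and> bij_on M T \<and> Riesz_on N T)"

lemma Riesz_decomposable_iff:
  assumes T: "bounded_clinear T"
  shows "Riesz_decomposable T \<longleftrightarrow> (\<exists>M N. closed_direct_sum M N \<and> invariant T M \<and>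
     invariant T N \<and> invertible_on M T \<and> Riesz_on N T)"
proof -
  have "reduced_op M N T \<and> bij_on M T \<and> Riesz_on N T \<longleftrightarrow> closed_direct_sum M N \<and>
     invariant T M \<and> invariant T N \<and> invertible_on M T \<and> Riesz_on N T" for M N
  proof (cases "reduced_op M N T")
    case True
    then interpret reduced_op M N T .
    show ?thesis using sum invM invN onM.invertible_on_iff True by blast
  next
    case False
    then show ?thesis using T unfolding reduced_op_def by blast
  qed
  then show ?thesis unfolding Riesz_decomposable_def by simp
qed

lemma GKRD_iff:
  assumes T: "bounded_clinear T"
  shows "GKRD T \<longleftrightarrow> (\<exists>M N. reduced_op M N T \<and> Kato_on M T \<and> Riesz_on N T)"
  unfolding GKRD_def reduced_op_def using T by blast

lemma bij_imp_Kato: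
  assumes "bij_on M T" "closed M"
  shows "Kato_on M T"
proof -
  have "(T ^^ n) ` M = M" for n
  proof (induction n)
    case (Suc n)
    have "(T ^^ Suc n) ` M = T ` ((T ^^ n) ` M)" by (rule image_funpow_Suc[symmetric])
    then show ?case using assms(1) unfolding Suc by (simp add: bij_betw_def)
  qed simp
  then show ?thesis using assms by (simp add: Kato_on_def ker_on_def bij_betw_def)
qed

lemma Riesz_decomposable_imp_GKRD:
  assumes "bounded_clinear T" "Riesz_decomposable T"
  shows "GKRD T"
proof -
  obtain M N where MN: "reduced_op M N T" "bij_on M T" "Riesz_on N T"
    using assms(2) unfolding Riesz_decomposable_def by blast
  interpret reduced_op M N T by (rule MN(1))
  have "Kato_on M T" by (rule bij_imp_Kato[OF MN(2) onM.closed])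
  then show ?thesis using GKRD_iff[OF assms(1)] MN by blast
qed

text \<open>Serves (ii), (viii) and (ix) at once, which differ only in how regular points near 0 are
  found. The pair of the GKRD is kept.\<close>

lemma GKRD_near_bij_imp_decomposable:
  assumes T: "bounded_clinear T" and G: "GKRD T"
    and near: "\<And>\<epsilon>. \<epsilon> > 0 \<Longrightarrow> \<exists>\<mu>. cmod \<mu> < \<epsilon> \<and> bij_on UNIV (shift T \<mu>)"
  shows "Riesz_decomposable T"
proof -
  obtain M N where MN: "reduced_op M N T" "Kato_on M T" "Riesz_on N T"
    using G GKRD_iff[OF T] by blast
  interpret reduced_op M N T by (rule MN(1))
  have "bij_on M (shift T \<mu>)" if "bij_on UNIV (shift T \<mu>)" for \<mu>
    using that reduced_op.bij_UNIV_iff[OF reduced_shift] by blast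
  then have onM.near_bij unfolding onM.near_bij_def using near by blast
  then have "bij_on M T" by (rule onM.Kato_near_bij_imp_bij[OF MN(2)])
  then show ?thesis unfolding Riesz_decomposable_def using MN by blast
qed

section \<open>From the decomposition to projections and inverses\<close>

context reduced_op
begin

context
  assumes bij: "bij_on M T" and R: "Riesz_on N T"
begin

text \<open>Both summands must be regular at the same point: small shifts are on \<open>M\<close>,
  and on \<open>N\<close> regular points are dense. Approximating every small \<open>\<nu>\<close>,
  not just 0, later yields nonzero regular points.\<close>

lemma near_0_dense_bij:
  obtains \<delta> where "\<delta> > 0" "\<And>\<nu> \<epsilon>. cmod \<nu> < \<delta> \<Longrightarrow> \<epsilon> > 0 \<Longrightarrow>
     \<exists>\<mu>. cmod (\<mu> - \<nu>) < \<epsilon> \<and> bij_on UNIV (shift T \<mu>)"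
proof -
  obtain \<delta> where \<delta>: "\<delta> > 0" "\<And>\<mu>. cmod \<mu> < \<delta> \<Longrightarrow> bij_on M (shift T \<mu>)"
    using onM.bij_shift_small[OF bij] by blast
  have "\<exists>\<mu>. cmod (\<mu> - \<nu>) < \<epsilon> \<and> bij_on UNIV (shift T \<mu>)" if "cmod \<nu> < \<delta>" "\<epsilon> > 0" for \<nu> \<epsilon>
  proof -
    define e where "e = min \<epsilon> (\<delta> - cmod \<nu>)"
    have "e > 0" using that by (simp add: e_def)
    then obtain \<mu> where \<mu>: "cmod (\<mu> - \<nu>) < e" "bij_on N (shift T \<mu>)"
      using onN.Riesz_dense_bij[OF R] by blast
    have "cmod \<mu> \<le> cmod (\<mu> - \<nu>) + cmod \<nu>" using norm_triangle_ineq[of "\<mu> - \<nu>" \<nu>] by simp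
    then have "cmod \<mu> < \<delta>" using \<mu>(1) by (simp add: e_def)
    then have "bij_on UNIV (shift T \<mu>)"
      using \<mu>(2) \<delta>(2) reduced_op.bij_UNIV_iff[OF reduced_shift] by blast
    then show ?thesis using \<mu>(1) by (auto simp: e_def)
  qed
  with \<delta>(1) show thesis by (rule that)
qed

lemma Browder_near_0:
  obtains \<delta> where "\<delta> > 0" "\<And>\<mu>. \<mu> \<noteq> 0 \<Longrightarrow> cmod \<mu> < \<delta> \<Longrightarrow> Browder (shift T \<mu>)"
proof -
  obtain \<delta> where \<delta>: "\<delta> > 0" "\<And>\<mu>. cmod \<mu> < \<delta> \<Longrightarrow> bij_on M (shift T \<mu>)"
    using onM.bij_shift_small[OF bij] by blast
  have "Browder (shift T \<mu>)" if "\<mu> \<noteq> 0" "cmod \<mu> < \<delta>" for \<mu>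
    by (rule reduced_op.Browder_on_UNIV[OF reduced_shift \<delta>(2)[OF that(2)] onN.Riesz_Browder[OF R that(1)]])
  with \<delta>(1) show thesis by (rule that)
qed

text \<open>The generalized Drazin-Riesz inverse: the inverse of \<open>T\<close> on
  \<open>M\<close> and zero on \<open>N\<close>. It also supplies both factors in (v).\<close>

definition partial_inverse :: "'a \<Rightarrow> 'a" where
  "partial_inverse x = inv_into M T (proj x)"

lemma T_partial_inverse: "T (partial_inverse x) = proj x" "partial_inverse x \<in> M"
  using bij proj(2)[of x] by (simp_all add: partial_inverse_def bij_betw_def f_inv_into_f inv_into_into)

lemma partial_inverse_T: "partial_inverse (T x) = proj x"
  using bij proj(2)[of x] by (simp add: partial_inverse_def bij_betw_def proj_T)

lemma bounded_clinear_partial_inverse: "bounded_clinear partial_inverse"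
proof -
  have inj: "partial_inverse x = y" if "y \<in> M" "T y = proj x" for x y
    using bij that by (metis T_partial_inverse bij_betw_def inj_onD)
  have "clinear partial_inverse"
    unfolding clinear_def
  proof (intro conjI allI)
    fix x y show "partial_inverse (x + y) = partial_inverse x + partial_inverse y"
      by (rule inj) (simp_all add: T_partial_inverse onM.T_add proj_add
          onM.mem_add)
  next
    fix c x show "partial_inverse (c *\<^sub>C x) = c *\<^sub>C partial_inverse x"
      by (rule inj) (simp_all add: T_partial_inverse onM.T_scale proj_scale
          onM.mem_scale)
  qed
  moreover obtain c where c: "c > 0" "\<And>x. x \<in> M \<Longrightarrow> c * norm x \<le> norm (T x)"
    using onM.lower_bound_bij[OF bij] by blast
  obtain K where K: "\<And>x. norm (proj x) \<le> norm x * K"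
    using proj(1) unfolding bounded_clinear_def by blast
  have "norm (partial_inverse x) \<le> norm x * (K / c)" for x
    using order_trans[OF c(2)[OF T_partial_inverse(2)[of x]]] K[of x] c(1)
    by (simp add: T_partial_inverse field_simps)
  ultimately show ?thesis unfolding bounded_clinear_def by blast
qed

lemma partial_inverse_proj: "partial_inverse (proj x) = partial_inverse x"
  by (simp add: partial_inverse_def proj)

lemma imp_gen_Drazin_Riesz: "gen_Drazin_Riesz_invertible T"
  unfolding gen_Drazin_Riesz_invertible_def
proof (rule exI[of _ partial_inverse], intro conjI bounded_clinear_partial_inverse)
  show "T \<circ> partial_inverse = partial_inverse \<circ> T"
    by (simp add: fun_eq_iff T_partial_inverse partial_inverse_T)
  show "partial_inverse \<circ> T \<circ> partial_inverse = partial_inverse"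
    by (simp add: fun_eq_iff T_partial_inverse partial_inverse_proj)
  let ?A = "\<lambda>x. T (partial_inverse (T x)) - T x"
  have A: "?A x = T (proj x) - T x" for x by (simp add: partial_inverse_T)
  have bA: "bounded_clinear ?A"
    by (intro bounded_clinear_diff bounded_clinear_compose[OF bounded] bounded
        bounded_clinear_compose[OF bounded_clinear_partial_inverse])
  have "reduced_op M N ?A"
    by (rule reduced_cong[OF bA]) (auto simp: A invariant_def proj onM.T_0
        intro: onM.T_in onN.T_in csubspace_minus[OF onN.csubspace] onM.mem_0)
  moreover have "?A x = 0" if "x \<in> M" for x using that by (simp add: A proj)
  ultimately have "Riesz ?A \<longleftrightarrow> Riesz_on N ?A" by (rule reduced_op.Riesz_UNIV_iff)
  also have "\<dots> \<longleftrightarrow> Riesz_on N (\<lambda>x. - T x)"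
    by (rule Riesz_on_cong) (simp add: A proj onM.T_0)
  finally show "Riesz ?A" using Riesz_on_minus[OF onN.csubspace onN.clinear R] by simp
qed

lemma coproj_reduced:
  "reduced_op M N (\<lambda>x. T (x - proj x))"
proof (rule reduced_cong)
  show "bounded_clinear (\<lambda>x. T (x - proj x))"
    by (rule bounded_clinear_compose[OF bounded coproj_bounded])
qed (auto simp: invariant_def proj onM.T_0 intro: onN.T_in onM.mem_0)

lemma Riesz_coproj: "Riesz (\<lambda>x. T (x - proj x))"
proof -
  have "Riesz (\<lambda>x. T (x - proj x)) \<longleftrightarrow> Riesz_on N (\<lambda>x. T (x - proj x))"
    by (rule reduced_op.Riesz_UNIV_iff[OF coproj_reduced]) (simp add: proj onM.T_0)
  also have "\<dots> \<longleftrightarrow> Riesz_on N T"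
    by (rule Riesz_on_cong) (simp add: proj)
  finally show ?thesis using R by simp
qed

lemma proj_idem: "proj \<circ> proj = proj"
  by (simp add: fun_eq_iff proj)

lemma imp_Riesz_quasipolar: "Riesz_quasipolar T"
  unfolding Riesz_quasipolar_def
proof (rule exI[of _ proj], intro conjI proj(1) proj_idem Riesz_coproj)
  show "T \<circ> proj = proj \<circ> T" by (simp add: fun_eq_iff proj_T)
  show "\<exists>A. bounded_clinear A \<and> proj = A \<circ> T"
    by (intro exI[of _ partial_inverse]) (simp add: bounded_clinear_partial_inverse fun_eq_iff partial_inverse_T)
  show "\<exists>B. bounded_clinear B \<and> proj = T \<circ> B"
    by (intro exI[of _ partial_inverse]) (simp add: bounded_clinear_partial_inverse fun_eq_iff T_partial_inverse)
qed

text \<open>\<open>P\<close> projects onto the Riesz summand. On \<open>M\<close> the sum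
  \<open>T + P\<close> is the bijective \<open>T\<close>; on \<open>N\<close> it is
  \<open>T + 1\<close>, a nonzero shift of a Riesz operator and hence Browder.\<close>

lemma imp_Browder_perturbation:
  "\<exists>P. bounded_clinear P \<and> P \<circ> P = P \<and> T \<circ> P = P \<circ> T \<and> Browder (\<lambda>x. T x + P x) \<and> Riesz (T \<circ> P)"
proof (intro exI[of _ "\<lambda>x. x - proj x"] conjI coproj_bounded)
  show "(\<lambda>x. x - proj x) \<circ> (\<lambda>x. x - proj x) = (\<lambda>x. x - proj x)"
    by (simp add: fun_eq_iff proj_diff proj)
  show "T \<circ> (\<lambda>x. x - proj x) = (\<lambda>x. x - proj x) \<circ> T" by (simp add: fun_eq_iff coproj_T)
  show "Riesz (T \<circ> (\<lambda>x. x - proj x))" using Riesz_coproj by (simp add: o_def)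
  let ?B = "\<lambda>x. T x + (x - proj x)"
  have bB: "bounded_clinear ?B" by (intro bounded_clinear_add bounded coproj_bounded)
  have red: "reduced_op M N ?B"
    by (rule reduced_cong[OF bB]) (auto simp: invariant_def proj onM.T_in onN.T_in onN.mem_add)
  have "bij_on M ?B"
    using bij by (subst bij_betw_cong[of M ?B T]) (simp_all add: proj)
  moreover have "Browder_on N ?B \<longleftrightarrow> Browder_on N (shift T (- 1))"
    using reduced_shift[of "- 1"]
    by (intro Browder_on_cong) (auto simp: shift_def proj scaleC_one reduced_op_def)
  then have "Browder_on N ?B" using onN.Riesz_Browder[OF R, of "- 1"] by simp
  ultimately show "Browder ?B" by (rule reduced_op.Browder_on_UNIV[OF red])
qed

end

lemma Browder_Riesz_imp_decomposable:
  assumes B: "Browder_on M T" and R: "Riesz_on N T"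
  shows "Riesz_decomposable T"
proof -
  obtain p where p: "bij_on ((T ^^ p) ` M) T"
    using onM.Browder_imp_bij_part B unfolding Browder_on_def by blast
  define Y where "Y = (T ^^ p) ` M"
  define K where "K = ker_on M (T ^^ p)"
  \<comment> \<open>\<open>N'\<close> is the sum of \<open>K\<close> and \<open>N\<close>. Written
    through \<open>proj\<close> it is the kernel of a bounded operator, hence closed.\<close>
  define N' where "N' = {x. proj x \<in> K}"
  interpret Y: restricted_op Y T
    unfolding Y_def using B by (intro onM.pow_image_op) (auto simp: Browder_on_def Fredholm_on_def)
  have K: "csubspace K" "closed K" "K \<subseteq> M"
    unfolding K_def
    by (rule csubspace_ker_on[OF onM.csubspace onM.clinear_pow],
        rule closed_ker_on[OF onM.closed bounded_clinear_funpow[OF bounded]], simp add: ker_on_def)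
  have YM: "Y \<subseteq> M" unfolding Y_def by (rule onM.pow_image_subset)
  have TK: "T x \<in> K" if "x \<in> K" for x
    using that by (auto simp: K_def ker_on_def onM.T_in funpow_swap1[symmetric] onM.T_0)
  have powbij: "bij_on Y (T ^^ n)" for n
  proof (induction n)
    case (Suc n)
    then show ?case using p bij_betw_trans[of "T ^^ n" Y Y T Y] by (simp add: Y_def o_def)
  qed (simp add: bij_betw_def)
  have YK: "x = 0" if "x \<in> Y" "x \<in> K" for x
  proof -
    have "(T ^^ p) x = (T ^^ p) 0" using that(2) by (simp add: K_def ker_on_def clinear_0[OF onM.clinear_pow])
    then show ?thesis
      using powbij[of p] that(1) Y.mem_0 unfolding bij_betw_def by (meson inj_onD)
  qed
  have N'eq: "N' = ker_on UNIV ((T ^^ p) \<circ> proj)"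
    using proj(2) by (auto simp: N'_def K_def ker_on_def)
  have bp: "bounded_clinear ((T ^^ p) \<circ> proj)"
    unfolding o_def by (intro bounded_clinear_compose[OF bounded_clinear_funpow[OF bounded]] proj(1))
  have sum': "closed_direct_sum Y N'"
    unfolding closed_direct_sum_def
  proof (intro conjI allI)
    show "csubspace N'" unfolding N'eq
      by (rule csubspace_ker_on[OF csubspace_UNIV bounded_clinear_clinear[OF bp]])
    show "closed N'" unfolding N'eq by (rule closed_ker_on[OF closed_UNIV bp])
    show "Y \<inter> N' = {0}"
      using YK YM proj(4) Y.mem_0 csubspace_0[OF K(1)]
      by (auto simp: N'_def proj_0)
    fix x
    obtain v k where vk: "v \<in> Y" "k \<in> K" "proj x = v + k"
      using onM.bij_part_decomp[OF p proj(2)[of x]] unfolding Y_def K_def by metis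
    have "proj (k + (x - proj x)) = k"
      using vk(2) K(3) proj(4)[of k] proj(5)[OF proj(3)[of x]] by (auto simp: proj_add)
    then have "k + (x - proj x) \<in> N'" using vk(2) by (simp add: N'_def)
    moreover have "x = v + (k + (x - proj x))" using vk(3) by simp
    ultimately show "\<exists>m\<in>Y. \<exists>n\<in>N'. x = m + n" using vk(1) by blast
  qed (rule Y.csubspace Y.closed)+
  have red: "reduced_op Y N' T"
    using sum' bounded Y.inv by unfold_locales (auto simp: invariant_def N'_def proj_T TK)
  have "Riesz_on N' T"
    unfolding Riesz_on_def
  proof (intro allI impI)
    fix \<mu> :: complex assume \<mu>: "\<mu> \<noteq> 0"
    interpret S: reduced_op M N "shift T \<mu>" by (rule reduced_shift)
    have bijK: "bij_on K (shift T \<mu>)"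
      unfolding bij_betw_def
    proof
      show "inj_on (shift T \<mu>) K"
      proof (rule inj_onI)
        fix x y assume xy: "x \<in> K" "y \<in> K" "shift T \<mu> x = shift T \<mu> y"
        then have "x - y \<in> K" "shift T \<mu> (x - y) = 0"
          by (simp_all add: csubspace_diff[OF K(1)] S.onM.T_diff)
        then have "x - y = 0" unfolding K_def by (rule onM.shift_nilpotent_inj[OF \<mu>])
        then show "x = y" by simp
      qed
      show "shift T \<mu> ` K = K"
      proof
        show "shift T \<mu> ` K \<subseteq> K"
          unfolding shift_def using TK csubspace_diff[OF K(1)] csubspace_scale[OF K(1)] by blast
        show "K \<subseteq> shift T \<mu> ` K" using onM.shift_nilpotent_surj[OF \<mu>] unfolding K_def by blast
      qed
    qed
    have "Fredholm_on N (shift T \<mu>)" using R \<mu> by (simp add: Riesz_on_def)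
    from S.Fredholm_on_sum[OF bijK K this] show "Fredholm_on N' (shift T \<mu>)"
      unfolding N'_def .
  qed
  moreover have "bij_on Y T" using p by (simp add: Y_def)
  ultimately show ?thesis unfolding Riesz_decomposable_def using red by blast
qed

end

lemma decomposableE:
  assumes "Riesz_decomposable T"
  obtains M N where "reduced_op M N T" "bij_on M T" "Riesz_on N T"
  using assms unfolding Riesz_decomposable_def by blast

lemma decomposable_iff_Browder_Riesz:
  assumes T: "bounded_clinear T"
  shows "Riesz_decomposable T \<longleftrightarrow> (\<exists>M N. closed_direct_sum M N \<and> invariant T M \<and>
     invariant T N \<and> Browder_on M T \<and> Riesz_on N T)"
proof
  assume "Riesz_decomposable T"
  then obtain M N where MN: "reduced_op M N T" "bij_on M T" "Riesz_on N T" by (rule decomposableE)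
  interpret reduced_op M N T by (rule MN(1))
  have "T ` M = M" and inj: "inj_on T M" using MN(2) by (auto simp: bij_betw_def)
  moreover have "ker_on M T = {0}"
  proof -
    have "x = 0" if "x \<in> M" "T x = 0" for x
      using inj_onD[OF inj, of x 0] that onM.mem_0 onM.T_0 by simp
    then show ?thesis
      using onM.mem_0 onM.T_0 by (auto simp: ker_on_def)
  qed
  moreover have "\<exists>F. fin_cdim F \<and> F \<subseteq> M \<and> (\<forall>x\<in>M. \<exists>y\<in>M. \<exists>f\<in>F. x = y + f)"
    using onM.mem_0 fin_cdim_zero by (intro exI[of _ "{0}"]) auto
  ultimately have "Fredholm_on M T" using fin_cdim_zero onM.closed by (simp add: Fredholm_on_def)
  \<comment> \<open>Exponent 0: \<open>T\<close> is already bijective on \<open>M\<close>.\<close>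
  moreover have "finite_ascent_on M T" "finite_descent_on M T"
    using onM.bij_part_ascent_descent[of 0] MN(2) by simp_all
  ultimately show "\<exists>M N. closed_direct_sum M N \<and> invariant T M \<and>
     invariant T N \<and> Browder_on M T \<and> Riesz_on N T"
    using sum invM invN MN(3) unfolding Browder_on_def by blast
next
  assume "\<exists>M N. closed_direct_sum M N \<and> invariant T M \<and>
     invariant T N \<and> Browder_on M T \<and> Riesz_on N T"
  then obtain M N where "reduced_op M N T" "Browder_on M T" "Riesz_on N T"
    using T unfolding reduced_op_def by blast
  then show "Riesz_decomposable T" by (rule reduced_op.Browder_Riesz_imp_decomposable)
qed

lemma decomposable_imp_gen_Drazin_Riesz:
  "Riesz_decomposable T \<Longrightarrow> gen_Drazin_Riesz_invertible T"
  by (erule decomposableE) (rule reduced_op.imp_gen_Drazin_Riesz)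

lemma decomposable_imp_Riesz_quasipolar:
  "Riesz_decomposable T \<Longrightarrow> Riesz_quasipolar T"
  by (erule decomposableE) (rule reduced_op.imp_Riesz_quasipolar)

lemma decomposable_imp_Browder_perturbation:
  "Riesz_decomposable T \<Longrightarrow> \<exists>P. bounded_clinear P \<and> P \<circ> P = P \<and> T \<circ> P = P \<circ> T \<and>
     Browder (\<lambda>x. T x + P x) \<and> Riesz (T \<circ> P)"
  by (erule decomposableE) (rule reduced_op.imp_Browder_perturbation)

section \<open>From commuting projections to the decomposition\<close>

lemma commuting_projection_reduced:
  assumes T: "bounded_clinear T" and P: "bounded_clinear P" "P \<circ> P = P" and TP: "\<And>x. P (T x) = T (P x)"
  shows "reduced_op {x. P x = x} {x. P x = 0} T"
  using projection_closed_direct_sum[OF P] T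
  by unfold_locales (auto simp: invariant_def TP clinear_0[OF bounded_clinear_clinear[OF T]])

text \<open>\<open>STS = S\<close> makes the product of \<open>S\<close> and \<open>T\<close>
  idempotent. On its range \<open>S\<close> inverts \<open>T\<close>, and on its kernel
  \<open>TST - T\<close> is \<open>-T\<close>.\<close>

lemma gen_Drazin_Riesz_imp_decomposable:
  assumes T: "bounded_clinear T" and D: "gen_Drazin_Riesz_invertible T"
  shows "Riesz_decomposable T"
proof -
  obtain S where S: "bounded_clinear S" "T \<circ> S = S \<circ> T" "S \<circ> T \<circ> S = S"
    and R: "Riesz (\<lambda>x. T (S (T x)) - T x)"
    using D unfolding gen_Drazin_Riesz_invertible_def by blast
  have TS: "T (S x) = S (T x)" for x using S(2) by (metis o_apply)
  have STS: "S (S (T x)) = S x" for x using S(3) by (metis o_apply TS)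
  define P where "P x = S (T x)" for x
  have PP: "P \<circ> P = P" by (simp add: fun_eq_iff P_def TS STS)
  have bP: "bounded_clinear P" unfolding P_def[abs_def] by (rule bounded_clinear_compose[OF S(1) T])
  let ?M = "{x. P x = x}" and ?N = "{x. P x = 0}" and ?A = "\<lambda>x. T (S (T x)) - T x"
  have bA: "bounded_clinear ?A"
    by (intro bounded_clinear_diff bounded_clinear_compose[OF T] bounded_clinear_compose[OF S(1)] T)
  interpret reduced_op ?M ?N T
    by (rule commuting_projection_reduced[OF T bP PP]) (simp add: P_def TS)
  interpret S: restricted_op UNIV S
    using S(1) by unfold_locales (simp_all add: csubspace_UNIV invariant_def)
  have redA: "reduced_op ?M ?N ?A"
    by (rule commuting_projection_reduced[OF bA bP PP])
      (simp add: P_def TS onM.T_diff S.T_diff)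
  have "bij_on ?M T"
  proof (rule bij_betw_byWitness[of _ S])
    show "T ` ?M \<subseteq> ?M" using onM.T_in by blast
    show "S ` ?M \<subseteq> ?M" by (auto simp: P_def TS STS)
    show "\<forall>x\<in>?M. S (T x) = x" "\<forall>x\<in>?M. T (S x) = x" by (simp_all add: P_def TS)
  qed
  moreover have "Riesz_on ?N T"
  proof -
    have "Riesz ?A \<longleftrightarrow> Riesz_on ?N ?A"
      by (rule reduced_op.Riesz_UNIV_iff[OF redA]) (simp add: P_def)
    also have "\<dots> \<longleftrightarrow> Riesz_on ?N (\<lambda>x. - T x)"
      by (rule Riesz_on_cong) (simp add: P_def onM.T_0)
    finally have "Riesz_on ?N (\<lambda>x. - T x)" using R by simp
    moreover have "clinear (\<lambda>x. - T x)"
      by (simp add: clinear_def onM.T_add onM.T_scale)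
    ultimately have "Riesz_on ?N (\<lambda>x. - (- T x))"
      using Riesz_on_minus[OF onN.csubspace] by blast
    then show ?thesis by simp
  qed
  ultimately show ?thesis
    unfolding Riesz_decomposable_def using reduced_op_axioms by blast
qed

lemma Riesz_quasipolar_imp_decomposable:
  assumes T: "bounded_clinear T" and D: "Riesz_quasipolar T"
  shows "Riesz_decomposable T"
proof -
  obtain Q A B where Q: "bounded_clinear Q" "Q \<circ> Q = Q" "T \<circ> Q = Q \<circ> T"
    and R: "Riesz (\<lambda>x. T (x - Q x))" and AB: "Q = A \<circ> T" "Q = T \<circ> B"
    using D unfolding Riesz_quasipolar_def by blast
  have TQ: "Q (T x) = T (Q x)" for x using Q(3) by (metis o_apply)
  have QQ: "Q (Q x) = Q x" for x using Q(2) by (metis o_apply)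
  let ?M = "{x. Q x = x}" and ?N = "{x. Q x = 0}" and ?A = "\<lambda>x. T (x - Q x)"
  interpret reduced_op ?M ?N T
    by (rule commuting_projection_reduced[OF T Q(1,2) TQ])
  have bA: "bounded_clinear ?A"
    by (intro bounded_clinear_compose[OF T] bounded_clinear_diff bounded_clinear_id Q(1))
  have redA: "reduced_op ?M ?N ?A"
    by (rule commuting_projection_reduced[OF bA Q(1,2)])
      (simp add: TQ clinear_diff[OF bounded_clinear_clinear[OF Q(1)]])
  have "bij_on ?M T"
  \<comment> \<open>\<open>B\<close> need not map the range of \<open>Q\<close> into itself, so it
    is compressed by \<open>Q\<close>. That the result is a left inverse too is seen through the
    other factor \<open>A\<close>.\<close>
  proof (rule bij_betw_byWitness[of _ "\<lambda>x. Q (B x)"])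
    have TB: "T (B x) = Q x" for x using AB(2) by (metis o_apply)
    have AT: "A (T x) = Q x" for x using AB(1) by (metis o_apply)
    show "T ` ?M \<subseteq> ?M" using onM.T_in by blast
    show "(\<lambda>x. Q (B x)) ` ?M \<subseteq> ?M" by (auto simp: QQ)
    show "\<forall>x\<in>?M. T (Q (B x)) = x" by (simp add: TQ[symmetric] TB)
    show "\<forall>x\<in>?M. Q (B (T x)) = x"
    proof
      fix x assume x: "x \<in> ?M"
      have "Q (Q (B (T x))) = A (T (Q (B (T x))))" by (simp only: AT)
      also have "T (Q (B (T x))) = T x" using x TQ[of x] by (simp add: TQ[symmetric] TB QQ)
      finally show "Q (B (T x)) = x" using x by (simp add: QQ AT)
    qed
  qed
  moreover have "Riesz_on ?N T"
  proof -
    have "Riesz ?A \<longleftrightarrow> Riesz_on ?N ?A"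
      by (rule reduced_op.Riesz_UNIV_iff[OF redA]) (simp add: onM.T_0)
    also have "\<dots> \<longleftrightarrow> Riesz_on ?N T" by (rule Riesz_on_cong) simp
    finally show ?thesis using R by simp
  qed
  ultimately show ?thesis
    unfolding Riesz_decomposable_def using reduced_op_axioms by blast
qed

text \<open>Reduces (vi) to (vii): on the kernel of \<open>P\<close> the Browder operator
  \<open>T + P\<close> is \<open>T\<close>, and on the range of \<open>P\<close> the Riesz operator
  \<open>TP\<close> is \<open>T\<close>. The kernel of \<open>P\<close> is thus the Browder
  summand.\<close>

lemma Browder_perturbation_imp_decomposable:
  assumes T: "bounded_clinear T" and P: "bounded_clinear P" "P \<circ> P = P" "T \<circ> P = P \<circ> T"
    and B: "Browder (\<lambda>x. T x + P x)" and R: "Riesz (T \<circ> P)"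
  shows "Riesz_decomposable T"
proof -
  have TP: "P (T x) = T (P x)" for x using P(3) by (metis o_apply)
  have clP: "clinear P" by (rule bounded_clinear_clinear[OF P(1)])
  let ?M = "{x. P x = x}" and ?N = "{x. P x = 0}" and ?B = "\<lambda>x. T x + P x" and ?A = "\<lambda>x. T (P x)"
  interpret reduced_op ?M ?N T
    by (rule commuting_projection_reduced[OF T P(1,2) TP])
  have redB: "reduced_op ?M ?N ?B"
    by (rule commuting_projection_reduced[OF bounded_clinear_add[OF T P(1)] P(1,2)])
      (simp add: TP clinear_add[OF clP])
  have redA: "reduced_op ?N ?M ?A"
    by (rule reduced_op_commute, rule commuting_projection_reduced[OF bounded_clinear_compose[OF T P(1)] P(1,2)])
      (simp add: TP)
  have "Browder_on ?N ?B" by (rule reduced_op.Browder_on_component[OF redB B])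
  moreover have "Browder_on ?N ?B \<longleftrightarrow> Browder_on ?N T" by (rule Browder_on_cong[OF _ invN]) simp
  ultimately have BN: "Browder_on ?N T" by simp
  have "Riesz ?A \<longleftrightarrow> Riesz_on ?M ?A"
    by (rule reduced_op.Riesz_UNIV_iff[OF redA]) (simp add: onM.T_0)
  also have "\<dots> \<longleftrightarrow> Riesz_on ?M T" by (rule Riesz_on_cong) simp
  finally have "Riesz_on ?M T" using R by (simp add: o_def)
  with BN show ?thesis
    by (intro reduced_op.Browder_Riesz_imp_decomposable[OF reduced_op_commute[OF reduced_op_axioms]])
qed

section \<open>Spectral conditions near 0\<close>

lemma decomposable_not_islimpt:
  assumes "Riesz_decomposable T"
  shows "\<not> 0 islimpt Browder_spectrum T"
proof -
  obtain M N where MN: "reduced_op M N T" "bij_on M T" "Riesz_on N T"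
    using assms by (rule decomposableE)
  obtain \<delta> where \<delta>: "\<delta> > 0" "\<And>\<mu>. \<mu> \<noteq> 0 \<Longrightarrow> cmod \<mu> < \<delta> \<Longrightarrow> Browder (shift T \<mu>)"
    using reduced_op.Browder_near_0[OF MN] by blast
  then show ?thesis
    unfolding islimpt_approachable Browder_spectrum_def by (auto simp: dist_norm)
qed

lemma decomposable_notin_interior:
  assumes "Riesz_decomposable T"
  shows "0 \<notin> interior (cspectrum T)"
proof
  assume "0 \<in> interior (cspectrum T)"
  then obtain e where e: "e > 0" "ball 0 e \<subseteq> cspectrum T" unfolding mem_interior by blast
  obtain M N where MN: "reduced_op M N T" "bij_on M T" "Riesz_on N T"
    using assms by (rule decomposableE)
  interpret reduced_op M N T by (rule MN(1))
  obtain \<delta> where "\<delta> > 0" "\<And>\<nu> \<epsilon>. cmod \<nu> < \<delta> \<Longrightarrow> \<epsilon> > 0 \<Longrightarrow>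
     \<exists>\<mu>. cmod (\<mu> - \<nu>) < \<epsilon> \<and> bij_on UNIV (shift T \<mu>)"
    using near_0_dense_bij[OF MN(2,3)] by blast
  from this(2)[of 0 e] this(1) e(1) obtain \<mu> where \<mu>: "cmod \<mu> < e" "bij_on UNIV (shift T \<mu>)" by auto
  then have "invertible_on UNIV (shift T \<mu>)"
    using restricted_op.invertible_on_iff[OF onX.shift_restricted] by blast
  moreover have "\<mu> \<in> cspectrum T" using e(2) \<mu>(1) by (auto simp: dist_norm)
  ultimately show False by (simp add: cspectrum_def)
qed

lemma notin_interior_ball:
  fixes S :: "complex set"
  assumes "0 \<notin> interior S" "\<epsilon> > 0"
  obtains \<mu> where "cmod \<mu> < \<epsilon>" "\<mu> \<notin> S"
  using assms unfolding mem_interior by (auto simp: subset_iff)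

lemma spectrum_imp_near_bij:
  assumes T: "bounded_clinear T" and "0 \<notin> interior (cspectrum T)" "\<epsilon> > 0"
  shows "\<exists>\<mu>. cmod \<mu> < \<epsilon> \<and> bij_on UNIV (shift T \<mu>)"
proof -
  interpret restricted_op UNIV T
    using T by unfold_locales (simp_all add: csubspace_UNIV invariant_def)
  obtain \<mu> where "cmod \<mu> < \<epsilon>" "invertible_on UNIV (shift T \<mu>)"
    using notin_interior_ball[OF assms(2,3)] by (auto simp: cspectrum_def)
  then show ?thesis using restricted_op.invertible_on_iff[OF shift_restricted] by blast
qed

text \<open>A point outside the Browder spectrum may still lie in the spectrum, but then it is
  isolated there; a regular point is taken next to it, still within \<open>\<epsilon>\<close> of
  0.\<close>

lemma Browder_spectrum_imp_near_bij:
  assumes T: "bounded_clinear T" and "0 \<notin> interior (Browder_spectrum T)" "\<epsilon> > 0"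
  shows "\<exists>\<mu>. cmod \<mu> < \<epsilon> \<and> bij_on UNIV (shift T \<mu>)"
proof -
  interpret restricted_op UNIV T
    using T by unfold_locales (simp_all add: csubspace_UNIV invariant_def)
  obtain \<nu> where \<nu>: "cmod \<nu> < \<epsilon>" "Browder (shift T \<nu>)"
    using notin_interior_ball[OF assms(2,3)] by (auto simp: Browder_spectrum_def)
  obtain \<delta> where \<delta>: "\<delta> > 0" "\<And>\<mu>. \<mu> \<noteq> 0 \<Longrightarrow> cmod \<mu> < \<delta> \<Longrightarrow> bij_on UNIV (shift (shift T \<nu>) \<mu>)"
    using restricted_op.Browder_imp_punctured[OF shift_restricted \<nu>(2)] by blast
  define t where "t = min \<delta> (\<epsilon> - cmod \<nu>) / 2"
  have t: "t > 0" "t < \<delta>" "t < \<epsilon> - cmod \<nu>" using \<delta>(1) \<nu>(1) by (auto simp: t_def min_def)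
  then have "bij_on UNIV (shift T (\<nu> + of_real t))"
    using \<delta>(2)[of "of_real t"] by (simp add: shift_shift)
  moreover have "cmod (\<nu> + of_real t) < \<epsilon>"
    using t norm_triangle_ineq[of \<nu> "of_real t"] by simp
  ultimately show ?thesis by blast
qed

subsection \<open>Vector-valued power series\<close>

text \<open>Scalar functions become a special case of vector-valued ones, so the power series
  results also cover the values of functionals at a fixed vector.\<close>

instantiation complex :: cbanach
begin

definition scaleC_complex :: "complex \<Rightarrow> complex \<Rightarrow> complex" where
  "scaleC_complex a x = a * x"

instance
  by standard (simp_all add: scaleC_complex_def algebra_simps norm_mult scaleR_conv_of_real)

end

text \<open>Each omitted term carries at least \<open>N\<close> factors of
  \<open>cmod h / r\<close>; pulling these out leaves terms of the binomial expansion of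
  \<open>(cmod z + r) ^ k\<close>.\<close>

lemma binomial_tail_bound:
  fixes z h :: complex and r :: real
  assumes r: "r > 0" "cmod h \<le> r"
  shows "cmod ((z + h) ^ k - (\<Sum>m<N. of_nat (k choose m) * z ^ (k - m) * h ^ m))
    \<le> (cmod h / r) ^ N * (cmod z + r) ^ k"
proof -
  define t where "t m = of_nat (k choose m) * z ^ (k - m) * h ^ m" for m
  define s where "s m = real (k choose m) * r ^ m * cmod z ^ (k - m)" for m
  have "(z + h) ^ k = (\<Sum>m\<le>k. t m)"
    unfolding t_def using binomial_ring[of h z k] by (simp add: add.commute mult.assoc mult.commute mult.left_commute)
  \<comment> \<open>Padding with zero terms allows the sum to be split at \<open>N\<close> even when
    \<open>N\<close> exceeds \<open>k\<close>.\<close>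
  also have "\<dots> = (\<Sum>m<max N (Suc k). t m)"
    by (rule sum.mono_neutral_left) (auto simp: t_def)
  also have "\<dots> = (\<Sum>m<N. t m) + (\<Sum>m=N..<max N (Suc k). t m)"
    by (simp add: lessThan_atLeast0 sum.atLeastLessThan_concat)
  finally have "(z + h) ^ k - (\<Sum>m<N. t m) = (\<Sum>m=N..<max N (Suc k). t m)" by simp
  also have "cmod \<dots> \<le> (\<Sum>m=N..<max N (Suc k). (cmod h / r) ^ N * s m)"
  proof (rule sum_norm_le)
    fix m assume "m \<in> {N..<max N (Suc k)}"
    then have "N \<le> m" by simp
    have "cmod h ^ m = (cmod h / r) ^ m * r ^ m" using r by (simp flip: power_mult_distrib)
    also have "\<dots> \<le> (cmod h / r) ^ N * r ^ m"
      using r \<open>N \<le> m\<close> by (intro mult_right_mono power_decreasing) auto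
    finally have "real (k choose m) * cmod z ^ (k - m) * cmod h ^ m
        \<le> real (k choose m) * cmod z ^ (k - m) * ((cmod h / r) ^ N * r ^ m)"
      by (intro mult_left_mono) auto
    then show "cmod (t m) \<le> (cmod h / r) ^ N * s m"
      by (simp add: t_def s_def norm_mult norm_power mult.assoc mult.commute mult.left_commute)
  qed
  also have "\<dots> = (cmod h / r) ^ N * (\<Sum>m=N..<max N (Suc k). s m)" by (rule sum_distrib_left[symmetric])
  also have "\<dots> \<le> (cmod h / r) ^ N * (\<Sum>m\<le>k. s m)"
    using r by (intro mult_left_mono sum_mono2) (auto simp: s_def)
  also have "(\<Sum>m\<le>k. s m) = (cmod z + r) ^ k"
    unfolding s_def using binomial_ring[of r "cmod z" k] by (simp add: add.commute)
  finally show ?thesis by (simp add: t_def)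
qed

text \<open>The \<open>m\<close>-th coefficient of the series with coefficients \<open>u\<close>
  after re-expansion about \<open>z\<close>. For \<open>k < m\<close> the binomial coefficient
  vanishes, so the truncated difference \<open>k - m\<close> is harmless.\<close>

definition recentred :: "complex \<Rightarrow> (nat \<Rightarrow> 'a::cbanach) \<Rightarrow> nat \<Rightarrow> 'a" where
  "recentred z u m = (\<Sum>k. (of_nat (k choose m) * z ^ (k - m)) *\<^sub>C u k)"

context
  fixes u :: "nat \<Rightarrow> 'a::cbanach" and C K r :: real and z :: complex
  assumes C: "C > 0" and u: "\<And>n. norm (u n) \<le> K * C ^ n" and r: "r > 0" "(cmod z + r) * C < 1"
begin

private abbreviation "L \<equiv> K / (1 - (cmod z + r) * C)"
private abbreviation "tm m k \<equiv> (of_nat (k choose m) * z ^ (k - m)) *\<^sub>C u k"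

private lemma geometric_K: "(\<lambda>k. K * ((cmod z + r) * C) ^ k) sums L"
proof -
  have "norm ((cmod z + r) * C) < 1" using C r by simp
  from sums_mult[OF geometric_sums[OF this], of K] show ?thesis by simp
qed

private lemma term_bound:
  assumes "cmod a \<le> b * (cmod z + r) ^ k" "b \<ge> 0"
  shows "norm (a *\<^sub>C u k) \<le> b * (K * ((cmod z + r) * C) ^ k)"
proof -
  have "norm (a *\<^sub>C u k) \<le> (b * (cmod z + r) ^ k) * (K * C ^ k)"
    unfolding norm_scaleC using assms r by (intro mult_mono u) auto
  then show ?thesis by (simp add: power_mult_distrib mult.assoc mult.left_commute)
qed

text \<open>A Cauchy estimate for radius \<open>r\<close>: a single binomial term is at most the
  whole expansion of \<open>(r + cmod z) ^ k\<close>.\<close>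

lemma summable_norm_recentred:
  "summable (\<lambda>k. norm (tm m k))"
  and norm_recentred: "norm (recentred z u m) * r ^ m \<le> L"
proof -
  have le: "norm (tm m k) \<le> (1 / r ^ m) * (K * ((cmod z + r) * C) ^ k)" for k
  proof (rule term_bound)
    have "real (k choose m) * r ^ m * cmod z ^ (k - m) \<le> (r + cmod z) ^ k"
    proof (cases "m \<le> k")
      case True
      then show ?thesis unfolding binomial_ring[of r "cmod z"] using r
        by (intro member_le_sum[of m "{..k}" "\<lambda>m. real (k choose m) * r ^ m * cmod z ^ (k - m)"]) auto
    qed (use r in \<open>simp add: binomial_eq_0\<close>)
    moreover have "r ^ m > 0" using r by simp
    ultimately have "real (k choose m) * cmod z ^ (k - m) \<le> (r + cmod z) ^ k / r ^ m"
      by (simp add: pos_le_divide_eq mult.commute mult.left_commute)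
    then show "cmod (of_nat (k choose m) * z ^ (k - m)) \<le> 1 / r ^ m * (cmod z + r) ^ k"
      by (simp add: norm_mult norm_power add.commute)
  qed (use r in simp)
  have g: "(\<lambda>k. (1 / r ^ m) * (K * ((cmod z + r) * C) ^ k)) sums ((1 / r ^ m) * L)"
    by (rule sums_mult[OF geometric_K])
  show s: "summable (\<lambda>k. norm (tm m k))"
    using le by (intro summable_comparison_test[OF _ sums_summable[OF g]]) auto
  have "norm (recentred z u m) \<le> (\<Sum>k. norm (tm m k))"
    unfolding recentred_def by (rule summable_norm[OF s])
  also have "\<dots> \<le> (1 / r ^ m) * L"
    using suminf_le[OF le s sums_summable[OF g]] sums_unique[OF g] by simp
  finally have "norm (recentred z u m) * r ^ m \<le> (1 / r ^ m) * L * r ^ m"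
    using r(1) by (intro mult_right_mono) auto
  also have "\<dots> = L" using r(1) by simp
  finally show "norm (recentred z u m) * r ^ m \<le> L" .
qed

text \<open>The bound is linear in \<open>K\<close>. For coefficients obtained by evaluating
  functionals at \<open>x\<close>, \<open>K\<close> is proportional to \<open>norm x\<close>, so the
  pointwise estimate becomes one in the dual norm.\<close>

lemma recentred_remainder:
  assumes h: "cmod h \<le> r"
  shows "norm ((\<Sum>k. (z + h) ^ k *\<^sub>C u k) - (\<Sum>m<N. h ^ m *\<^sub>C recentred z u m))
    \<le> (cmod h / r) ^ N * L"
proof -
  let ?E = "(\<Sum>k. (z + h) ^ k *\<^sub>C u k) - (\<Sum>m<N. h ^ m *\<^sub>C recentred z u m)"
  let ?d = "\<lambda>k. (z + h) ^ k - (\<Sum>m<N. of_nat (k choose m) * z ^ (k - m) * h ^ m)"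
  have le: "norm (?d k *\<^sub>C u k) \<le> (cmod h / r) ^ N * (K * ((cmod z + r) * C) ^ k)" for k
    using r by (intro term_bound binomial_tail_bound h) auto
  have g: "(\<lambda>k. (cmod h / r) ^ N * (K * ((cmod z + r) * C) ^ k)) sums
      ((cmod h / r) ^ N * L)"
    by (rule sums_mult[OF geometric_K])
  have s: "summable (\<lambda>k. norm (?d k *\<^sub>C u k))"
    using le by (intro summable_comparison_test[OF _ sums_summable[OF g]]) auto
  have cm: "(\<lambda>k. h ^ m *\<^sub>C (tm m k)) sums (h ^ m *\<^sub>C recentred z u m)" for m
    unfolding recentred_def
    by (intro bounded_linear.sums[OF bounded_clinear_linear[OF bounded_clinear_scaleC]]
        summable_sums summable_norm_cancel[OF summable_norm_recentred])
  have cs: "(\<lambda>k. \<Sum>m<N. h ^ m *\<^sub>C (tm m k)) sums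
      (\<Sum>m<N. h ^ m *\<^sub>C recentred z u m)"
    by (rule sums_sum) (rule cm)
  have "cmod (z + h) * C \<le> (cmod z + r) * C"
    using h C norm_triangle_ineq[of z h] by (intro mult_right_mono) auto
  then have "cmod (z + h) * C < 1" using r(2) by (rule le_less_trans)
  then have "(\<lambda>k. (z + h) ^ k *\<^sub>C u k) sums (\<Sum>k. (z + h) ^ k *\<^sub>C u k)"
    by (intro summable_sums summable_norm_cancel[OF summable_scaleC_power[OF C u]])
  from sums_diff[OF this cs]
  have "(\<lambda>k. ?d k *\<^sub>C u k) sums (?E)"
    by (simp add: cvs.scale_left_diff_distrib cvs.scale_sum_left scaleC_scaleC mult.commute)
  then have "?E = (\<Sum>k. ?d k *\<^sub>C u k)"
    by (rule sums_unique)
  also have "norm \<dots> \<le> (\<Sum>k. norm (?d k *\<^sub>C u k))" by (rule summable_norm[OF s])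
  also have "\<dots> \<le> (cmod h / r) ^ N * L"
    using suminf_le[OF le s sums_summable[OF g]] sums_unique[OF g] by simp
  finally show ?thesis .
qed

end

lemma analytic_on_X_power_series:
  fixes u :: "nat \<Rightarrow> 'a::cbanach"
  assumes C: "C > 0" and u: "\<And>n. norm (u n) \<le> K * C ^ n" and "R * C \<le> 1"
  shows "analytic_on_X (ball 0 R) (\<lambda>w. \<Sum>n. w ^ n *\<^sub>C u n)"
  unfolding analytic_on_X_def
proof
  fix z :: complex assume "z \<in> ball 0 R"
  then have zR: "cmod z < R" by simp
  define r where "r = (R - cmod z) / 2"
  have r: "r > 0" "cmod z + r < R" using zR by (auto simp: r_def field_simps)
  then have rC: "(cmod z + r) * C < 1"
    using C assms(3) by (meson less_le_trans mult_strict_right_mono)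
  have "ball z r \<subseteq> ball 0 R"
  proof
    fix w assume "w \<in> ball z r"
    then have "cmod (w - z) < r" by (simp add: dist_norm norm_minus_commute)
    then show "w \<in> ball 0 R" using r norm_triangle_ineq[of z "w - z"] by simp
  qed
  moreover have "(\<lambda>n. (w - z) ^ n *\<^sub>C recentred z u n) sums (\<Sum>n. w ^ n *\<^sub>C u n)"
    if w: "w \<in> ball z r" for w
  proof -
    define h where "h = w - z"
    let ?d = "\<lambda>N. (\<Sum>k. (z + h) ^ k *\<^sub>C u k) - (\<Sum>m<N. h ^ m *\<^sub>C recentred z u m)"
      and ?b = "\<lambda>N. (cmod h / r) ^ N * (K / (1 - (cmod z + r) * C))"
    have h: "cmod h < r" using w by (simp add: h_def dist_norm norm_minus_commute)
    have "?b \<longlonglongrightarrow> 0 * (K / (1 - (cmod z + r) * C))"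
      using h r(1) by (intro tendsto_mult tendsto_const LIMSEQ_realpow_zero) auto
    then have lim: "?b \<longlonglongrightarrow> 0" by simp
    have "(\<lambda>N. ?d N) \<longlonglongrightarrow> 0"
    proof (rule Lim_null_comparison[OF always_eventually lim], rule allI)
      fix N
      show "norm (?d N)
          \<le> ?b N"
        using h by (intro recentred_remainder[OF C u r(1) rC]) simp
    qed
    from tendsto_diff[OF tendsto_const[of "\<Sum>k. (z + h) ^ k *\<^sub>C u k"] this]
    have "(\<lambda>N. \<Sum>m<N. h ^ m *\<^sub>C recentred z u m) \<longlonglongrightarrow> (\<Sum>k. (z + h) ^ k *\<^sub>C u k)" by simp
    then show ?thesis by (simp add: sums_def h_def)
  qed
  ultimately show "\<exists>r>0. ball z r \<subseteq> ball 0 R \<and>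
      (\<exists>c. \<forall>w\<in>ball z r. (\<lambda>n. (w - z) ^ n *\<^sub>C c n) sums (\<Sum>n. w ^ n *\<^sub>C u n))"
    using r(1) by blast
qed

text \<open>Once the lower coefficients vanish, dividing by the \<open>n\<close>-th power leaves a
  series with constant term \<open>c n\<close>. Zeros arbitrarily close to \<open>z\<close> make
  this term arbitrarily small.\<close>

lemma power_series_zeros_imp_coeffs_0:
  fixes c :: "nat \<Rightarrow> 'a::cbanach"
  assumes r: "r > 0" and f: "\<And>w. w \<in> ball z r \<Longrightarrow> (\<lambda>n. ((w - z) ^ n) *\<^sub>C c n) sums f w"
    and zeros: "\<And>\<epsilon>. \<epsilon> > 0 \<Longrightarrow> \<exists>w. w \<noteq> z \<and> cmod (w - z) < \<epsilon> \<and> f w = 0"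
  shows "c n = 0"
proof (induction n rule: less_induct)
  case (less n)
  define s where "s = r / 2"
  have s: "s > 0" "s < r" using r by (auto simp: s_def)
  have "summable (\<lambda>k. (of_real s ^ k) *\<^sub>C c k)"
    using f[of "z + of_real s"] s by (auto simp: dist_norm sums_iff)
  then have "(\<lambda>k. (of_real s ^ k) *\<^sub>C c k) \<longlonglongrightarrow> 0" by (rule summable_LIMSEQ_zero)
  then have "Bseq (\<lambda>k. (of_real s ^ k) *\<^sub>C c k)" by (intro convergent_imp_Bseq convergentI)
  then obtain L where L: "L > 0" "\<And>k. norm ((of_real s ^ k) *\<^sub>C c k) \<le> L" unfolding Bseq_def by blast
  have ck: "norm (c (j + n)) \<le> (L / s ^ n) * (1 / s) ^ j" for j
  proof -
    have "norm ((of_real s ^ (j + n)) *\<^sub>C c (j + n)) = s ^ j * s ^ n * norm (c (j + n))"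
      using s(1) by (simp add: norm_scaleC norm_power norm_mult power_add)
    then have "s ^ j * s ^ n * norm (c (j + n)) \<le> L" using L(2)[of "j + n"] by simp
    moreover have "s ^ j * s ^ n > 0" using s(1) by simp
    ultimately have "norm (c (j + n)) \<le> L / (s ^ j * s ^ n)"
      by (simp add: pos_le_divide_eq mult.commute)
    then show ?thesis by (simp add: power_divide mult.commute)
  qed
  define B where "B = L / s ^ n"
  have B: "B > 0" using L s by (simp add: B_def)
  have "norm (c n) \<le> e" if e: "e > 0" for e
  proof -
    \<comment> \<open>The first bound keeps the ratio \<open>cmod h / s\<close> below one half, so
      the denominator in the tail estimate is at least one half; the second makes
      \<open>2 * B\<close> times the ratio smaller than \<open>e\<close>.\<close>
    define t where "t = min (s / 2) (e * s / (2 * B))"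
    have t: "t > 0" using s e B by (simp add: t_def)
    obtain w where w: "w \<noteq> z" "cmod (w - z) < t" "f w = 0" using zeros[OF t] by blast
    define h where "h = w - z"
    have h: "h \<noteq> 0" "cmod h < s / 2" "cmod h < e * s / (2 * B)" using w by (auto simp: h_def t_def)
    have wb: "w \<in> ball z r" using h(2) s by (simp add: h_def dist_norm norm_minus_commute)
    have q: "cmod h * (1 / s) < 1" using h s by (simp add: field_simps)
    have "(\<lambda>j. h ^ (j + n) *\<^sub>C c (j + n)) sums (f w - (\<Sum>k<n. h ^ k *\<^sub>C c k))"
      using f[OF wb] unfolding h_def by (rule sums_split_initial_segment)
    then have "(\<lambda>j. h ^ n *\<^sub>C (h ^ j *\<^sub>C c (j + n))) sums 0"
      using less w(3) by (simp add: scaleC_scaleC power_add mult.commute)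
    from bounded_linear.sums[OF bounded_clinear_linear[OF bounded_clinear_scaleC], OF this, of "inverse (h ^ n)"]
    have "(\<lambda>j. h ^ j *\<^sub>C c (j + n)) sums 0" using h(1) by (simp add: scaleC_scaleC flip: mult.assoc)
    then have "(\<Sum>j. h ^ j *\<^sub>C c (j + n)) = 0" by (rule sums_unique[symmetric])
    then have "norm (c n) \<le> B * (cmod h * (1 / s)) / (1 - cmod h * (1 / s))"
      using power_series_near_0[of "1 / s" "\<lambda>j. c (j + n)" B h] s(1) ck q unfolding B_def by simp
    also have "\<dots> \<le> B * (cmod h * (1 / s)) / (1 / 2)"
      using B h s by (intro divide_left_mono mult_nonneg_nonneg) (auto simp: field_simps)
    also have "\<dots> \<le> e" using h(3) B s by (simp add: field_simps)
    finally show ?thesis .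
  qed
  then have "norm (c n) \<le> 0" by (rule_tac field_le_epsilon) simp
  then show ?case by simp
qed

text \<open>The identity theorem. The interior of the zero set is closed in the disc because its
  limit points are again accumulated by zeros; it contains the centre, and the disc is
  connected.\<close>

lemma analytic_on_X_zeros_imp_0:
  assumes f: "analytic_on_X (ball a r) f" and r: "r > 0"
    and zeros: "\<And>\<epsilon>. \<epsilon> > 0 \<Longrightarrow> \<exists>w. w \<noteq> a \<and> cmod (w - a) < \<epsilon> \<and> f w = 0"
    and w: "w \<in> ball a r"
  shows "f w = 0"
proof -
  define Z where "Z = {z \<in> ball a r. \<exists>e>0. \<forall>w\<in>ball z e. w \<in> ball a r \<and> f w = 0}"
  have local: "z \<in> Z" if z: "z \<in> ball a r"
    and zz: "\<And>\<epsilon>. \<epsilon> > 0 \<Longrightarrow> \<exists>w. w \<noteq> z \<and> cmod (w - z) < \<epsilon> \<and> f w = 0" for z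
  proof -
    obtain e c where e: "e > 0" "ball z e \<subseteq> ball a r"
      "\<And>w. w \<in> ball z e \<Longrightarrow> (\<lambda>n. ((w - z) ^ n) *\<^sub>C c n) sums f w"
      using f z unfolding analytic_on_X_def by blast
    have "c n = 0" for n by (rule power_series_zeros_imp_coeffs_0[OF e(1,3) zz])
    then have "f w = 0" if "w \<in> ball z e" for w
      using e(3)[OF that] by (simp add: sums_iff)
    then show ?thesis using z e unfolding Z_def by blast
  qed
  have "open Z"
    unfolding open_contains_ball
  proof
    fix z assume "z \<in> Z"
    then obtain e where e: "e > 0" "\<And>w. w \<in> ball z e \<Longrightarrow> w \<in> ball a r \<and> f w = 0" unfolding Z_def by blast
    have "z' \<in> Z" if z': "z' \<in> ball z e" for z'
    proof -
      obtain e' where "e' > 0" "ball z' e' \<subseteq> ball z e" using openE[OF open_ball z'] by blast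
      then show ?thesis using e(2) z' unfolding Z_def by blast
    qed
    then show "\<exists>e>0. ball z e \<subseteq> Z" using e(1) by blast
  qed
  moreover have Zsub: "Z \<subseteq> ball a r" unfolding Z_def by blast
  moreover have "closedin (top_of_set (ball a r)) Z"
  proof -
    have "z \<in> Z" if z: "z \<in> ball a r" "z \<in> closure Z" for z
    proof (rule local[OF z(1)])
      fix \<epsilon> :: real assume \<epsilon>: "\<epsilon> > 0"
      then obtain z' where z': "z' \<in> Z" "dist z' z < \<epsilon> / 2"
        using z(2) unfolding closure_approachable by (meson half_gt_zero)
      then obtain e where e: "e > 0" "\<And>w. w \<in> ball z' e \<Longrightarrow> f w = 0" unfolding Z_def by blast
      define t where "t = min e \<epsilon> / 4"
      have t: "t > 0" "2 * t < e" "2 * t \<le> \<epsilon> / 2" using e(1) \<epsilon> by (auto simp: t_def)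
      \<comment> \<open>Two candidates are offered since one of them may coincide with
        \<open>z\<close>.\<close>
      obtain w where w: "w \<noteq> z" "w = z' + of_real t \<or> w = z' + of_real (2 * t)"
      proof (cases "z = z' + of_real t")
        case True
        then have "z' + of_real (2 * t) \<noteq> z" using t(1) by auto
        then show ?thesis using that by blast
      next
        case False
        then have "z' + of_real t \<noteq> z" by metis
        then show ?thesis using that by blast
      qed
      have d: "cmod (w - z') \<le> 2 * t" using w(2) t(1) by (auto simp: norm_mult)
      then have "f w = 0" using t by (intro e(2)) (simp add: dist_norm norm_minus_commute)
      moreover have "cmod (w - z) < \<epsilon>"
        using norm_triangle_ineq[of "w - z'" "z' - z"] d t z'(2) by (simp add: dist_norm)
      ultimately show "\<exists>w. w \<noteq> z \<and> cmod (w - z) < \<epsilon> \<and> f w = 0" using w(1) by blast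
    qed
    then have "Z = ball a r \<inter> closure Z" using Zsub closure_subset[of Z] by blast
    then show ?thesis by (metis closed_closure closedin_closed_Int)
  qed
  moreover have "a \<in> Z" using r by (intro local zeros) auto
  ultimately have "openin (top_of_set (ball a r)) Z" "closedin (top_of_set (ball a r)) Z" "Z \<noteq> {}"
    by (auto intro: open_subset)
  then have "Z = ball a r" using connected_ball[of a r] unfolding connected_clopen by blast
  then have "w \<in> Z" using w by simp
  then obtain e where "e > 0" "\<And>v. v \<in> ball w e \<Longrightarrow> f v = 0" unfolding Z_def by blast
  then show ?thesis by simp
qed

subsection \<open>The Hahn--Banach theorem\<close>

text \<open>Functionals are represented by their graphs, which are subspaces of \<open>X \<times> \<real>\<close>; the norm bound alone
  makes such a subspace single-valued.\<close>

definition bounded_graph :: "real \<Rightarrow> ('a::real_normed_vector \<times> real) set \<Rightarrow> bool" where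
  "bounded_graph K G \<longleftrightarrow> subspace G \<and> (\<forall>(x, t)\<in>G. t \<le> K * norm x)"

lemma bounded_graph_bound: "bounded_graph K G \<Longrightarrow> (x, t) \<in> G \<Longrightarrow> \<bar>t\<bar> \<le> K * norm x"
proof -
  assume G: "bounded_graph K G" "(x, t) \<in> G"
  then have "- (x, t) \<in> G" unfolding bounded_graph_def by (blast intro: subspace_neg)
  then have "- t \<le> K * norm (- x)" "t \<le> K * norm x" using G unfolding bounded_graph_def by auto
  then show ?thesis by simp
qed

lemma bounded_graph_unique:
  assumes "bounded_graph K G" "(x, t) \<in> G" "(x, t') \<in> G"
  shows "t = t'"
proof -
  have "(x, t) - (x, t') \<in> G" using assms unfolding bounded_graph_def by (blast intro: subspace_diff)
  then have "(0, t - t') \<in> G" by simp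
  from bounded_graph_bound[OF assms(1) this] show ?thesis by simp
qed

lemma bounded_graph_Union_chain:
  assumes "\<C> \<noteq> {}" "subset.chain {G. bounded_graph K G} \<C>"
  shows "bounded_graph K (\<Union>\<C>)"
proof -
  have sub: "bounded_graph K G" if "G \<in> \<C>" for G
    using assms(2) that unfolding subset_chain_def by blast
  have "subspace (\<Union>\<C>)"
    unfolding subspace_def
  proof (intro conjI ballI allI)
    obtain G where "G \<in> \<C>" using assms(1) by blast
    then show "0 \<in> \<Union>\<C>" using sub[of G] subspace_0[of G] by (auto simp: bounded_graph_def)
  next
    fix p q assume "p \<in> \<Union>\<C>" "q \<in> \<Union>\<C>"
    then obtain G H where "G \<in> \<C>" "p \<in> G" "H \<in> \<C>" "q \<in> H" by blast
    moreover from this have "G \<subseteq> H \<or> H \<subseteq> G" using assms(2) unfolding subset_chain_def by blast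
    ultimately obtain F where F: "F \<in> \<C>" "p \<in> F" "q \<in> F" by blast
    then have "p + q \<in> F" using sub[OF F(1)] unfolding bounded_graph_def by (blast intro: subspace_add)
    then show "p + q \<in> \<Union>\<C>" using F(1) by blast
  next
    fix c p assume "p \<in> \<Union>\<C>"
    then obtain G where G: "G \<in> \<C>" "p \<in> G" by blast
    then have "c *\<^sub>R p \<in> G" using sub[OF G(1)] unfolding bounded_graph_def by (blast intro: subspace_scale)
    then show "c *\<^sub>R p \<in> \<Union>\<C>" using G(1) by blast
  qed
  then show ?thesis using sub unfolding bounded_graph_def by blast
qed

text \<open>The value \<open>c\<close> at \<open>x0\<close> has to lie between the lower bounds
  collected in \<open>S\<close> and the upper bounds in \<open>c_upper\<close>; \<open>cross\<close>
  says that these are compatible. If \<open>x0\<close> already has a value, the two bounds force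
  \<open>c\<close> to equal it, so no case distinction arises.\<close>

lemma bounded_graph_extend:
  assumes G: "bounded_graph K G" and K: "K \<ge> 0"
  obtains H c where "bounded_graph K H" "G \<subseteq> H" "(x0, c) \<in> H"
proof -
  have sG: "subspace G" and le: "\<And>x t. (x, t) \<in> G \<Longrightarrow> t \<le> K * norm x"
    using G by (auto simp: bounded_graph_def)
  have 0: "(0, 0) \<in> G" using subspace_0[OF sG] by (simp add: zero_prod_def)
  have cross: "t' - K * norm (x' - x0) \<le> K * norm (x + x0) - t" if "(x, t) \<in> G" "(x', t') \<in> G" for x t x' t'
  proof -
    have "(x, t) + (x', t') \<in> G" using that by (intro subspace_add sG)
    then have "t + t' \<le> K * norm (x + x')" using le by simp
    also have "\<dots> \<le> K * (norm (x + x0) + norm (x' - x0))"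
      using norm_triangle_ineq[of "x + x0" "x' - x0"] K by (intro mult_left_mono) auto
    finally show ?thesis by (simp add: algebra_simps)
  qed
  define S where "S = (\<lambda>(x', t'). t' - K * norm (x' - x0)) ` G"
  define c where "c = Sup S"
  have ne: "S \<noteq> {}" using 0 by (auto simp: S_def)
  have ub: "s \<le> K * norm (x + x0) - t" if "s \<in> S" "(x, t) \<in> G" for s x t
    using that cross by (auto simp: S_def)
  have bdd: "bdd_above S" using ub[OF _ 0] by (intro bdd_aboveI) auto
  have c_upper: "c \<le> K * norm (x + x0) - t" if "(x, t) \<in> G" for x t
    unfolding c_def using ub that by (intro cSup_least ne) auto
  have c_lower: "t - K * norm (x - x0) \<le> c" if "(x, t) \<in> G" for x t
    unfolding c_def using that by (intro cSup_upper bdd) (force simp: S_def)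
  define H where "H = {p + q | p q. p \<in> G \<and> q \<in> range (\<lambda>a. a *\<^sub>R (x0, c))}"
  have "subspace (range (\<lambda>a. a *\<^sub>R (x0, c)))"
    by (rule linear_subspace_image[OF _ subspace_UNIV], rule linearI) (simp_all add: algebra_simps)
  from subspace_sums[OF sG this] have sH: "subspace H" unfolding H_def .
  have bound: "t + a * c \<le> K * norm (x + a *\<^sub>R x0)" if xt: "(x, t) \<in> G" for x t a
  proof -
    have scaled: "(b *\<^sub>R x, b * t) \<in> G" for b using subspace_scale[OF sG xt, of b] by simp
    consider "a = 0" | "a > 0" | "a < 0" by linarith
    then show ?thesis
    proof cases
      case 1
      then show ?thesis using le[OF xt] by simp
    next
      case 2
      have "a * (c + inverse a * t) \<le> a * (K * norm (inverse a *\<^sub>R x + x0))"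
        using c_upper[OF scaled[of "inverse a"]] 2 by (intro mult_left_mono) auto
      also have "\<dots> = K * norm (a *\<^sub>R (inverse a *\<^sub>R x + x0))" using 2 by simp
      also have "a *\<^sub>R (inverse a *\<^sub>R x + x0) = x + a *\<^sub>R x0" using 2 by (simp add: scaleR_add_right)
      finally have "a * (c + inverse a * t) \<le> K * norm (x + a *\<^sub>R x0)" .
      moreover have "a * (c + inverse a * t) = t + a * c" using 2 by (simp add: distrib_left)
      ultimately show ?thesis by simp
    next
      case 3
      define b where "b = - a"
      have b: "b > 0" using 3 by (simp add: b_def)
      have "b * (inverse b * t - c) \<le> b * (K * norm (inverse b *\<^sub>R x - x0))"
        using c_lower[OF scaled[of "inverse b"]] b by (intro mult_left_mono) auto
      also have "\<dots> = K * norm (b *\<^sub>R (inverse b *\<^sub>R x - x0))" using b by simp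
      also have "b *\<^sub>R (inverse b *\<^sub>R x - x0) = x + a *\<^sub>R x0" using b by (simp add: scaleR_diff_right b_def)
      finally have "b * (inverse b * t - c) \<le> K * norm (x + a *\<^sub>R x0)" .
      moreover have "b * (inverse b * t - c) = t + a * c" using b by (simp add: right_diff_distrib) (simp add: b_def)
      ultimately show ?thesis by simp
    qed
  qed
  show thesis
  proof
    show "bounded_graph K H"
      unfolding bounded_graph_def using sH bound by (auto simp: H_def)
    show "G \<subseteq> H"
    proof
      fix p assume "p \<in> G"
      then have "p + 0 *\<^sub>R (x0, c) \<in> H" unfolding H_def by blast
      then show "p \<in> H" by (simp flip: zero_prod_def)
    qed
    have "(0, 0) + 1 *\<^sub>R (x0, c) \<in> H" unfolding H_def using 0 by blast
    then show "(x0, c) \<in> H" by simp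
  qed
qed

lemma Hahn_Banach_real:
  fixes Y :: "'a::real_normed_vector set" and f :: "'a \<Rightarrow> real"
  assumes Y: "subspace Y" and K: "K \<ge> 0"
    and f: "\<And>x y. x \<in> Y \<Longrightarrow> y \<in> Y \<Longrightarrow> f (x + y) = f x + f y" "\<And>c x. x \<in> Y \<Longrightarrow> f (c *\<^sub>R x) = c * f x"
      "\<And>x. x \<in> Y \<Longrightarrow> \<bar>f x\<bar> \<le> K * norm x"
  obtains g where "linear g" "\<And>x. x \<in> Y \<Longrightarrow> g x = f x" "\<And>x. \<bar>g x\<bar> \<le> K * norm x"
proof -
  define G0 where "G0 = (\<lambda>x. (x, f x)) ` Y"
  have "subspace G0"
    unfolding subspace_def G0_def
  proof (intro conjI ballI allI)
    have "f 0 = 0" using f(2)[OF subspace_0[OF Y], of 0] by simp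
    then show "0 \<in> (\<lambda>x. (x, f x)) ` Y"
      using subspace_0[OF Y] by (intro image_eqI[of _ _ 0]) (simp_all add: zero_prod_def)
  next
    fix p q assume "p \<in> (\<lambda>x. (x, f x)) ` Y" "q \<in> (\<lambda>x. (x, f x)) ` Y"
    then obtain x y where "x \<in> Y" "y \<in> Y" "p = (x, f x)" "q = (y, f y)" by blast
    then show "p + q \<in> (\<lambda>x. (x, f x)) ` Y"
      using subspace_add[OF Y] f(1) by (intro image_eqI[of _ _ "x + y"]) auto
  next
    fix c p assume "p \<in> (\<lambda>x. (x, f x)) ` Y"
    then obtain x where "x \<in> Y" "p = (x, f x)" by blast
    then show "c *\<^sub>R p \<in> (\<lambda>x. (x, f x)) ` Y"
      using subspace_scale[OF Y] f(2) by (intro image_eqI[of _ _ "c *\<^sub>R x"]) auto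
  qed
  then have G0: "bounded_graph K G0"
    using f(3) by (force simp: bounded_graph_def G0_def abs_le_iff)
  let ?A = "{G. bounded_graph K G \<and> G0 \<subseteq> G}"
  have "\<exists>M\<in>?A. \<forall>X\<in>?A. M \<subseteq> X \<longrightarrow> X = M"
  proof (rule subset_Zorn_nonempty)
    show "?A \<noteq> {}" using G0 by blast
    fix \<C> assume C: "\<C> \<noteq> {}" "subset.chain ?A \<C>"
    then have "subset.chain {G. bounded_graph K G} \<C>" unfolding subset_chain_def by blast
    then have "bounded_graph K (\<Union>\<C>)" by (rule bounded_graph_Union_chain[OF C(1)])
    moreover have "G0 \<subseteq> \<Union>\<C>" using C unfolding subset_chain_def by blast
    ultimately show "\<Union>\<C> \<in> ?A" by simp
  qed
  then obtain G where GA: "G \<in> ?A" and GX: "\<forall>X\<in>?A. G \<subseteq> X \<longrightarrow> X = G" by (rule bexE)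
  from GA have G: "bounded_graph K G" "G0 \<subseteq> G" by simp_all
  have max: "H = G" if "bounded_graph K H" "G \<subseteq> H" for H
    using bspec[OF GX, of H] that G(2) by simp
  have "\<exists>t. (x, t) \<in> G" for x
  proof -
    obtain H c where H: "bounded_graph K H" "G \<subseteq> H" "(x, c) \<in> H"
      using bounded_graph_extend[OF G(1) K] by blast
    with max[OF H(1,2)] show ?thesis by blast
  qed
  then obtain g where g: "\<And>x. (x, g x) \<in> G" by metis
  have sG: "subspace G" using G(1) by (simp add: bounded_graph_def)
  show thesis
  proof
    show "linear g"
    proof (rule linearI)
      fix x y
      have "(x + y, g x + g y) \<in> G" using subspace_add[OF sG g[of x] g[of y]] by simp
      then show "g (x + y) = g x + g y" by (rule bounded_graph_unique[OF G(1) g])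
    next
      fix c x
      have "(c *\<^sub>R x, c *\<^sub>R g x) \<in> G" using subspace_scale[OF sG g[of x], of c] by simp
      then show "g (c *\<^sub>R x) = c *\<^sub>R g x" by (rule bounded_graph_unique[OF G(1) g])
    qed
    show "g x = f x" if "x \<in> Y" for x
      using that G(2) by (intro bounded_graph_unique[OF G(1) g]) (auto simp: G0_def)
    show "\<bar>g x\<bar> \<le> K * norm x" for x by (rule bounded_graph_bound[OF G(1) g])
  qed
qed

section \<open>Complex functionals\<close>

definition functional_bound :: "real \<Rightarrow> ('a::cbanach \<Rightarrow> complex) \<Rightarrow> bool" where
  "functional_bound K \<phi> \<longleftrightarrow> (\<forall>x y. \<phi> (x + y) = \<phi> x + \<phi> y) \<and> (\<forall>c x. \<phi> (c *\<^sub>C x) = c * \<phi> x) \<and>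
     (\<forall>x. cmod (\<phi> x) \<le> K * norm x)"

lemma bounded_cfunctional_iff: "bounded_cfunctional \<phi> \<longleftrightarrow> (\<exists>K. functional_bound K \<phi>)"
  unfolding bounded_cfunctional_def functional_bound_def by (auto simp: mult.commute)

text \<open>A complex functional is determined by its real part \<open>g\<close> as \<open>x \<mapsto> g x - \<i> g (\<i> x)\<close>.\<close>

lemma Hahn_Banach:
  fixes Y :: "'a::cbanach set" and \<phi> :: "'a \<Rightarrow> complex"
  assumes Y: "csubspace Y" and K: "K \<ge> 0"
    and \<phi>: "\<And>x y. x \<in> Y \<Longrightarrow> y \<in> Y \<Longrightarrow> \<phi> (x + y) = \<phi> x + \<phi> y" "\<And>c x. x \<in> Y \<Longrightarrow> \<phi> (c *\<^sub>C x) = c * \<phi> x"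
      "\<And>x. x \<in> Y \<Longrightarrow> cmod (\<phi> x) \<le> K * norm x"
  obtains \<psi> where "functional_bound K \<psi>" "\<And>x. x \<in> Y \<Longrightarrow> \<psi> x = \<phi> x"
proof -
  have sR: "r *\<^sub>R x = of_real r *\<^sub>C x" for r and x :: 'a by (rule scaleC_of_real[symmetric])
  have "\<bar>Re (\<phi> x)\<bar> \<le> K * norm x" if "x \<in> Y" for x
    using abs_Re_le_cmod[of "\<phi> x"] \<phi>(3)[OF that] by linarith
  moreover have "Re (\<phi> (x + y)) = Re (\<phi> x) + Re (\<phi> y)" if "x \<in> Y" "y \<in> Y" for x y
    using that by (simp add: \<phi>(1))
  moreover have "Re (\<phi> (c *\<^sub>R x)) = c * Re (\<phi> x)" if "x \<in> Y" for c x
    using that by (simp add: \<phi>(2) sR)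
  ultimately obtain g where g: "linear g" "\<And>x. x \<in> Y \<Longrightarrow> g x = Re (\<phi> x)" "\<And>x. \<bar>g x\<bar> \<le> K * norm x"
    using Hahn_Banach_real[OF csubspace_imp_subspace[OF Y] K, of "\<lambda>x. Re (\<phi> x)"] by blast
  define \<psi> where "\<psi> x = Complex (g x) (- g (\<i> *\<^sub>C x))" for x
  have g_add: "g (x + y) = g x + g y" for x y by (rule linear_add[OF g(1)])
  have g_scale: "g (of_real r *\<^sub>C x) = r * g x" for r x using linear_scale[OF g(1), of r x] by (simp add: sR)
  have g_neg: "g (- x) = - g x" for x by (rule linear_neg[OF g(1)])
  have add: "\<psi> (x + y) = \<psi> x + \<psi> y" for x y
    by (simp add: \<psi>_def g_add scaleC_add_right complex_eq_iff)
  have scale: "\<psi> (c *\<^sub>C x) = c * \<psi> x" for c x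
  proof -
    have ii: "\<i> *\<^sub>C \<i> *\<^sub>C x = - x" by (simp add: scaleC_scaleC scaleC_one)
    have gc: "g (c *\<^sub>C y) = Re c * g y + Im c * g (\<i> *\<^sub>C y)" for y
    proof -
      have "c *\<^sub>C y = of_real (Re c) *\<^sub>C y + of_real (Im c) *\<^sub>C \<i> *\<^sub>C y"
        by (simp add: scaleC_scaleC mult.commute flip: scaleC_add_left complex_eq)
      from arg_cong[OF this, of g] show ?thesis by (simp only: g_add g_scale)
    qed
    have "\<i> *\<^sub>C c *\<^sub>C x = c *\<^sub>C \<i> *\<^sub>C x" by (simp add: scaleC_scaleC mult.commute)
    then show ?thesis
      using gc[of x] gc[of "\<i> *\<^sub>C x"] ii by (simp add: \<psi>_def complex_eq_iff g_neg mult.commute[of \<i> c])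
  qed
  have bound: "cmod (\<psi> x) \<le> K * norm x" for x
  proof (cases "\<psi> x = 0")
    case True
    then show ?thesis using K by simp
  next
    case False
    \<comment> \<open>Rotating \<open>x\<close> by \<open>u\<close> makes the value of
      \<open>\<psi>\<close> real and nonnegative, so the bound on the real part \<open>g\<close>
      controls the modulus.\<close>
    define u where "u = cnj (\<psi> x) / cmod (\<psi> x)"
    have nu: "cmod u = 1" using False by (simp add: u_def norm_divide)
    have "\<psi> (u *\<^sub>C x) = of_real (cmod (\<psi> x))"
      unfolding scale u_def using False complex_norm_square[of "\<psi> x"]
      by (simp add: field_simps power2_eq_square)
    then have "cmod (\<psi> x) = Re (\<psi> (u *\<^sub>C x))" by simp
    also have "\<dots> \<le> \<bar>g (u *\<^sub>C x)\<bar>" by (simp add: \<psi>_def)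
    also have "\<dots> \<le> K * norm (u *\<^sub>C x)" by (rule g(3))
    finally show ?thesis by (simp add: norm_scaleC nu)
  qed
  show thesis
  proof
    show "functional_bound K \<psi>" using add scale bound by (simp add: functional_bound_def)
    show "\<psi> x = \<phi> x" if x: "x \<in> Y" for x
    proof -
      have "\<i> *\<^sub>C x \<in> Y" using Y x by (rule csubspace_scale)
      then show ?thesis using g(2) x \<phi>(2)[OF x, of \<i>] by (simp add: \<psi>_def complex_eq_iff)
    qed
  qed
qed

text \<open>The functional is the coefficient of \<open>b\<close> on the span of \<open>Y\<close>
  and \<open>b\<close>, bounded by \<open>1 / d\<close>, extended by Hahn-Banach.\<close>

lemma functional_separating:
  fixes Y :: "'a::cbanach set"
  assumes Y: "csubspace Y" "closed Y" and b: "b \<notin> Y"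
  obtains \<psi> K where "functional_bound K \<psi>" "K \<ge> 0" "\<psi> b = 1" "\<And>y. y \<in> Y \<Longrightarrow> \<psi> y = 0"
proof -
  obtain d where d: "d > 0" "\<And>y a. y \<in> Y \<Longrightarrow> cmod a * d \<le> norm (y + a *\<^sub>C b)"
    using csubspace_coefficient_bound[OF Y b] by blast
  define Z where "Z = {y + a *\<^sub>C b | y a. y \<in> Y}"
  have a_unique: "a = a'" if "y \<in> Y" "y' \<in> Y" "y + a *\<^sub>C b = y' + a' *\<^sub>C b" for y y' a a'
  proof -
    have "(y - y') + (a - a') *\<^sub>C b = 0" using that(3) by (simp add: cvs.scale_left_diff_distrib algebra_simps)
    then have "cmod (a - a') * d \<le> 0" using d(2)[of "y - y'" "a - a'"] csubspace_diff[OF Y(1)] that by simp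
    then show ?thesis using d(1) by (simp add: mult_le_0_iff)
  qed
  define \<phi> where "\<phi> x = (THE a. \<exists>y\<in>Y. x = y + a *\<^sub>C b)" for x
  have \<phi>: "\<phi> (y + a *\<^sub>C b) = a" if "y \<in> Y" for y a
    unfolding \<phi>_def
  proof (rule the_equality)
    show "\<exists>y'\<in>Y. y + a *\<^sub>C b = y' + a *\<^sub>C b" using that by blast
    show "a' = a" if "\<exists>y'\<in>Y. y + a *\<^sub>C b = y' + a' *\<^sub>C b" for a'
      using that a_unique \<open>y \<in> Y\<close> by metis
  qed
  have lin: "(y + a *\<^sub>C b) + (y' + a' *\<^sub>C b) = (y + y') + (a + a') *\<^sub>C b"
    "c *\<^sub>C (y + a *\<^sub>C b) = c *\<^sub>C y + (c * a) *\<^sub>C b" for y y' a a' c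
    by (simp_all add: scaleC_add_left scaleC_add_right scaleC_scaleC algebra_simps)
  have sZ: "csubspace Z"
    unfolding csubspace_def
  proof (intro conjI ballI allI)
    show "0 \<in> Z" unfolding Z_def using csubspace_0[OF Y(1)] by (auto intro!: exI[of _ 0])
  next
    fix x x' assume "x \<in> Z" "x' \<in> Z"
    then show "x + x' \<in> Z" unfolding Z_def using lin(1) csubspace_add[OF Y(1)] by blast
  next
    fix c x assume "x \<in> Z"
    then show "c *\<^sub>C x \<in> Z" unfolding Z_def using lin(2) csubspace_scale[OF Y(1)] by blast
  qed
  have Z: "\<exists>y a. y \<in> Y \<and> x = y + a *\<^sub>C b" if "x \<in> Z" for x using that unfolding Z_def by blast
  have "cmod (\<phi> x) \<le> 1 / d * norm x" if "x \<in> Z" for x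
  proof -
    obtain y a where x: "y \<in> Y" "x = y + a *\<^sub>C b" using Z[OF \<open>x \<in> Z\<close>] by blast
    then show ?thesis using d(2)[OF x(1), of a] d(1) by (simp add: \<phi> field_simps)
  qed
  moreover have "\<phi> (c *\<^sub>C x) = c * \<phi> x" if "x \<in> Z" for c x
  proof -
    obtain y a where x: "y \<in> Y" "x = y + a *\<^sub>C b" using Z[OF \<open>x \<in> Z\<close>] by blast
    show ?thesis unfolding x(2) lin(2) using x(1) by (simp add: \<phi> csubspace_scale[OF Y(1)])
  qed
  moreover have "\<phi> (x + x') = \<phi> x + \<phi> x'" if "x \<in> Z" "x' \<in> Z" for x x'
  proof -
    obtain y a where x: "y \<in> Y" "x = y + a *\<^sub>C b" using Z[OF \<open>x \<in> Z\<close>] by blast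
    obtain y' a' where x': "y' \<in> Y" "x' = y' + a' *\<^sub>C b" using Z[OF \<open>x' \<in> Z\<close>] by blast
    show ?thesis unfolding x(2) x'(2) lin(1) using x(1) x'(1) by (simp add: \<phi> csubspace_add[OF Y(1)])
  qed
  moreover have "0 \<le> 1 / d" using d by simp
  ultimately obtain \<psi> where \<psi>: "functional_bound (1 / d) \<psi>" "\<And>x. x \<in> Z \<Longrightarrow> \<psi> x = \<phi> x"
    using Hahn_Banach[OF sZ, of "1 / d" \<phi>] by blast
  show thesis
  proof
    show "0 \<le> 1 / d" using d by simp
    show "functional_bound (1 / d) \<psi>" by (rule \<psi>(1))
    have "0 + 1 *\<^sub>C b \<in> Z" unfolding Z_def using csubspace_0[OF Y(1)] by blast
    then show "\<psi> b = 1" using \<psi>(2)[of "0 + 1 *\<^sub>C b"] \<phi>[OF csubspace_0[OF Y(1)], of 1] by (simp add: scaleC_one)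
    fix y assume y: "y \<in> Y"
    then have "y + 0 *\<^sub>C b \<in> Z" unfolding Z_def by blast
    then show "\<psi> y = 0" using \<psi>(2)[of "y + 0 *\<^sub>C b"] \<phi>[OF y, of 0] by simp
  qed
qed

subsection \<open>The single-valued extension property\<close>

lemma functional_bound_diff:
  assumes "functional_bound K \<phi>" "functional_bound L \<psi>"
  shows "functional_bound (K + L) (\<lambda>x. \<phi> x - \<psi> x)"
  unfolding functional_bound_def
proof (intro conjI allI)
  fix x show "cmod (\<phi> x - \<psi> x) \<le> (K + L) * norm x"
    using assms norm_triangle_ineq4[of "\<phi> x" "\<psi> x"] unfolding functional_bound_def
    by (metis add_mono distrib_right order_trans)
qed (use assms in \<open>simp_all add: functional_bound_def algebra_simps\<close>)

lemma functional_bound_scale: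
  assumes "functional_bound K \<phi>"
  shows "functional_bound (cmod a * K) (\<lambda>x. a * \<phi> x)"
  unfolding functional_bound_def
proof (intro conjI allI)
  fix x
  have "cmod a * cmod (\<phi> x) \<le> cmod a * (K * norm x)"
    using assms by (intro mult_left_mono) (simp_all add: functional_bound_def)
  then show "cmod (a * \<phi> x) \<le> cmod a * K * norm x" by (simp add: norm_mult mult.assoc)
qed (use assms in \<open>simp_all add: functional_bound_def algebra_simps\<close>)

lemma bounded_cfunctional_diff:
  "bounded_cfunctional \<phi> \<Longrightarrow> bounded_cfunctional \<psi> \<Longrightarrow> bounded_cfunctional (\<lambda>x. \<phi> x - \<psi> x)"
  unfolding bounded_cfunctional_iff using functional_bound_diff by blast

lemma bounded_cfunctional_remainder:
  fixes a :: "nat \<Rightarrow> complex"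
  assumes "bounded_cfunctional \<phi>" "\<And>n. bounded_cfunctional (c n)"
  shows "bounded_cfunctional (\<lambda>x. \<phi> x - (\<Sum>n<N. a n * c n x))"
proof (induction N)
  case (Suc N)
  have "bounded_cfunctional (\<lambda>x. a N * c N x)"
    using assms(2) functional_bound_scale unfolding bounded_cfunctional_iff by blast
  from bounded_cfunctional_diff[OF Suc this] show ?case by (simp add: algebra_simps)
qed (simp add: assms)

lemma functional_bound_cong_bounded:
  assumes "bounded_cfunctional \<phi>" "\<And>x. cmod (\<phi> x) \<le> K * norm x"
  shows "functional_bound K \<phi>"
  using assms by (simp add: bounded_cfunctional_def functional_bound_def)

lemma functional_0: "bounded_cfunctional \<phi> \<Longrightarrow> \<phi> 0 = 0"
  unfolding bounded_cfunctional_def by (metis add_cancel_right_right)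

lemma dual_norm_bounds:
  assumes \<phi>: "functional_bound K \<phi>" and K: "K \<ge> 0"
  shows "0 \<le> dual_norm \<phi>" "dual_norm \<phi> \<le> K" "cmod (\<phi> x) \<le> dual_norm \<phi> * norm x"
proof -
  let ?S = "(\<lambda>x. cmod (\<phi> x)) ` {x. norm x \<le> 1}"
  have le: "cmod (\<phi> x) \<le> K" if "norm x \<le> 1" for x
  proof -
    have "cmod (\<phi> x) \<le> K * norm x" using \<phi> by (simp add: functional_bound_def)
    also have "\<dots> \<le> K * 1" using that K by (intro mult_left_mono)
    finally show ?thesis by simp
  qed
  then have bdd: "bdd_above ?S" by (intro bdd_aboveI[of _ K]) auto
  have upper: "cmod (\<phi> x) \<le> dual_norm \<phi>" if "norm x \<le> 1" for x
    unfolding dual_norm_def using that by (intro cSup_upper bdd) auto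
  have "0 \<le> cmod (\<phi> 0)" by simp
  also have "\<dots> \<le> dual_norm \<phi>" by (rule upper) simp
  finally show pos: "0 \<le> dual_norm \<phi>" .
  have "(0::'a) \<in> {x. norm x \<le> 1}" by simp
  then have "?S \<noteq> {}" by blast
  then show "dual_norm \<phi> \<le> K"
    unfolding dual_norm_def using le by (intro cSup_least) auto
  show "cmod (\<phi> x) \<le> dual_norm \<phi> * norm x"
  proof (cases "x = 0")
    case True
    have "bounded_cfunctional \<phi>" using \<phi> unfolding bounded_cfunctional_iff by blast
    then show ?thesis using functional_0[of \<phi>] True by simp
  next
    case False
    have "norm (of_real (1 / norm x) *\<^sub>C x) = 1" using False by (simp only: norm_scaleC norm_of_real) simp
    then have "cmod (\<phi> (of_real (1 / norm x) *\<^sub>C x)) \<le> dual_norm \<phi>" by (intro upper) simp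
    moreover have "\<phi> (of_real (1 / norm x) *\<^sub>C x) = of_real (1 / norm x) * \<phi> x"
      using \<phi> unfolding functional_bound_def by blast
    ultimately have "cmod (\<phi> x) / norm x \<le> dual_norm \<phi>" by (simp add: norm_mult norm_divide)
    then show ?thesis using False by (simp add: pos_divide_le_eq)
  qed
qed

text \<open>Convergence in the dual norm controls the values at each fixed \<open>x\<close>. This
  reduces the adjoint to scalar functions, to which the identity theorem applies.\<close>

lemma analytic_on_dual_imp_pointwise:
  assumes f: "analytic_on_dual D f"
  shows "analytic_on_X D (\<lambda>w. f w x)"
  unfolding analytic_on_X_def
proof
  fix z assume z: "z \<in> D"
  from f[unfolded analytic_on_dual_def, THEN conjunct2, THEN bspec, OF z]
  obtain r c where r: "r > 0" "ball z r \<subseteq> D" and c: "\<forall>n. bounded_cfunctional (c n)"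
    and lim: "\<forall>w\<in>ball z r. (\<lambda>N. dual_norm (\<lambda>x. f w x - (\<Sum>n<N. (w - z) ^ n * c n x))) \<longlonglongrightarrow> 0"
    by blast
  have "(\<lambda>n. (w - z) ^ n *\<^sub>C c n x) sums f w x" if w: "w \<in> ball z r" for w
  proof -
    let ?d = "\<lambda>N x. f w x - (\<Sum>n<N. (w - z) ^ n * c n x)"
    have fw: "bounded_cfunctional (f w)" using f w r unfolding analytic_on_dual_def by blast
    have le: "cmod (?d N x)
        \<le> dual_norm (?d N) * norm x" for N
    proof -
      obtain K where K: "functional_bound K (?d N)"
        using bounded_cfunctional_remainder[of "f w" c "\<lambda>n. (w - z) ^ n" N, OF fw c[rule_format]]
        unfolding bounded_cfunctional_iff by blast
      have "K * norm y \<le> \<bar>K\<bar> * norm y" for y :: 'a by (intro mult_right_mono) auto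
      then have "functional_bound \<bar>K\<bar> (?d N)"
        using K unfolding functional_bound_def by (meson order_trans)
      from dual_norm_bounds(3)[OF this] show ?thesis by simp
    qed
    have lim0: "(\<lambda>N. dual_norm (?d N) * norm x) \<longlonglongrightarrow> 0"
      using tendsto_mult[OF bspec[OF lim w] tendsto_const] by simp
    have "(\<lambda>N. ?d N x) \<longlonglongrightarrow> 0"
      by (rule Lim_null_comparison[OF always_eventually lim0], rule allI, rule le)
    from tendsto_diff[OF tendsto_const[of "f w x"] this]
    show ?thesis by (simp add: sums_def scaleC_complex_def)
  qed
  with r show "\<exists>r>0. ball z r \<subseteq> D \<and>
      (\<exists>c. \<forall>w\<in>ball z r. (\<lambda>n. (w - z) ^ n *\<^sub>C c n) sums f w x)"
    by (intro exI[of _ r] conjI exI[of _ "\<lambda>n. c n x"]) auto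
qed

text \<open>Aiming at a positive real \<open>t\<close> with tolerance \<open>t\<close> excludes 0,
  as the identity theorem requires zeros other than the centre.\<close>

lemma decomposable_regular_near_0:
  assumes "Riesz_decomposable T" and e: "\<epsilon> > 0"
  obtains \<mu> where "\<mu> \<noteq> 0" "cmod \<mu> < \<epsilon>" "bij_on UNIV (shift T \<mu>)"
proof -
  obtain M N where MN: "reduced_op M N T" "bij_on M T" "Riesz_on N T"
    using assms(1) by (rule decomposableE)
  obtain \<delta> where \<delta>: "\<delta> > 0" "\<And>\<nu> \<epsilon>. cmod \<nu> < \<delta> \<Longrightarrow> \<epsilon> > 0 \<Longrightarrow>
     \<exists>\<mu>. cmod (\<mu> - \<nu>) < \<epsilon> \<and> bij_on UNIV (shift T \<mu>)"
    using reduced_op.near_0_dense_bij[OF MN] by blast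
  define t where "t = min \<delta> \<epsilon> / 2"
  have t: "t > 0" "t < \<delta>" "2 * t \<le> \<epsilon>" using \<delta>(1) e by (auto simp: t_def)
  obtain \<mu> where \<mu>: "cmod (\<mu> - of_real t) < t" "bij_on UNIV (shift T \<mu>)"
    using \<delta>(2)[of "of_real t" t] t by auto
  have "\<mu> \<noteq> 0" using \<mu>(1) t(1) by auto
  moreover have "cmod \<mu> < \<epsilon>"
    using norm_triangle_ineq[of "\<mu> - of_real t" "of_real t"] \<mu>(1) t by simp
  ultimately show thesis using \<mu>(2) by (rule that)
qed

text \<open>At a regular point \<open>w\<close> injectivity of \<open>T - w\<close> forces
  \<open>f w = 0\<close>, and nonzero regular points accumulate at 0.\<close>

lemma decomposable_imp_SVEP:
  assumes T: "bounded_clinear T" and D: "Riesz_decomposable T"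
  shows "SVEP_at T 0"
  unfolding SVEP_at_def
proof (intro allI impI ballI, elim conjE)
  fix r :: real and f and \<mu> :: complex
  assume r: "r > 0" and f: "analytic_on_X (ball 0 r) f" and \<mu>: "\<mu> \<in> ball 0 r"
    and eq: "\<forall>\<mu>\<in>ball 0 r. T (f \<mu>) - \<mu> *\<^sub>C f \<mu> = 0"
  show "f \<mu> = 0"
  proof (rule analytic_on_X_zeros_imp_0[OF f r _ \<mu>])
    fix \<epsilon> :: real assume "\<epsilon> > 0"
    then have "min \<epsilon> r > 0" using r by simp
    then obtain w where w: "w \<noteq> 0" "cmod w < min \<epsilon> r" "bij_on UNIV (shift T w)"
      using decomposable_regular_near_0[OF D] by blast
    have "shift T w (f w) = shift T w 0"
      using eq w(2) by (simp add: shift_def clinear_0[OF bounded_clinear_clinear[OF T]])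
    then have "f w = 0" using w(3) unfolding bij_betw_def by (meson UNIV_I inj_onD)
    then show "\<exists>w. w \<noteq> 0 \<and> cmod (w - 0) < \<epsilon> \<and> f w = 0" using w by auto
  qed
qed

text \<open>Here surjectivity of \<open>T - w\<close> is used: every \<open>x\<close> is in its
  range, on which \<open>f w\<close> vanishes.\<close>

lemma decomposable_imp_SVEP_adjoint:
  assumes D: "Riesz_decomposable T"
  shows "SVEP_adjoint_at T 0"
  unfolding SVEP_adjoint_at_def
proof (intro allI impI ballI, elim conjE)
  fix r :: real and f and \<mu> :: complex and x
  assume r: "r > 0" and f: "analytic_on_dual (ball 0 r) f" and \<mu>: "\<mu> \<in> ball 0 r"
    and eq: "\<forall>\<mu>\<in>ball 0 r. \<forall>x. f \<mu> (T x) - \<mu> * f \<mu> x = 0"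
  show "f \<mu> x = 0"
  proof (rule analytic_on_X_zeros_imp_0[OF analytic_on_dual_imp_pointwise[OF f] r _ \<mu>])
    fix \<epsilon> :: real assume "\<epsilon> > 0"
    then have "min \<epsilon> r > 0" using r by simp
    then obtain w where w: "w \<noteq> 0" "cmod w < min \<epsilon> r" "bij_on UNIV (shift T w)"
      using decomposable_regular_near_0[OF D] by blast
    then have wr: "w \<in> ball 0 r" by simp
    obtain y where y: "x = T y - w *\<^sub>C y" using w(3) unfolding bij_betw_def shift_def by blast
    have lin: "f w (a + b) = f w a + f w b" "f w (c *\<^sub>C a) = c * f w a" for a b c
      using f wr unfolding analytic_on_dual_def bounded_cfunctional_def by blast+
    have "f w x = f w (T y) + f w ((- w) *\<^sub>C y)" unfolding y lin(1)[symmetric] by simp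
    also have "\<dots> = f w (T y) - w * f w y" unfolding lin(2) by simp
    also have "\<dots> = 0" using eq wr by blast
    finally show "\<exists>w. w \<noteq> 0 \<and> cmod (w - 0) < \<epsilon> \<and> f w x = 0" using w by auto
  qed
qed

section \<open>Power series of functionals and the adjoint\<close>

context
  fixes \<phi> :: "nat \<Rightarrow> 'a::cbanach \<Rightarrow> complex" and B C :: real
  assumes C: "C > 0" and B: "B \<ge> 0" and \<phi>: "\<And>n. functional_bound (B * C ^ n) (\<phi> n)"
begin

private lemma coeff_bound: "norm (\<phi> n x) \<le> (B * norm x) * C ^ n"
  using \<phi>[of n] by (simp add: functional_bound_def mult.commute mult.left_commute)

lemma recentred_functional:
  assumes r: "r > 0" "(cmod z + r) * C < 1"
  shows "bounded_cfunctional (\<lambda>x. recentred z (\<lambda>k. \<phi> k x) m)"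
proof -
  let ?t = "\<lambda>k x. (of_nat (k choose m) * z ^ (k - m)) *\<^sub>C \<phi> k x"
  have s: "summable (\<lambda>k. ?t k x)" for x
    by (rule summable_norm_cancel[OF summable_norm_recentred[OF C coeff_bound r]])
  have lin: "\<phi> k (x + y) = \<phi> k x + \<phi> k y" "\<phi> k (c *\<^sub>C x) = c * \<phi> k x" for k x y c
    using \<phi>[of k] unfolding functional_bound_def by blast+
  have "recentred z (\<lambda>k. \<phi> k (x + y)) m = recentred z (\<lambda>k. \<phi> k x) m + recentred z (\<lambda>k. \<phi> k y) m" for x y
    unfolding recentred_def suminf_add[OF s s] by (simp add: lin scaleC_add_right)
  moreover have "recentred z (\<lambda>k. \<phi> k (c *\<^sub>C x)) m = c * recentred z (\<lambda>k. \<phi> k x) m" for c x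
  proof -
    have "?t k (c *\<^sub>C x) = c * ?t k x" for k by (simp add: lin scaleC_complex_def)
    then show ?thesis unfolding recentred_def using suminf_mult[OF s, of c x] by simp
  qed
  moreover have "cmod (recentred z (\<lambda>k. \<phi> k x) m) \<le> norm x * (B / (1 - (cmod z + r) * C) / r ^ m)" for x
  proof -
    have "r ^ m > 0" using r(1) by simp
    with norm_recentred[OF C coeff_bound[of _ x] r, of m]
    have "cmod (recentred z (\<lambda>k. \<phi> k x) m) \<le> (B * norm x) / (1 - (cmod z + r) * C) / r ^ m"
      by (subst pos_le_divide_eq) auto
    also have "\<dots> = norm x * (B / (1 - (cmod z + r) * C) / r ^ m)" by simp
    finally show ?thesis .
  qed
  ultimately show ?thesis unfolding bounded_cfunctional_def by blast
qed

text \<open>Makes boundedness of the sum functional the case \<open>m = 0\<close> of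
  \<open>recentred_functional\<close>.\<close>

lemma recentred_0: "recentred w u 0 = (\<Sum>k. w ^ k *\<^sub>C u k)"
  by (simp add: recentred_def)

lemma analytic_on_dual_power_series:
  assumes "R * C \<le> 1"
  shows "analytic_on_dual (ball 0 R) (\<lambda>w x. \<Sum>n. w ^ n *\<^sub>C \<phi> n x)"
proof -
  have radius: "(R - cmod z) / 2 > 0" "(cmod z + (R - cmod z) / 2) * C < 1" if "z \<in> ball 0 R" for z :: complex
  proof -
    have zR: "cmod z < R" using that by simp
    then show "(R - cmod z) / 2 > 0" by simp
    have "cmod z + (R - cmod z) / 2 < R" using zR by (simp add: field_simps)
    then show "(cmod z + (R - cmod z) / 2) * C < 1"
      using C assms by (meson less_le_trans mult_strict_right_mono)
  qed
  have bf: "bounded_cfunctional (\<lambda>x. \<Sum>n. w ^ n *\<^sub>C \<phi> n x)" if "w \<in> ball 0 R" for w :: complex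
    using recentred_functional[OF radius[OF that], of 0] by (simp only: recentred_0)
  show ?thesis
    unfolding analytic_on_dual_def
  proof (intro conjI ballI)
    fix w :: complex assume "w \<in> ball 0 R"
    then show "bounded_cfunctional (\<lambda>x. \<Sum>n. w ^ n *\<^sub>C \<phi> n x)" by (rule bf)
  next
    fix z :: complex assume z: "z \<in> ball 0 R"
    define r where "r = (R - cmod z) / 2"
    have r: "r > 0" "(cmod z + r) * C < 1" using radius[OF z] by (simp_all add: r_def)
    have sub: "ball z r \<subseteq> ball 0 R"
    proof
      fix w assume "w \<in> ball z r"
      then have "cmod (w - z) < r" by (simp add: dist_norm norm_minus_commute)
      then show "w \<in> ball 0 R"
        using r(1) norm_triangle_ineq[of z "w - z"] by (simp add: r_def field_simps)
    qed
    let ?c = "\<lambda>n x. recentred z (\<lambda>k. \<phi> k x) n"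
    have c: "bounded_cfunctional (?c n)" for n by (rule recentred_functional[OF r])
    have conv: "(\<lambda>N. dual_norm (\<lambda>x. (\<Sum>n. w ^ n *\<^sub>C \<phi> n x) - (\<Sum>n<N. (w - z) ^ n * ?c n x))) \<longlonglongrightarrow> 0"
      if w: "w \<in> ball z r" for w
    proof -
      define h where "h = w - z"
      have h: "cmod h < r" using w by (simp add: h_def dist_norm norm_minus_commute)
      let ?L = "B / (1 - (cmod z + r) * C)"
      let ?d = "\<lambda>N x. (\<Sum>n. w ^ n *\<^sub>C \<phi> n x) - (\<Sum>n<N. (w - z) ^ n * ?c n x)"
      have L0: "?L \<ge> 0" using B r(2) by simp
      have "cmod (?d N x) \<le> ((cmod h / r) ^ N * ?L) * norm x" for N x
      proof -
        have "cmod (?d N x) \<le> (cmod h / r) ^ N * (B * norm x / (1 - (cmod z + r) * C))"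
          using recentred_remainder[OF C coeff_bound[of _ x] r less_imp_le[OF h], of N]
          by (simp add: h_def scaleC_complex_def)
        also have "\<dots> = ((cmod h / r) ^ N * ?L) * norm x" by simp
        finally show ?thesis .
      qed
      then have fb: "functional_bound ((cmod h / r) ^ N * ?L) (?d N)" for N
        using w sub by (intro functional_bound_cong_bounded bounded_cfunctional_remainder bf c) auto
      have nonneg: "0 \<le> (cmod h / r) ^ N * ?L" for N using L0 r(1) by (intro mult_nonneg_nonneg) simp_all
      note b = dual_norm_bounds(1,2)[OF fb nonneg]
      have "(\<lambda>N. (cmod h / r) ^ N * ?L) \<longlonglongrightarrow> 0 * ?L"
        using h r(1) by (intro tendsto_mult tendsto_const LIMSEQ_realpow_zero) auto
      then have lim: "(\<lambda>N. (cmod h / r) ^ N * ?L) \<longlonglongrightarrow> 0" by simp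
      show ?thesis
      proof (rule Lim_null_comparison[OF always_eventually lim], rule allI)
        fix N show "norm (dual_norm (?d N)) \<le> (cmod h / r) ^ N * ?L"
          using b[of N] by (simp only: real_norm_def abs_of_nonneg)
      qed
    qed
    show "\<exists>r>0. ball z r \<subseteq> ball 0 R \<and> (\<exists>c. (\<forall>n. bounded_cfunctional (c n)) \<and>
        (\<forall>w\<in>ball z r. (\<lambda>N. dual_norm (\<lambda>x. (\<Sum>n. w ^ n *\<^sub>C \<phi> n x) - (\<Sum>n<N. (w - z) ^ n * c n x))) \<longlonglongrightarrow> 0))"
      by (intro exI[of _ r] conjI exI[of _ ?c] allI ballI r(1) sub c conv)
  qed
qed

lemma adjoint_chain_eigenvector:
  assumes "cmod w * C < 1" and T0: "\<phi> 0 (T x) = 0" and T: "\<And>n. \<phi> (Suc n) (T x) = \<phi> n x"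
  shows "(\<Sum>n. w ^ n *\<^sub>C \<phi> n (T x)) - w * (\<Sum>n. w ^ n *\<^sub>C \<phi> n x) = 0"
proof -
  have s: "summable (\<lambda>n. w ^ n *\<^sub>C \<phi> n y)" for y
    by (rule summable_norm_cancel[OF summable_scaleC_power[OF C coeff_bound assms(1)]])
  have "(\<Sum>n. w ^ n *\<^sub>C \<phi> n (T x)) = (\<Sum>n. w ^ Suc n *\<^sub>C \<phi> (Suc n) (T x))"
    using suminf_split_head[OF s[of "T x"]] by (simp add: T0)
  also have "\<dots> = (\<Sum>n. w * (w ^ n *\<^sub>C \<phi> n x))" by (simp add: T scaleC_complex_def mult.assoc)
  also have "\<dots> = w * (\<Sum>n. w ^ n *\<^sub>C \<phi> n x)" by (rule suminf_mult[OF s])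
  finally show ?thesis by simp
qed

end

context reduced_op
begin

lemma SVEP_imp_inj:
  assumes K: "Kato_on M T" and S: "SVEP_at T 0"
  shows "inj_on T M"
proof (rule onM.inj_onI_ker, rule ccontr)
  fix x assume x: "x \<in> M" "T x = 0" "x \<noteq> 0"
  then have "x \<in> ker_on M T" by (simp add: ker_on_def)
  from onM.Kato_chain[OF K this] obtain u C where C: "C > 0" "\<And>n. norm (u n) \<le> norm x * C ^ n"
    and u: "u 0 = x" "\<And>n. u n \<in> M" "\<And>n. T (u (Suc n)) = u n" by metis
  define f where "f w = (\<Sum>n. w ^ n *\<^sub>C u n)" for w
  have R: "1 / C > 0" "1 / C * C \<le> 1" using C(1) by simp_all
  have "analytic_on_X (ball 0 (1 / C)) f"
    unfolding f_def[abs_def] by (rule analytic_on_X_power_series[OF C R(2)])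
  moreover have "\<forall>\<mu>\<in>ball 0 (1 / C). T (f \<mu>) - \<mu> *\<^sub>C f \<mu> = 0"
  proof
    fix \<mu> :: complex assume "\<mu> \<in> ball 0 (1 / C)"
    then have "cmod \<mu> * C < 1" using C(1) by (simp add: field_simps)
    from onM.chain_eigenvector(2)[OF C this _ u(2,3)] show "T (f \<mu>) - \<mu> *\<^sub>C f \<mu> = 0"
      using u(1) x(2) by (simp add: f_def)
  qed
  moreover have "0 \<in> ball (0::complex) (1 / C)" using R(1) by simp
  ultimately have "f 0 = 0" using S R(1) unfolding SVEP_at_def by blast
  moreover have "norm (f 0 - u 0) \<le> 0" using power_series_near_0[OF C, of 0] by (simp add: f_def)
  ultimately show False using u(1) x(3) by simp
qed

text \<open>The first functional separates \<open>b\<close> from the range of \<open>T\<close> on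
  \<open>M\<close>; each next one extends the previous functional, composed with the inverse of
  \<open>T\<close>, from that range by Hahn-Banach. Composition with \<open>proj\<close> makes all
  of them vanish on \<open>N\<close>, so the recursion holds on the whole space.\<close>

lemma adjoint_chain:
  assumes inj: "inj_on T M" and cl: "closed (T ` M)" and b: "b \<in> M" "b \<notin> T ` M"
  obtains \<phi> B C where "C > 0" "B \<ge> 0" "\<And>n. functional_bound (B * C ^ n) (\<phi> n)"
    "\<And>x. \<phi> 0 (T x) = 0" "\<phi> 0 b = 1" "\<And>n x. \<phi> (Suc n) (T x) = \<phi> n x"
proof -
  obtain c where c: "c > 0" "\<And>x. x \<in> M \<Longrightarrow> c * norm x \<le> norm (T x)"
    using onM.lower_bound[OF inj cl] by blast
  obtain P0 where P0: "P0 > 0" "\<And>x. norm (proj x) \<le> norm x * P0"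
    using bounded_linear.pos_bounded[OF bounded_clinear_linear[OF proj(1)]] by blast
  have sTM: "csubspace (T ` M)" by (rule csubspace_image[OF onM.csubspace onM.clinear])
  have comp: "functional_bound (K * P0) (\<lambda>x. \<psi> (proj x))" if "functional_bound K \<psi>" "K \<ge> 0" for K \<psi>
    unfolding functional_bound_def
  proof (intro conjI allI)
    fix x
    have "cmod (\<psi> (proj x)) \<le> K * norm (proj x)" using that(1) by (simp add: functional_bound_def)
    also have "\<dots> \<le> K * (norm x * P0)" using that(2) P0(2) by (intro mult_left_mono)
    finally show "cmod (\<psi> (proj x)) \<le> K * P0 * norm x" by (simp add: mult.commute mult.left_commute)
  qed (use that(1) in \<open>simp_all add: functional_bound_def proj_add proj_scale\<close>)
  obtain \<psi> K where \<psi>: "functional_bound K \<psi>" "K \<ge> 0" "\<psi> b = 1" "\<And>y. y \<in> T ` M \<Longrightarrow> \<psi> y = 0"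
    by (rule functional_separating[OF sTM cl b(2)]) (rule that)
  define B where "B = K * P0"
  \<comment> \<open>Each step costs a factor \<open>1 / c\<close> for inverting \<open>T\<close> and
    a factor \<open>P0\<close> for composing with \<open>proj\<close>.\<close>
  define C where "C = P0 / c"
  have C: "C > 0" using P0 c by (simp add: C_def)
  have B: "B \<ge> 0" using \<psi> P0 by (simp add: B_def)
  \<comment> \<open>Invariance under \<open>proj\<close> carries the recursion from \<open>M\<close>
    to all vectors; the clause for \<open>n = 0\<close> keeps the data of the starting functional
    through dependent choice.\<close>
  define Q where "Q n \<phi> \<longleftrightarrow> functional_bound (B * C ^ n) \<phi> \<and> (\<forall>x. \<phi> (proj x) = \<phi> x) \<and>
    (n = 0 \<longrightarrow> \<phi> b = 1 \<and> (\<forall>x. \<phi> (T x) = 0))" for n and \<phi> :: "'a \<Rightarrow> complex"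
  have Q0: "\<exists>\<phi>. Q 0 \<phi>"
  proof (rule exI[of _ "\<lambda>x. \<psi> (proj x)"])
    have "functional_bound (B * C ^ 0) (\<lambda>x. \<psi> (proj x))" using comp[OF \<psi>(1,2)] by (simp add: B_def)
    moreover have "\<psi> (proj (T x)) = 0" for x using \<psi>(4) proj(2) by (simp add: proj_T)
    ultimately show "Q 0 (\<lambda>x. \<psi> (proj x))"
      unfolding Q_def using proj(2,4) b(1) \<psi>(3) by simp
  qed
  have step: "\<exists>\<phi>'. Q (Suc n) \<phi>' \<and> (\<forall>x. \<phi>' (T x) = \<phi> x)" if Q: "Q n \<phi>" for n \<phi>
  proof -
    have fb: "functional_bound (B * C ^ n) \<phi>" and pr: "\<And>x. \<phi> (proj x) = \<phi> x"
      using Q by (simp_all add: Q_def)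
    have BC: "0 \<le> B * C ^ n" using B C by simp
    define \<eta> where "\<eta> y = \<phi> (inv_into M T y)" for y
    have \<eta>: "\<eta> (T m) = \<phi> m" if "m \<in> M" for m using that inj by (simp add: \<eta>_def)
    have lin: "\<phi> (x + y) = \<phi> x + \<phi> y" "\<phi> (a *\<^sub>C x) = a * \<phi> x" "cmod (\<phi> x) \<le> B * C ^ n * norm x" for x y a
      using fb unfolding functional_bound_def by blast+
    have e3: "cmod (\<eta> y) \<le> B * C ^ n / c * norm y" if "y \<in> T ` M" for y
    proof -
      obtain m where m: "m \<in> M" "y = T m" using \<open>y \<in> T ` M\<close> by blast
      have "norm m \<le> norm y / c" using c(2)[OF m(1)] c(1) m(2) by (simp add: pos_le_divide_eq mult.commute)
      then have "B * C ^ n * norm m \<le> B * C ^ n * (norm y / c)" using BC by (intro mult_left_mono)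
      then show ?thesis using lin(3)[of m] m by (simp add: \<eta>)
    qed
    have e1: "\<eta> (y + y') = \<eta> y + \<eta> y'" if "y \<in> T ` M" "y' \<in> T ` M" for y y'
    proof -
      obtain m m' where "m \<in> M" "y = T m" "m' \<in> M" "y' = T m'"
        using \<open>y \<in> T ` M\<close> \<open>y' \<in> T ` M\<close> by blast
      then show ?thesis
        using \<eta>[of "m + m'"] onM.mem_add by (simp add: onM.T_add \<eta> lin)
    qed
    have e2: "\<eta> (a *\<^sub>C y) = a * \<eta> y" if "y \<in> T ` M" for a y
    proof -
      obtain m where "m \<in> M" "y = T m" using \<open>y \<in> T ` M\<close> by blast
      then show ?thesis
        using \<eta>[of "a *\<^sub>C m"] onM.mem_scale by (simp add: onM.T_scale \<eta> lin)
    qed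
    have BCc: "0 \<le> B * C ^ n / c" using BC c(1) by simp
    obtain \<psi>' where \<psi>': "functional_bound (B * C ^ n / c) \<psi>'" "\<And>y. y \<in> T ` M \<Longrightarrow> \<psi>' y = \<eta> y"
      by (rule Hahn_Banach[OF sTM BCc e1 e2 e3]) (assumption | rule that)+
    have "functional_bound (B * C ^ Suc n) (\<lambda>x. \<psi>' (proj x))"
      using comp[OF \<psi>'(1) BCc] by (simp add: C_def mult.commute mult.left_commute)
    then have "Q (Suc n) (\<lambda>x. \<psi>' (proj x))" unfolding Q_def using proj(2,4) by simp
    moreover have "\<psi>' (proj (T x)) = \<phi> x" for x
      using \<psi>'(2)[of "T (proj x)"] proj(2)[of x] by (simp add: proj_T \<eta> pr)
    ultimately show ?thesis by blast
  qed
  obtain \<phi> where \<phi>: "\<And>n. Q n (\<phi> n)" "\<And>n x. \<phi> (Suc n) (T x) = \<phi> n x"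
    using dependent_nat_choice[of Q "\<lambda>n \<phi> \<phi>'. \<forall>x. \<phi>' (T x) = \<phi> x", OF Q0 step] by metis
  show thesis
  proof (rule that[OF C B])
    show "functional_bound (B * C ^ n) (\<phi> n)" for n using \<phi>(1)[of n] by (simp add: Q_def)
    show "\<phi> 0 (T x) = 0" "\<phi> 0 b = 1" for x using \<phi>(1)[of 0] by (simp_all add: Q_def)
    show "\<phi> (Suc n) (T x) = \<phi> n x" for n x by (rule \<phi>(2))
  qed
qed

text \<open>Injectivity comes first because the chain of functionals is built from the inverse of
  \<open>T\<close> on its range. A missing vector \<open>b\<close> would give a nonzero analytic
  family, with value 1 at \<open>b\<close> for \<open>w = 0\<close>.\<close>

lemma SVEP_adjoint_imp_surj:
  assumes inj: "inj_on T M" and cl: "closed (T ` M)" and S: "SVEP_adjoint_at T 0"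
  shows "T ` M = M"
proof (rule ccontr)
  assume "T ` M \<noteq> M"
  then obtain b where b: "b \<in> M" "b \<notin> T ` M" using onM.T_in by blast
  obtain \<phi> B C where C: "C > 0" "B \<ge> 0" "\<And>n. functional_bound (B * C ^ n) (\<phi> n)"
    and \<phi>: "\<And>x. \<phi> 0 (T x) = 0" "\<phi> 0 b = 1" "\<And>n x. \<phi> (Suc n) (T x) = \<phi> n x"
    by (rule adjoint_chain[OF inj cl b]) (rule that)
  have R: "1 / C > 0" "1 / C * C \<le> 1" using C(1) by simp_all
  define f where "f w x = (\<Sum>n. w ^ n *\<^sub>C \<phi> n x)" for w x
  have "analytic_on_dual (ball 0 (1 / C)) f"
    unfolding f_def[abs_def] by (rule analytic_on_dual_power_series[OF C R(2)])
  moreover have "\<forall>w\<in>ball 0 (1 / C). \<forall>x. f w (T x) - w * f w x = 0"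
  proof (intro ballI allI)
    fix w :: complex and x assume "w \<in> ball 0 (1 / C)"
    then have "cmod w * C < 1" using C(1) by (simp add: field_simps)
    from adjoint_chain_eigenvector[of C B \<phi> w T x, OF C this \<phi>(1,3)]
    show "f w (T x) - w * f w x = 0" by (simp add: f_def)
  qed
  moreover have "0 \<in> ball (0::complex) (1 / C)" using R(1) by simp
  ultimately have "f 0 b = 0" using S R(1) unfolding SVEP_adjoint_at_def by blast
  moreover have "norm (\<phi> n b) \<le> (B * norm b) * C ^ n" for n
    using C(3)[of n] by (simp add: functional_bound_def mult.commute mult.left_commute)
  from power_series_near_0[OF C(1) this, of 0] have "norm (f 0 b - \<phi> 0 b) \<le> 0" by (simp add: f_def)
  ultimately show False using \<phi>(2) by simp
qed

end

section \<open>The equivalences\<close>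

lemma GKRD_SVEP_imp_decomposable:
  assumes T: "bounded_clinear T" and G: "GKRD T" and S: "SVEP_at T 0" "SVEP_adjoint_at T 0"
  shows "Riesz_decomposable T"
proof -
  obtain M N where MN: "reduced_op M N T" "Kato_on M T" "Riesz_on N T"
    using G GKRD_iff[OF T] by blast
  interpret reduced_op M N T by (rule MN(1))
  have inj: "inj_on T M" by (rule SVEP_imp_inj[OF MN(2) S(1)])
  moreover have "T ` M = M"
    using SVEP_adjoint_imp_surj[OF inj _ S(2)] MN(2) by (simp add: Kato_on_def)
  ultimately show ?thesis
    unfolding Riesz_decomposable_def bij_betw_def using MN by blast
qed

theorem theorem2p6:
  fixes T :: "'a::cbanach \<Rightarrow> 'a"
  assumes inf_dim: "\<not> fin_cdim (UNIV :: 'a set)"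
    and T: "bounded_clinear T"
  shows
   "let
      c1 = (\<exists>M N. closed_direct_sum M N \<and> invariant T M \<and> invariant T N \<and>
                 invertible_on M T \<and> Riesz_on N T);
      c2 = (GKRD T \<and> 0 \<notin> interior (cspectrum T));
      c3 = (GKRD T \<and> SVEP_at T 0 \<and> SVEP_adjoint_at T 0);
      c4 = gen_Drazin_Riesz_invertible T;
      c5 = Riesz_quasipolar T;
      c6 = (\<exists>P. bounded_clinear P \<and> P \<circ> P = P \<and> T \<circ> P = P \<circ> T \<and>
                Browder (\<lambda>x. T x + P x) \<and> Riesz (T \<circ> P));
      c7 = (\<exists>M N. closed_direct_sum M N \<and> invariant T M \<and> invariant T N \<and>
                 Browder_on M T \<and> Riesz_on N T);
      c8 = (GKRD T \<and> \<not> (0 islimpt Browder_spectrum T));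
      c9 = (GKRD T \<and> 0 \<notin> interior (Browder_spectrum T))
    in (c1 \<longleftrightarrow> c2) \<and> (c1 \<longleftrightarrow> c3) \<and> (c1 \<longleftrightarrow> c4) \<and> (c1 \<longleftrightarrow> c5) \<and> (c1 \<longleftrightarrow> c6) \<and>
       (c1 \<longleftrightarrow> c7) \<and> (c1 \<longleftrightarrow> c8) \<and> (c1 \<longleftrightarrow> c9)"
proof -
  let ?D = "Riesz_decomposable T"
  note G = Riesz_decomposable_imp_GKRD[OF T]
  have c2: "?D \<longleftrightarrow> GKRD T \<and> 0 \<notin> interior (cspectrum T)"
    using G decomposable_notin_interior GKRD_near_bij_imp_decomposable[OF T]
      spectrum_imp_near_bij[OF T] by blast
  have c3: "?D \<longleftrightarrow> GKRD T \<and> SVEP_at T 0 \<and> SVEP_adjoint_at T 0"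
    using G decomposable_imp_SVEP[OF T] decomposable_imp_SVEP_adjoint GKRD_SVEP_imp_decomposable[OF T] by blast
  have c4: "?D \<longleftrightarrow> gen_Drazin_Riesz_invertible T"
    using decomposable_imp_gen_Drazin_Riesz gen_Drazin_Riesz_imp_decomposable[OF T] by blast
  have c5: "?D \<longleftrightarrow> Riesz_quasipolar T"
    using decomposable_imp_Riesz_quasipolar Riesz_quasipolar_imp_decomposable[OF T] by blast
  have c6: "?D \<longleftrightarrow> (\<exists>P. bounded_clinear P \<and> P \<circ> P = P \<and> T \<circ> P = P \<circ> T \<and>
                Browder (\<lambda>x. T x + P x) \<and> Riesz (T \<circ> P))"
    using decomposable_imp_Browder_perturbation Browder_perturbation_imp_decomposable[OF T] by blast
  \<comment> \<open>Interior points of a subset of the plane are accumulation points, so (viii)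
    implies (ix).\<close>
  have c98: "\<not> 0 islimpt Browder_spectrum T \<Longrightarrow> 0 \<notin> interior (Browder_spectrum T)"
    using interior_limit_point by blast
  have c9: "GKRD T \<Longrightarrow> 0 \<notin> interior (Browder_spectrum T) \<Longrightarrow> ?D"
    using GKRD_near_bij_imp_decomposable[OF T] Browder_spectrum_imp_near_bij[OF T] by blast
  have c8: "?D \<Longrightarrow> GKRD T \<and> \<not> 0 islimpt Browder_spectrum T"
    using G decomposable_not_islimpt by blast
  show ?thesis
    unfolding Let_def Riesz_decomposable_iff[OF T, symmetric]
      decomposable_iff_Browder_Riesz[OF T, symmetric]
    using c2 c3 c4 c5 c6 c98 c9 c8 by blast
qed

end
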